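(* Let $Z\in\mathcal Z$ and let $\mu\in\mathcal F_Z$. Then the metric measure space $(G,d_Z,\mu)$ has the Calderón–Zygmund property (CZP) with respect to the family $\mathcal D^Z$.
   Context: **Group setting.** $N$ is a stratified Lie group of step $S\ge 1$: simply connected, with Lie algebra $\mathfrak n=\bigoplus_{j=1}^S\mathfrak n_j$, $[\mathfrak n_i,\mathfrak n_j]\subset\mathfrak n_{i+j}$ (with $\mathfrak n_l=0$ for $l>S$), $\mathfrak n_1$ generating $\mathfrak n$. $dn$ is the Haar measure on $N$ (push-forward of Lebesgue measure by $\exp_N$). $A=(\mathbb R_+,\cdot)$ acts on $N$ by the automorphic dilations $D_a(\exp_N(\sum_j Y_j))=\exp_N(\sum_j a^jY_j)$, $Y_j\in\mathfrak n_j$. $G=N\rtimes A$ has product $(n,a)(n',a')=(nD_a(n'),aa')$, identity $1_G=(1_N,1)$, and right Haar measure $d\rho(n,a)=a^{-1}\,dn\,da$. Fix bases $\{\breve X_{j,i}:1\le i\le q_j\}$ of $\mathfrak n_j$. $d_N$ is the (left-invariant) Carnot–Carathéodory distance on $N$ for which $\breve X_{1,1},\dots,\breve X_{1,q_1}$ is an orthonormal horizontal frame. In the Lie algebra $\mathfrak g=\mathfrak n\oplus\mathfrak a$ of $G$, $X_0$ is the generator of $A$ with $\exp(tX_0)=(1_N,e^t)$, and $X_{j,i}$ is the left-invariant vector field on $G$ whose value at $1_G$ is $\breve X_{j,i}$. $d_G$ is the left-invariant Carnot–Carathéodory distance on $G$ for which $X_0,X_{1,1},\dots,X_{1,q_1}$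 is an orthonormal horizontal frame. $\langle\cdot,\cdot\rangle$ is the scalar product on $\mathfrak g$ making $\{X_0\}\cup\{X_{j,i}\}_{j,i}$ orthonormal, and $\mathcal Z=\{Z\in\mathfrak g:\langle Z,X_0\rangle=1\}$. For $Z\in\mathcal Z$, $n(t)\in N$ is defined by $\exp(tZ)=(n(t),e^t)$, $t\in\mathbb R$. **Flow measures.** A Borel measure $\mu$ on $G$ is a $Z$-flow measure if $d\mu=\varphi\,d\rho$ with $\varphi:G\to[0,\infty)$ satisfying $\varphi(x)=\varphi(x\exp(tZ))$ for all $x\in G$, $t\in\mathbb R$. Put $\mu_N(F)=\int_F\varphi(n,1)\,dn$ for Borel $F\subset N$. $\mathcal F_Z$ is the set of $Z$-flow measures $\mu$ such that $(N,d_N,\mu_N)$ is doubling, i.e. balls have positive finite measure and for every $C>1$ there is $D(\mu_N,C)>1$ with $\mu_N(B(x,Cr))\le D(\mu_N,C)\mu_N(B(x,r))$ for all $x\in N$, $r>0$. **Christ cubes.** For $\mu\in\mathcal F_Z$, fix a Christ decomposition of $(N,d_N,\mu_N)$: families $\mathcal Q_k$ ($k\in\mathbb Z$) of countably many pairwise disjoint open sets of $N$ ("cubes of generation $k$"), $\mathcal Q=\bigcup_k\mathcal Q_k$, and constants $\delta\in(0,1)$, $C_1,c>0$ such that: (i) $\mu_N(N\setminus\bigcup_{Q\in\mathcal Q_k}Q)=0$ for all $k$; (ii) each $Q\in\mathcal Q_k$ is contained in a unique $p_N(Q)\in\mathcal Q_{k-1}$ and is disjoint from every other element of $\mathcal Q_{k-1}$;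 (iii) for each $Q\in\mathcal Q_k$ there is $n_Q\in Q$ with $B_N(n_Q,c\delta^k)\subset Q\subset B_N(n_Q,C_1\delta^k)$; (iv) $\mu_N(p_N(Q))\le C_1\mu_N(Q)$ and $s_N(Q):=\{Q'\in\mathcal Q:p_N(Q')=Q\}$ has at most $C_1$ elements. It is assumed that $C_1\ge3$ and $\#s_N(Q)\ge2$ for all $Q$. **Cylinders.** For $E\subset N$, $r>1$, $a\in A$: $P_{r,E}(a)=\{(n,1)\exp(tZ):n\in E,\ t\in U_r(a)\}$, $U_r(a)=(\log(a/r),\log(ar))$. Fix $\gamma\ge5$ and $\lambda>e^3/\delta$. $P_{r,Q}(a)$ with $Q\in\mathcal Q_k$ is *admissible* if either $r>e$ and $ar^2\le\delta^k\le\lambda ar^\gamma$ ( *large* ), or $1<r\le e$ and $ae^2\log r\le\delta^k\le\lambda ae^2\log r$ ( *small* ). **The family $\mathcal D^Z$.** For an admissible $P=P_{r,Q}(a)$, the set of sons is $s(P)=\{P_{\sqrt r,Q}(a/\sqrt r),P_{\sqrt r,Q}(a\sqrt r)\}$ if both of these are admissible, and $s(P)=\{P_{r,Q'}(a):Q'\in s_N(Q)\}$ otherwise; $s^1(P)=s(P)$, $s^{m+1}(P)=\bigcup_{P'\in s^m(P)}s(P')$. Put $p^\downarrow(P)=P_{r^3,Q}(a/r^2)$, $p^\uparrow(P)=P_{r^2,Q}(ar)$, $p^\leftrightarrow(P)=P_{r,p_N(Q)}(a)$, and $\mathcal S(P)=\{P_{r,Q'}(a):Q'\in\mathcal Q_j\}$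 if $Q\in\mathcal Q_j$. Fix a large admissible $P_0=P_{r_0,Q_0}(1)$ and define recursively $P_{k+1}=p^\leftrightarrow(P_k)$ whenever this is admissible; at the successive values of $k$ for which it is not, $P_{k+1}$ is alternately $p^\uparrow(P_k)$ and $p^\downarrow(P_k)$, starting with $p^\uparrow$. For $k\ge0$ let $\mathcal S_k=\mathcal S(P_k)$; let $\widetilde{\mathcal S}_k=\emptyset$ if $P_{k+1}=p^\leftrightarrow(P_k)$ and $\widetilde{\mathcal S}_k=\mathcal S(P_{k+1}\setminus P_k)$ otherwise, where, if $P_k=P_{r,Q}(a)$, $P_{k+1}\setminus P_k$ stands (up to a null set) for the cylinder $P_{r,Q}(ar^2)$ when $P_{k+1}=p^\uparrow(P_k)$ and $P_{r^2,Q}(a/r^3)$ when $P_{k+1}=p^\downarrow(P_k)$. With $\widetilde{\mathcal S}_\ell^m=\bigcup_{P\in\widetilde{\mathcal S}_\ell}s^m(P)$, put $\mathcal D^Z_{-k}=\mathcal S_k\cup\widetilde{\mathcal S}_k\cup\bigcup_{\ell>k}\widetilde{\mathcal S}_\ell^{\ell-k}$ for $k\ge0$, $\mathcal D^Z_k=\bigcup_{P\in\mathcal D^Z_{k-1}}s(P)$ for $k\ge1$, and $\mathcal D^Z=\bigcup_{k\in\mathbb Z}\mathcal D^Z_k$. **Flow metric.** $d_Z((n,a),(n',a'))=d_G\big((n\,n(\log a)^{-1},a),(n'\,n(\log a')^{-1},a')\big)$. **CZP.** A metric measure space $(X,d,\mu)$ with $\mu(X)=\infty$ has the CZP if there is $C_0\ge1$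 such that for every $f\in L^1(\mu)$ and $\alpha>0$ there exist a countable family of sets $\mathcal E(f,\alpha)=\{E_j\}$, numbers $r_j>0$, points $x_j\in X$ and a decomposition $f=g+\sum_jb_j$ such that for every $j$: (a) $|g|\le C_0\alpha$ $\mu$-a.e.; (b) $b_j=0$ on $X\setminus E_j$; (c) $\sum_j\|b_j\|_1\le C_0\|f\|_1$ and $\int_{E_j}b_j\,d\mu=0$; (d) $E_j\subset B(x_j,C_0r_j)$; (e) $\sum_j\mu(E_j^* )\le\frac{C_0}{\alpha}\|f\|_1$, where $E_j^*=\{x:d(x,E_j)<r_j\}$. In this case, with $\mathcal E=\{E\in\mathcal E(f,\alpha):f\in L^1(\mu),\alpha>0\}$, the space has the CZP *with respect to the family* $\mathcal E$. *)

theory Defs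
  imports "HOL-Analysis.Analysis" "HOL-Algebra.Group"
begin

section \<open>Left-invariant geometry on a Lie group with a global chart\<close>

primrec C_k :: "nat \<Rightarrow> ('e::real_normed_vector \<Rightarrow> 'f::real_normed_vector) \<Rightarrow> bool" where
  "C_k 0 = (\<lambda>f. continuous_on UNIV f)"
| "C_k (Suc k) = (\<lambda>f. \<exists>f'. (\<forall>x. (f has_derivative f' x) (at x)) \<and> (\<forall>v. C_k k (\<lambda>x. f' x v)))"

definition smooth :: "('e::real_normed_vector \<Rightarrow> 'f::real_normed_vector) \<Rightarrow> bool" where
  "smooth f \<longleftrightarrow> (\<forall>k. C_k k f)"

text \<open>
  In this section \<open>M\<close> is a Lie group and \<open>\<kappa>\<close> an injective map to a Euclidean space whose
  restriction to \<open>carrier M\<close> is a global chart onto an open set. The tangent space at the identity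
  is identified with the Euclidean space through the differential of \<open>\<kappa>\<close> at the identity, and a
  left-invariant vector field with its value \<open>W\<close> there; \<open>left_field M \<kappa> W g\<close> is the value at \<open>g\<close>
  of that field, read in the chart.
\<close>

definition left_field ::
    "('m, 'r) monoid_scheme \<Rightarrow> ('m \<Rightarrow> 'e::real_normed_vector) \<Rightarrow> 'e \<Rightarrow> 'm \<Rightarrow> 'e" where
  "left_field M \<kappa> W g =
     vector_derivative (\<lambda>t. \<kappa> (g \<otimes>\<^bsub>M\<^esub> inv_into UNIV \<kappa> (\<kappa> \<one>\<^bsub>M\<^esub> + t *\<^sub>R W))) (at 0)"

definition lie_exp ::
    "('m, 'r) monoid_scheme \<Rightarrow> ('m \<Rightarrow> 'e::real_normed_vector) \<Rightarrow> 'e \<Rightarrow> 'm" where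
  "lie_exp M \<kappa> W =
     (THE g. \<exists>\<eta> :: real \<Rightarrow> 'm.
        (\<forall>t. \<eta> t \<in> carrier M) \<and>
        (\<forall>s t. \<eta> (s + t) = \<eta> s \<otimes>\<^bsub>M\<^esub> \<eta> t) \<and>
        ((\<lambda>t. \<kappa> (\<eta> t)) has_vector_derivative W) (at 0) \<and>
        g = \<eta> 1)"

text \<open>
  \<open>F\<close> is the (finite, linearly independent) set of tangent vectors declared to be an orthonormal
  horizontal frame, and \<open>u t W\<close> is the \<open>W\<close>-component of the velocity of \<open>\<eta>\<close>.
\<close>

definition horizontal_curve ::
    "('m, 'r) monoid_scheme \<Rightarrow> ('m \<Rightarrow> 'e::real_normed_vector) \<Rightarrow> 'e set \<Rightarrow>
     (real \<Rightarrow> 'm) \<Rightarrow> (real \<Rightarrow> 'e \<Rightarrow> real) \<Rightarrow> bool" where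
  "horizontal_curve M \<kappa> F \<eta> u \<longleftrightarrow>
     (\<forall>t\<in>{0..1}. \<eta> t \<in> carrier M) \<and>
     (\<lambda>t. \<kappa> (\<eta> t)) piecewise_C1_differentiable_on {0..1} \<and>
     (\<exists>K. finite K \<and>
        (\<forall>t\<in>{0..1} - K. ((\<lambda>t. \<kappa> (\<eta> t)) has_vector_derivative
            (\<Sum>W\<in>F. u t W *\<^sub>R left_field M \<kappa> W (\<eta> t))) (at t)))"

text \<open>
  Distances take values in \<^typ>\<open>ennreal\<close>, so that the infimum over the empty set is \<open>\<infinity>\<close>. For the two
  distances below, whose frames are bracket generating, all values are finite (Chow's theorem).
\<close>

definition cc_dist ::
    "('m, 'r) monoid_scheme \<Rightarrow> ('m \<Rightarrow> 'e::real_normed_vector) \<Rightarrow> 'e set \<Rightarrow> 'm \<Rightarrow> 'm \<Rightarrow> ennreal" where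
  "cc_dist M \<kappa> F g h =
     Inf {(\<integral>\<^sup>+ t\<in>{0..1}. ennreal (sqrt (\<Sum>W\<in>F. (u t W)\<^sup>2)) \<partial>lborel) |\<eta> u.
            horizontal_curve M \<kappa> F \<eta> u \<and> \<eta> 0 = g \<and> \<eta> 1 = h}"

definition dball :: "('x \<Rightarrow> 'x \<Rightarrow> ennreal) \<Rightarrow> 'x set \<Rightarrow> 'x \<Rightarrow> real \<Rightarrow> 'x set" where
  "dball d X x r = {y \<in> X. d x y < ennreal r}"

definition doubling :: "('x \<Rightarrow> 'x \<Rightarrow> ennreal) \<Rightarrow> 'x measure \<Rightarrow> bool" where
  "doubling d M \<longleftrightarrow>
     (\<forall>x\<in>space M. \<forall>r>0. 0 < emeasure M (dball d (space M) x r) \<and>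
                        emeasure M (dball d (space M) x r) < \<infinity>) \<and>
     (\<forall>C>1. \<exists>D>1. \<forall>x\<in>space M. \<forall>r>0.
        emeasure M (dball d (space M) x (C * r)) \<le> ennreal D * emeasure M (dball d (space M) x r))"


section \<open>Stratified groups and their extensions by dilations\<close>

text \<open>
  The Lie algebra is the vector space \<^typ>\<open>'v\<close>; \<open>layer j\<close> is its \<open>j\<close>-th layer (\<open>1 \<le> j \<le> step\<close>) and
  \<open>frame j 1, \<dots>, frame j (rank j)\<close> the chosen basis of that layer.
\<close>

record ('a, 'v) strat = "'a monoid" +
  expo :: "'v \<Rightarrow> 'a"
  step :: nat
  layer :: "nat \<Rightarrow> 'v set"
  rank :: "nat \<Rightarrow> nat"
  frame :: "nat \<Rightarrow> nat \<Rightarrow> 'v"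

abbreviation logN :: "('a, 'v) strat \<Rightarrow> 'a \<Rightarrow> 'v" where
  "logN N \<equiv> inv_into UNIV (expo N)"

text \<open>\<open>Ad N g Y\<close> is the differential at the identity of conjugation by \<open>g\<close>; the bracket is
  \<open>[X, Y] = ad X Y\<close>, i.e. that of left-invariant vector fields.\<close>

definition Ad :: "('a, 'v::real_normed_vector) strat \<Rightarrow> 'a \<Rightarrow> 'v \<Rightarrow> 'v" where
  "Ad N g Y = vector_derivative (\<lambda>t. logN N (g \<otimes>\<^bsub>N\<^esub> expo N (t *\<^sub>R Y) \<otimes>\<^bsub>N\<^esub> m_inv N g)) (at 0)"

definition bracket :: "('a, 'v::real_normed_vector) strat \<Rightarrow> 'v \<Rightarrow> 'v \<Rightarrow> 'v" where
  "bracket N X Y = vector_derivative (\<lambda>s. Ad N (expo N (s *\<^sub>R X)) Y) (at 0)"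

text \<open>
  A simply connected nilpotent Lie group is one whose exponential map is a global diffeomorphism, so
  its smooth structure is given by the single chart \<open>logN N\<close>; smoothness of the inversion is
  automatic, since it is \<open>Y \<mapsto> - Y\<close> in this chart.
\<close>

definition exponential_lie_group ::
    "('a::{second_countable_topology, t2_space}, 'v::euclidean_space) strat \<Rightarrow> bool" where
  "exponential_lie_group N \<longleftrightarrow>
     group N \<and> carrier N = UNIV \<and>
     homeomorphism UNIV UNIV (expo N) (logN N) \<and>
     smooth (\<lambda>(X, Y). logN N (expo N X \<otimes>\<^bsub>N\<^esub> expo N Y)) \<and>
     (\<forall>Y s t. expo N ((s + t) *\<^sub>R Y) = expo N (s *\<^sub>R Y) \<otimes>\<^bsub>N\<^esub> expo N (t *\<^sub>R Y))"

definition stratified_group ::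
    "('a::{second_countable_topology, t2_space}, 'v::euclidean_space) strat \<Rightarrow> bool" where
  "stratified_group N \<longleftrightarrow>
     exponential_lie_group N \<and>
     1 \<le> step N \<and> layer N (step N) \<noteq> {0} \<and>
     (\<forall>j\<in>{1..step N}. subspace (layer N j)) \<and>
     (\<forall>Y. \<exists>!y. y \<in> Pi\<^sub>E {1..step N} (layer N) \<and> Y = (\<Sum>j=1..step N. y j)) \<and>
     (\<forall>i\<in>{1..step N}. \<forall>j\<in>{1..step N}. \<forall>X\<in>layer N i. \<forall>Y\<in>layer N j.
        bracket N X Y \<in> (if i + j \<le> step N then layer N (i + j) else {0})) \<and>
     (\<lambda>W. subspace W \<and> (\<forall>X\<in>W. \<forall>Y\<in>W. bracket N X Y \<in> W)) hull layer N 1 = UNIV \<and>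
     (\<forall>j\<in>{1..step N}. inj_on (frame N j) {1..rank N j} \<and>
        independent (frame N j ` {1..rank N j}) \<and>
        span (frame N j ` {1..rank N j}) = layer N j)"

definition dil_alg :: "('a, 'v::euclidean_space) strat \<Rightarrow> real \<Rightarrow> 'v \<Rightarrow> 'v" where
  "dil_alg N a Y = (THE W. \<exists>y\<in>Pi\<^sub>E {1..step N} (layer N).
       Y = (\<Sum>j=1..step N. y j) \<and> W = (\<Sum>j=1..step N. a ^ j *\<^sub>R y j))"

definition dil :: "('a, 'v::euclidean_space) strat \<Rightarrow> real \<Rightarrow> 'a \<Rightarrow> 'a" where
  "dil N a n = expo N (dil_alg N a (logN N n))"

definition GA :: "('a, 'v::euclidean_space) strat \<Rightarrow> ('a \<times> real) monoid" where
  "GA N = \<lparr>carrier = {(n, a). 0 < a},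
           mult = (\<lambda>(n, a) (n', a'). (n \<otimes>\<^bsub>N\<^esub> dil N a n', a * a')),
           one = (\<one>\<^bsub>N\<^esub>, 1)\<rparr>"

text \<open>
  The Lie algebra of \<open>GA N\<close> is \<^typ>\<open>'v \<times> real\<close> through the chart \<open>chartG N\<close>: the generator of \<open>A\<close>,
  tangent to \<open>t \<mapsto> (\<one>, exp t)\<close>, is \<open>(0, 1)\<close>, and the field \<open>X\<^bsub>j,i\<^esub>\<close> is \<open>(frame N j i, 0)\<close>.
\<close>

definition chartG :: "('a, 'v) strat \<Rightarrow> 'a \<times> real \<Rightarrow> 'v \<times> real" where
  "chartG N = (\<lambda>(n, a). (logN N n, a))"

definition d_N :: "('a, 'v::euclidean_space) strat \<Rightarrow> 'a \<Rightarrow> 'a \<Rightarrow> ennreal" where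
  "d_N N = cc_dist N (logN N) (frame N 1 ` {1..rank N 1})"

definition d_G :: "('a, 'v::euclidean_space) strat \<Rightarrow> 'a \<times> real \<Rightarrow> 'a \<times> real \<Rightarrow> ennreal" where
  "d_G N = cc_dist (GA N) (chartG N) (insert (0, 1) ((\<lambda>i. (frame N 1 i, 0)) ` {1..rank N 1}))"

definition basis_g :: "('a, 'v::euclidean_space) strat \<Rightarrow> ('v \<times> real) set" where
  "basis_g N = insert (0, 1) {(frame N j i, 0) |j i. j \<in> {1..step N} \<and> i \<in> {1..rank N j}}"

text \<open>The scalar product making \<open>basis_g N\<close> orthonormal.\<close>

definition inner_g :: "('a, 'v::euclidean_space) strat \<Rightarrow> 'v \<times> real \<Rightarrow> 'v \<times> real \<Rightarrow> real" where
  "inner_g N Z W =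
     (\<Sum>b\<in>basis_g N. representation (basis_g N) Z b * representation (basis_g N) W b)"

definition Z_set :: "('a, 'v::euclidean_space) strat \<Rightarrow> ('v \<times> real) set" where
  "Z_set N = {Z. inner_g N Z (0, 1) = 1}"

definition flow :: "('a, 'v::euclidean_space) strat \<Rightarrow> 'v \<times> real \<Rightarrow> real \<Rightarrow> 'a \<times> real" where
  "flow N Z t = lie_exp (GA N) (chartG N) (t *\<^sub>R Z)"

definition flow_N :: "('a, 'v::euclidean_space) strat \<Rightarrow> 'v \<times> real \<Rightarrow> real \<Rightarrow> 'a" where
  "flow_N N Z t = fst (flow N Z t)"

definition d_Z ::
    "('a, 'v::euclidean_space) strat \<Rightarrow> 'v \<times> real \<Rightarrow> 'a \<times> real \<Rightarrow> 'a \<times> real \<Rightarrow> ennreal" where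
  "d_Z N Z = (\<lambda>(n, a) (n', a').
     d_G N (n \<otimes>\<^bsub>N\<^esub> m_inv N (flow_N N Z (ln a)), a) (n' \<otimes>\<^bsub>N\<^esub> m_inv N (flow_N N Z (ln a')), a'))"


section \<open>Flow measures\<close>

definition haar_N :: "('a::topological_space, 'v::euclidean_space) strat \<Rightarrow> 'a measure" where
  "haar_N N = distr lborel borel (expo N)"

definition right_haar_G ::
    "('a::topological_space, 'v::euclidean_space) strat \<Rightarrow> ('a \<times> real) measure" where
  "right_haar_G N = density (restrict_space (haar_N N \<Otimes>\<^sub>M lborel) (carrier (GA N)))
                            (\<lambda>(n, a). ennreal (1 / a))"

definition flow_measure_density ::
    "('a::topological_space, 'v::euclidean_space) strat \<Rightarrow> 'v \<times> real \<Rightarrow>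
     ('a \<times> real) measure \<Rightarrow> ('a \<times> real \<Rightarrow> real) \<Rightarrow> bool" where
  "flow_measure_density N Z \<mu> \<phi> \<longleftrightarrow>
     \<phi> \<in> borel_measurable (right_haar_G N) \<and>
     (\<forall>x\<in>carrier (GA N). 0 \<le> \<phi> x) \<and>
     (\<forall>x\<in>carrier (GA N). \<forall>t. \<phi> x = \<phi> (x \<otimes>\<^bsub>GA N\<^esub> flow N Z t)) \<and>
     \<mu> = density (right_haar_G N) (\<lambda>x. ennreal (\<phi> x))"

definition slice_measure ::
    "('a::topological_space, 'v::euclidean_space) strat \<Rightarrow> ('a \<times> real \<Rightarrow> real) \<Rightarrow> 'a measure" where
  "slice_measure N \<phi> = density (haar_N N) (\<lambda>n. ennreal (\<phi> (n, 1)))"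

text \<open>
  Membership of \<open>\<mu>\<close> in the class of flow measures with doubling slice. The density \<open>\<phi>\<close> is kept as an
  argument because the slice measure is defined through it (it is determined by \<open>\<mu>\<close> up to null sets
  that are invariant under the flow, so that the slice measure depends only on \<open>\<mu>\<close>).
\<close>

definition doubling_flow_measure ::
    "('a::topological_space, 'v::euclidean_space) strat \<Rightarrow> 'v \<times> real \<Rightarrow>
     ('a \<times> real) measure \<Rightarrow> ('a \<times> real \<Rightarrow> real) \<Rightarrow> bool" where
  "doubling_flow_measure N Z \<mu> \<phi> \<longleftrightarrow>
     flow_measure_density N Z \<mu> \<phi> \<and> doubling (d_N N) (slice_measure N \<phi>)"


section \<open>Christ cubes\<close>

text \<open>
  \<open>Q k\<close> is the set of cubes of generation \<open>k\<close>. Parents and sons are taken relative to an explicit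
  generation; the requirement of at least two sons below forces distinct generations to be disjoint,
  so that the generation is determined by the cube.
\<close>

definition cube_parent :: "(int \<Rightarrow> 'x set set) \<Rightarrow> int \<Rightarrow> 'x set \<Rightarrow> 'x set" where
  "cube_parent Q k E = (THE R. R \<in> Q (k - 1) \<and> E \<subseteq> R)"

definition cube_sons :: "(int \<Rightarrow> 'x set set) \<Rightarrow> int \<Rightarrow> 'x set \<Rightarrow> 'x set set" where
  "cube_sons Q k E = {E' \<in> Q (k + 1). cube_parent Q (k + 1) E' = E}"

definition christ_decomposition ::
    "('x::topological_space \<Rightarrow> 'x \<Rightarrow> ennreal) \<Rightarrow> 'x measure \<Rightarrow> (int \<Rightarrow> 'x set set) \<Rightarrow>
     real \<Rightarrow> real \<Rightarrow> real \<Rightarrow> bool" where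
  "christ_decomposition d M Q \<delta> C1 c \<longleftrightarrow>
     0 < \<delta> \<and> \<delta> < 1 \<and> 0 < C1 \<and> 0 < c \<and>
     (\<forall>k. countable (Q k) \<and> disjoint (Q k) \<and> (\<forall>E\<in>Q k. open E)) \<and>
     (\<forall>k. emeasure M (space M - \<Union>(Q k)) = 0) \<and>
     (\<forall>k. \<forall>E\<in>Q k. \<exists>!R. R \<in> Q (k - 1) \<and> E \<subseteq> R) \<and>
     (\<forall>k. \<forall>E\<in>Q k. \<forall>R\<in>Q (k - 1). R \<noteq> cube_parent Q k E \<longrightarrow> E \<inter> R = {}) \<and>
     (\<forall>k. \<forall>E\<in>Q k. \<exists>x\<in>E. dball d (space M) x (c * \<delta> powi k) \<subseteq> E \<and>
                            E \<subseteq> dball d (space M) x (C1 * \<delta> powi k)) \<and>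
     (\<forall>k. \<forall>E\<in>Q k. emeasure M (cube_parent Q k E) \<le> ennreal C1 * emeasure M E) \<and>
     (\<forall>k. \<forall>E\<in>Q k. finite (cube_sons Q k E) \<and> real (card (cube_sons Q k E)) \<le> C1)"


section \<open>Admissible cylinders and the family \<open>D\<^sup>Z\<close>\<close>

text \<open>
  The label \<open>(r, k, E, a)\<close> stands for the cylinder \<open>P\<^bsub>r,E\<^esub>(a)\<close> over a cube \<open>E\<close> of generation \<open>k\<close>. Since
  \<open>(n, t) \<mapsto> (n, 1) exp (t Z)\<close> is a bijection, a cylinder as a set determines its label, so all
  operations on cylinders may be defined on labels.
\<close>

type_synonym 'x cyl = "real \<times> int \<times> 'x set \<times> real"

fun cyl_set :: "('a, 'v::euclidean_space) strat \<Rightarrow> 'v \<times> real \<Rightarrow> 'a cyl \<Rightarrow> ('a \<times> real) set" where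
  "cyl_set N Z (r, k, E, a) =
     {(n, 1) \<otimes>\<^bsub>GA N\<^esub> flow N Z t |n t. n \<in> E \<and> t \<in> {ln (a / r)<..<ln (a * r)}}"

fun large_admissible ::
    "(int \<Rightarrow> 'x set set) \<Rightarrow> real \<Rightarrow> real \<Rightarrow> real \<Rightarrow> 'x cyl \<Rightarrow> bool" where
  "large_admissible Q \<delta> \<gamma> \<Lambda> (r, k, E, a) \<longleftrightarrow>
     E \<in> Q k \<and> 0 < a \<and> exp 1 < r \<and> a * r\<^sup>2 \<le> \<delta> powi k \<and> \<delta> powi k \<le> \<Lambda> * a * r powr \<gamma>"

fun small_admissible ::
    "(int \<Rightarrow> 'x set set) \<Rightarrow> real \<Rightarrow> real \<Rightarrow> 'x cyl \<Rightarrow> bool" where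
  "small_admissible Q \<delta> \<Lambda> (r, k, E, a) \<longleftrightarrow>
     E \<in> Q k \<and> 0 < a \<and> 1 < r \<and> r \<le> exp 1 \<and>
     a * (exp 1)\<^sup>2 * ln r \<le> \<delta> powi k \<and> \<delta> powi k \<le> \<Lambda> * a * (exp 1)\<^sup>2 * ln r"

definition admissible ::
    "(int \<Rightarrow> 'x set set) \<Rightarrow> real \<Rightarrow> real \<Rightarrow> real \<Rightarrow> 'x cyl \<Rightarrow> bool" where
  "admissible Q \<delta> \<gamma> \<Lambda> P \<longleftrightarrow> large_admissible Q \<delta> \<gamma> \<Lambda> P \<or> small_admissible Q \<delta> \<Lambda> P"

fun sons :: "(int \<Rightarrow> 'x set set) \<Rightarrow> real \<Rightarrow> real \<Rightarrow> real \<Rightarrow> 'x cyl \<Rightarrow> 'x cyl set" where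
  "sons Q \<delta> \<gamma> \<Lambda> (r, k, E, a) =
     (let P1 = (sqrt r, k, E, a / sqrt r); P2 = (sqrt r, k, E, a * sqrt r) in
      if admissible Q \<delta> \<gamma> \<Lambda> P1 \<and> admissible Q \<delta> \<gamma> \<Lambda> P2 then {P1, P2}
      else {(r, k + 1, E', a) |E'. E' \<in> cube_sons Q k E})"

primrec sons_iter ::
    "(int \<Rightarrow> 'x set set) \<Rightarrow> real \<Rightarrow> real \<Rightarrow> real \<Rightarrow> nat \<Rightarrow> 'x cyl \<Rightarrow> 'x cyl set" where
  "sons_iter Q \<delta> \<gamma> \<Lambda> 0 P = {P}"
| "sons_iter Q \<delta> \<gamma> \<Lambda> (Suc m) P = (\<Union>P'\<in>sons_iter Q \<delta> \<gamma> \<Lambda> m P. sons Q \<delta> \<gamma> \<Lambda> P')"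

fun p_down :: "'x cyl \<Rightarrow> 'x cyl" where
  "p_down (r, k, E, a) = (r ^ 3, k, E, a / r\<^sup>2)"

fun p_up :: "'x cyl \<Rightarrow> 'x cyl" where
  "p_up (r, k, E, a) = (r\<^sup>2, k, E, a * r)"

fun p_side :: "(int \<Rightarrow> 'x set set) \<Rightarrow> 'x cyl \<Rightarrow> 'x cyl" where
  "p_side Q (r, k, E, a) = (r, k - 1, cube_parent Q k E, a)"

text \<open>The set-theoretic differences of \<open>p_down P\<close>, respectively \<open>p_up P\<close>, and \<open>P\<close>, up to null sets.\<close>

fun rest_down :: "'x cyl \<Rightarrow> 'x cyl" where
  "rest_down (r, k, E, a) = (r\<^sup>2, k, E, a / r ^ 3)"

fun rest_up :: "'x cyl \<Rightarrow> 'x cyl" where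
  "rest_up (r, k, E, a) = (r, k, E, a * r\<^sup>2)"

fun same_type :: "(int \<Rightarrow> 'x set set) \<Rightarrow> 'x cyl \<Rightarrow> 'x cyl set" where
  "same_type Q (r, k, E, a) = {(r, k, E', a) |E'. E' \<in> Q k}"

text \<open>The main sequence \<open>P\<^sub>0, P\<^sub>1, \<dots>\<close>; the Boolean tells whether the next vertical enlargement is
  upwards.\<close>

primrec main_seq ::
    "(int \<Rightarrow> 'x set set) \<Rightarrow> real \<Rightarrow> real \<Rightarrow> real \<Rightarrow> 'x cyl \<Rightarrow> nat \<Rightarrow> 'x cyl \<times> bool" where
  "main_seq Q \<delta> \<gamma> \<Lambda> P0 0 = (P0, True)"
| "main_seq Q \<delta> \<gamma> \<Lambda> P0 (Suc k) =
     (let (P, up) = main_seq Q \<delta> \<gamma> \<Lambda> P0 k in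
      if admissible Q \<delta> \<gamma> \<Lambda> (p_side Q P) then (p_side Q P, up)
      else if up then (p_up P, False) else (p_down P, True))"

definition S_main ::
    "(int \<Rightarrow> 'x set set) \<Rightarrow> real \<Rightarrow> real \<Rightarrow> real \<Rightarrow> 'x cyl \<Rightarrow> nat \<Rightarrow> 'x cyl set" where
  "S_main Q \<delta> \<gamma> \<Lambda> P0 k = same_type Q (fst (main_seq Q \<delta> \<gamma> \<Lambda> P0 k))"

definition S_rest ::
    "(int \<Rightarrow> 'x set set) \<Rightarrow> real \<Rightarrow> real \<Rightarrow> real \<Rightarrow> 'x cyl \<Rightarrow> nat \<Rightarrow> 'x cyl set" where
  "S_rest Q \<delta> \<gamma> \<Lambda> P0 k =
     (let (P, up) = main_seq Q \<delta> \<gamma> \<Lambda> P0 k in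
      if admissible Q \<delta> \<gamma> \<Lambda> (p_side Q P) then {}
      else if up then same_type Q (rest_up P) else same_type Q (rest_down P))"

definition D_nonpos ::
    "(int \<Rightarrow> 'x set set) \<Rightarrow> real \<Rightarrow> real \<Rightarrow> real \<Rightarrow> 'x cyl \<Rightarrow> nat \<Rightarrow> 'x cyl set" where
  "D_nonpos Q \<delta> \<gamma> \<Lambda> P0 k =
     S_main Q \<delta> \<gamma> \<Lambda> P0 k \<union> S_rest Q \<delta> \<gamma> \<Lambda> P0 k \<union>
     (\<Union>l\<in>{k<..}. \<Union>P\<in>S_rest Q \<delta> \<gamma> \<Lambda> P0 l. sons_iter Q \<delta> \<gamma> \<Lambda> (l - k) P)"

primrec D_nonneg ::
    "(int \<Rightarrow> 'x set set) \<Rightarrow> real \<Rightarrow> real \<Rightarrow> real \<Rightarrow> 'x cyl \<Rightarrow> nat \<Rightarrow> 'x cyl set" where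
  "D_nonneg Q \<delta> \<gamma> \<Lambda> P0 0 = D_nonpos Q \<delta> \<gamma> \<Lambda> P0 0"
| "D_nonneg Q \<delta> \<gamma> \<Lambda> P0 (Suc k) = (\<Union>P\<in>D_nonneg Q \<delta> \<gamma> \<Lambda> P0 k. sons Q \<delta> \<gamma> \<Lambda> P)"

definition D_level ::
    "(int \<Rightarrow> 'x set set) \<Rightarrow> real \<Rightarrow> real \<Rightarrow> real \<Rightarrow> 'x cyl \<Rightarrow> int \<Rightarrow> 'x cyl set" where
  "D_level Q \<delta> \<gamma> \<Lambda> P0 k =
     (if k \<le> 0 then D_nonpos Q \<delta> \<gamma> \<Lambda> P0 (nat (- k)) else D_nonneg Q \<delta> \<gamma> \<Lambda> P0 (nat k))"

definition D_family ::
    "('a, 'v::euclidean_space) strat \<Rightarrow> 'v \<times> real \<Rightarrow>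
     (int \<Rightarrow> 'a set set) \<Rightarrow> real \<Rightarrow> real \<Rightarrow> real \<Rightarrow> 'a cyl \<Rightarrow> ('a \<times> real) set set" where
  "D_family N Z Q \<delta> \<gamma> \<Lambda> P0 = (\<Union>k. cyl_set N Z ` D_level Q \<delta> \<gamma> \<Lambda> P0 k)"


section \<open>The Calderon--Zygmund property\<close>

definition enlarge :: "('x \<Rightarrow> 'x \<Rightarrow> ennreal) \<Rightarrow> 'x set \<Rightarrow> 'x set \<Rightarrow> real \<Rightarrow> 'x set" where
  "enlarge d X E r = {x \<in> X. (INF y\<in>E. d x y) < ennreal r}"

text \<open>
  A Calderon--Zygmund decomposition of \<open>f\<close> at height \<open>\<alpha>\<close> with sets \<open>\<E> = {E j | j \<in> J}\<close>. The series
  of the \<open>b j\<close> converges absolutely almost everywhere. The enlarged sets are measured by the outer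
  measure, which is the measure on measurable sets, because \<^const>\<open>emeasure\<close> is \<open>0\<close> on non-measurable
  ones.
\<close>

definition CZ_decomposition ::
    "('x \<Rightarrow> 'x \<Rightarrow> ennreal) \<Rightarrow> 'x measure \<Rightarrow> real \<Rightarrow> ('x \<Rightarrow> complex) \<Rightarrow> real \<Rightarrow> 'x set set \<Rightarrow> bool" where
  "CZ_decomposition d M C0 f \<alpha> \<E> \<longleftrightarrow>
     (\<exists>(J :: nat set) (E :: nat \<Rightarrow> 'x set) (r :: nat \<Rightarrow> real) (x :: nat \<Rightarrow> 'x) g b.
        \<E> = E ` J \<and>
        (\<forall>j\<in>J. E j \<in> sets M \<and> 0 < r j \<and> x j \<in> space M \<and> integrable M (b j)) \<and>
        g \<in> borel_measurable M \<and>
        (AE y in M. ((\<lambda>j. b j y) has_sum (f y - g y)) J) \<and>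
        (AE y in M. norm (g y) \<le> C0 * \<alpha>) \<and>
        (\<forall>j\<in>J. \<forall>y\<in>space M - E j. b j y = 0) \<and>
        (\<Sum>\<^sub>\<infinity>j\<in>J. (\<integral>\<^sup>+ y. ennreal (norm (b j y)) \<partial>M)) \<le> ennreal C0 * (\<integral>\<^sup>+ y. ennreal (norm (f y)) \<partial>M) \<and>
        (\<forall>j\<in>J. (LINT y:E j|M. b j y) = 0) \<and>
        (\<forall>j\<in>J. E j \<subseteq> dball d (space M) (x j) (C0 * r j)) \<and>
        (\<Sum>\<^sub>\<infinity>j\<in>J. outer_measure_of M (enlarge d (space M) (E j) (r j)))
          \<le> ennreal (C0 / \<alpha>) * (\<integral>\<^sup>+ y. ennreal (norm (f y)) \<partial>M))"

text \<open>\<open>\<E> f \<alpha>\<close> is the family of sets chosen for \<open>f\<close> and \<open>\<alpha>\<close>, and \<open>\<F>\<close> the totality of the chosen sets.\<close>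

definition CZP_wrt :: "('x \<Rightarrow> 'x \<Rightarrow> ennreal) \<Rightarrow> 'x measure \<Rightarrow> 'x set set \<Rightarrow> bool" where
  "CZP_wrt d M \<F> \<longleftrightarrow>
     emeasure M (space M) = \<infinity> \<and>
     (\<exists>C0\<ge>1. \<exists>\<E> :: ('x \<Rightarrow> complex) \<Rightarrow> real \<Rightarrow> 'x set set.
        (\<forall>f \<alpha>. integrable M f \<longrightarrow> 0 < \<alpha> \<longrightarrow> CZ_decomposition d M C0 f \<alpha> (\<E> f \<alpha>)) \<and>
        \<F> = (\<Union>{\<E> f \<alpha> |f \<alpha>. integrable M f \<and> 0 < \<alpha>}))"

end

theory Submission
  imports Defs
begin

text \<open>
  In exponential coordinates every derivative needed is controlled by the adjoint action, so a
  linear map compatible with the bracket is a group homomorphism; hence the dilations are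
  automorphisms, and letting the dilation parameter tend to \<open>0\<close> shows that right translations
  preserve Lebesgue measure. The velocity at \<open>0\<close> of \<open>t \<mapsto> n D\<^bsub>exp t\<^esub>(n)\<^sup>-\<^sup>1\<close>, as a function of \<open>n\<close>, is
  dilation-homogeneous with invertible derivative at the identity, hence onto: every \<open>Z\<close> is
  conjugate to \<open>X\<^sub>0\<close> by an element of \<open>N\<close>. In the coordinates
  \<open>(n, b) \<mapsto> (n, 1) exp (ln b Z)\<close> the cylinders become products \<open>Q \<times> (a / r, a r)\<close>, the flow metric
  becomes \<open>d\<^sub>G\<close>, and \<open>\<mu>\<close> becomes \<open>\<mu>\<^sub>N \<times> db / b\<close>.

  A curve in \<open>G\<close> moves horizontally at speed \<open>b\<close> times its speed in \<open>N\<close>, so an admissible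
  cylinder has diameter comparable with \<open>ln r\<close>, and its neighbourhood of width \<open>ln r / 2\<close> lies in a
  product over a dilated cube, of comparable measure by doubling. The labels form a nested
  system with ancestors of unbounded measure, in which every generic point lies in arbitrarily small
  cylinders; the maximal cylinders on which the mean of \<open>\<bar>f\<bar>\<close> exceeds \<open>\<alpha>\<close> give the decomposition. A
  cylinder \<open>E\<close> of the family is itself realised as the decomposition of its indicator at height
  \<open>1\<close>, with \<open>g = f\<close> and \<open>b = 0\<close>.
\<close>

section \<open>Calculus in the exponential chart\<close>

text \<open>\<open>flow\<close> is a definite description, so nothing can be said about
  \<open>exp (t Z)\<close> before one-parameter subgroups are shown to exist and to be unique;
  conjugation yields them in closed form, and with that formula the continuity on which
  measurability of the coordinates rests. The two admissibility inequalities meet two opposite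
  requirements. The upper one bounds the diameter: points of a large cylinder are joined by climbing
  to height \<open>a * r powr \<gamma>\<close>, where horizontal motion is cheap, at a cost
  comparable with \<open>ln r\<close>. The lower one bounds the enlargement: a path of length
  \<open>ln r / 2\<close> ending in the cylinder moves in \<open>N\<close> by less than
  \<open>\<delta> powi k\<close>, the scale of the cube, and doubling of the slice measure absorbs
  this. The margins \<open>5 \<le> \<gamma>\<close> and \<open>exp 3 / \<delta> < \<Lambda>\<close>
  keep both inequalities alive when a cylinder is halved, cut along the sons of its cube, or
  enlarged. The measure of a cylinder is that of its base times \<open>2 * ln r\<close>, so parents
  and sons are compared factor by factor.\<close>

lemma has_vector_derivative_offset:
  fixes t :: real
  shows "((\<lambda>h. c (t + h)) has_vector_derivative v) (at 0) \<longleftrightarrow> (c has_vector_derivative v) (at t)"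
  by (simp add: has_vector_derivative_def has_derivative_at)

text \<open>The hypothesis has the form that a group law produces: the velocity at time
  \<open>t\<close>, read off at \<open>h = 0\<close> from a translate.\<close>

lemma zero_derivative_const:
  fixes c :: "real \<Rightarrow> 'b::real_normed_vector"
  assumes "\<And>t. ((\<lambda>h. c (t + h)) has_vector_derivative 0) (at 0)"
  shows "c t = c 0"
proof -
  have "(c has_vector_derivative 0) (at t)" for t
    using has_vector_derivative_offset[of c t 0] assms[of t] by (rule iffD1)
  then obtain k where "\<And>t. c t = k"
    using has_vector_derivative_zero_constant[of UNIV c] by auto
  then show ?thesis by simp
qed

text \<open>\<open>C_k\<close> merely asserts that some derivative exists. Uniqueness identifies it
  with \<open>frechet_derivative\<close>, so one named object carries both the first derivative and
  its differentiability in the base point.\<close>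

lemma C_k_2_frechet_derivative:
  assumes "C_k 2 f"
  shows "(f has_derivative frechet_derivative f (at x)) (at x)"
    and "\<exists>E. \<forall>x. ((\<lambda>x. frechet_derivative f (at x) v) has_derivative E x) (at x)"
proof -
  obtain f' where f': "\<And>x. (f has_derivative f' x) (at x)" "\<And>v. C_k 1 (\<lambda>x. f' x v)"
    using assms by (auto simp: numeral_2_eq_2)
  have eq: "frechet_derivative f (at x) = f' x" for x
    using frechet_derivative_at[OF f'(1)] by simp
  show "(f has_derivative frechet_derivative f (at x)) (at x)"
    using f'(1) eq by simp
  show "\<exists>E. \<forall>x. ((\<lambda>x. frechet_derivative f (at x) v) has_derivative E x) (at x)"
    using f'(2)[of v] eq by auto
qed

section \<open>The group law in exponential coordinates and its differential\<close>

locale exp_group =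
  fixes N :: "('a::{second_countable_topology, t2_space}, 'v::euclidean_space) strat"
  assumes exponential: "exponential_lie_group N"
begin

text \<open>The group law transported to the Lie algebra, that is, the Baker-Campbell-Hausdorff
  product. It is handled through its differential, never through its series.\<close>

definition star :: "'v \<Rightarrow> 'v \<Rightarrow> 'v" (infixl \<open>\<star>\<close> 70)
  where "X \<star> Y = logN N (expo N X \<otimes>\<^bsub>N\<^esub> expo N Y)"

lemma group_N: "group N" and carrier_N [simp]: "carrier N = UNIV"
  using exponential by (auto simp: exponential_lie_group_def)

lemma homeo: "homeomorphism UNIV UNIV (expo N) (logN N)"
  using exponential by (auto simp: exponential_lie_group_def)

lemma log_expo [simp]: "logN N (expo N X) = X"
  and expo_log [simp]: "expo N (logN N g) = g"
  using homeo by (auto simp: homeomorphism_def)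

lemma continuous_expo: "continuous_on UNIV (expo N)"
  and continuous_log: "continuous_on UNIV (logN N)"
  using homeo by (auto simp: homeomorphism_def)

lemma expo_eq_iff [simp]: "expo N X = expo N Y \<longleftrightarrow> X = Y"
  by (metis log_expo)

lemma expo_star: "expo N (X \<star> Y) = expo N X \<otimes>\<^bsub>N\<^esub> expo N Y"
  by (simp add: star_def)

lemma expo_add: "expo N ((s + t) *\<^sub>R Y) = expo N (s *\<^sub>R Y) \<otimes>\<^bsub>N\<^esub> expo N (t *\<^sub>R Y)"
  using exponential by (auto simp: exponential_lie_group_def)

lemma expo_0 [simp]: "expo N 0 = \<one>\<^bsub>N\<^esub>"
proof -
  have "expo N 0 \<otimes>\<^bsub>N\<^esub> expo N 0 = expo N 0"
    using expo_add[of 0 0 0] by simp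
  then show ?thesis
    using group.l_cancel_one'[OF group_N, of "expo N 0" "expo N 0"] by auto
qed

lemma log_one [simp]: "logN N \<one>\<^bsub>N\<^esub> = 0"
  using log_expo[of 0] by simp

lemma star_assoc: "(X \<star> Y) \<star> W = X \<star> (Y \<star> W)"
  using monoid.m_assoc[OF group.is_monoid[OF group_N], of "expo N X" "expo N Y" "expo N W"]
  by (simp add: star_def)

lemma star_0 [simp]: "X \<star> 0 = X" "0 \<star> X = X"
  using group_N by (simp_all add: star_def group.is_monoid monoid.r_one monoid.l_one)

lemma star_scale: "(s *\<^sub>R Y) \<star> (t *\<^sub>R Y) = (s + t) *\<^sub>R Y"
  by (simp add: star_def flip: expo_add)

lemma star_minus [simp]: "X \<star> - X = 0" "- X \<star> X = 0"
  using star_scale[of 1 X "-1"] star_scale[of "-1" X 1] by simp_all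

lemma star_cancel [simp]: "X \<star> (- X \<star> Y) = Y" "- X \<star> (X \<star> Y) = Y"
  by (simp_all flip: star_assoc)

lemma inv_expo: "inv\<^bsub>N\<^esub> (expo N X) = expo N (- X)"
  using group.inv_equality[OF group_N, of "expo N (- X)" "expo N X"] expo_star[of "- X" X] by simp

lemma minus_star: "- (X \<star> Y) = - Y \<star> - X"
  by (metis star_assoc star_cancel(1) star_minus(1) star_0(1))

definition dstar :: "'v \<times> 'v \<Rightarrow> 'v \<times> 'v \<Rightarrow> 'v"
  where "dstar p = frechet_derivative (\<lambda>(X, Y). X \<star> Y) (at p)"

lemma smooth_star: "smooth (\<lambda>(X, Y). X \<star> Y)"
  using exponential by (auto simp: exponential_lie_group_def star_def)

lemma has_derivative_star_dstar: "((\<lambda>(X, Y). X \<star> Y) has_derivative dstar p) (at p)"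
  unfolding dstar_def by (rule C_k_2_frechet_derivative(1)) (use smooth_star in \<open>auto simp: smooth_def\<close>)

lemma dstar_differentiable: "\<exists>E. \<forall>p. ((\<lambda>p. dstar p v) has_derivative E p) (at p)"
  unfolding dstar_def by (rule C_k_2_frechet_derivative(2)) (use smooth_star in \<open>auto simp: smooth_def\<close>)

lemma linear_dstar: "linear (dstar p)"
  using has_derivative_star_dstar has_derivative_linear by blast

lemma dstar_split: "dstar p (U, V) = dstar p (U, 0) + dstar p (0, V)"
  using linear_add[OF linear_dstar, of p "(U, 0)" "(0, V)"] by simp

lemma dstar_0 [simp]: "dstar p (0, 0) = 0"
  using linear_0[OF linear_dstar, of p] by (simp add: zero_prod_def)

lemma continuous_dstar: "continuous_on UNIV (\<lambda>p. dstar p v)"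
  using dstar_differentiable[of v] has_derivative_continuous continuous_at_imp_continuous_on by metis

text \<open>For a fixed vector the differential is continuous in the base point; expanding the
  vector in \<open>Basis\<close> gives joint continuity.\<close>

lemma continuous_on_dstar:
  assumes "continuous_on S f" "continuous_on S g"
  shows "continuous_on S (\<lambda>x. dstar (f x) (g x))"
proof -
  have "dstar (f x) (g x) = (\<Sum>b\<in>Basis. (g x \<bullet> b) *\<^sub>R dstar (f x) b)" for x
    by (subst euclidean_representation[of "g x", symmetric])
       (simp add: linear_sum[OF linear_dstar] linear_cmul[OF linear_dstar])
  moreover have "continuous_on S (\<lambda>x. dstar (f x) b)" for b
    using continuous_on_compose2[OF continuous_dstar assms(1)] by auto
  ultimately show ?thesis
    by (simp add: continuous_intros assms(2))
qed

lemma has_derivative_star: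
  assumes "(f has_derivative f') (at x within S)" "(g has_derivative g') (at x within S)"
  shows "((\<lambda>x. f x \<star> g x) has_derivative (\<lambda>h. dstar (f x, g x) (f' h, g' h))) (at x within S)"
proof -
  have "((\<lambda>x. (f x, g x)) has_derivative (\<lambda>h. (f' h, g' h))) (at x within S)"
    using assms by (rule has_derivative_Pair)
  from has_derivative_compose[OF this has_derivative_star_dstar] show ?thesis by simp
qed

lemma has_vector_derivative_star:
  assumes "(f has_vector_derivative f') (at t within S)" "(g has_vector_derivative g') (at t within S)"
  shows "((\<lambda>t. f t \<star> g t) has_vector_derivative dstar (f t, g t) (f', g')) (at t within S)"
  using has_derivative_star[OF assms[unfolded has_vector_derivative_def]]
    linear_cmul[OF linear_dstar, of "(f t, g t)" _ "(f', g')"]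
  by (simp add: has_vector_derivative_def)

lemma continuous_star:
  assumes "continuous_on S f" "continuous_on S g"
  shows "continuous_on S (\<lambda>x. f x \<star> g x)"
proof -
  have "continuous_on UNIV (\<lambda>(X, Y). X \<star> Y)"
    using has_derivative_star_dstar has_derivative_continuous continuous_at_imp_continuous_on by metis
  from continuous_on_compose2[OF this continuous_on_Pair[OF assms]] show ?thesis by simp
qed

lemma has_vector_derivative_scale: "((\<lambda>t. t *\<^sub>R Y) has_vector_derivative Y) (at t)"
  by (auto intro!: derivative_eq_intros)

lemma dstar_left [simp]: "dstar (X, 0) (U, 0) = U"
proof -
  have "((\<lambda>t. (X + t *\<^sub>R U) \<star> 0) has_vector_derivative dstar (X + 0 *\<^sub>R U, 0) (U, 0)) (at 0)"
    by (rule has_vector_derivative_star) (auto intro!: derivative_eq_intros)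
  moreover have "((\<lambda>t. (X + t *\<^sub>R U) \<star> 0) has_vector_derivative U) (at 0)"
    by (auto intro!: derivative_eq_intros)
  ultimately show ?thesis
    using vector_derivative_unique_at by fastforce
qed

lemma dstar_right [simp]: "dstar (0, Y) (0, V) = V"
proof -
  have "((\<lambda>t. 0 \<star> (Y + t *\<^sub>R V)) has_vector_derivative dstar (0, Y + 0 *\<^sub>R V) (0, V)) (at 0)"
    by (rule has_vector_derivative_star) (auto intro!: derivative_eq_intros)
  moreover have "((\<lambda>t. 0 \<star> (Y + t *\<^sub>R V)) has_vector_derivative V) (at 0)"
    by (auto intro!: derivative_eq_intros)
  ultimately show ?thesis
    using vector_derivative_unique_at by fastforce
qed

lemma dstar_origin [simp]: "dstar (0, 0) (U, V) = U + V"
  by (subst dstar_split) simp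

lemma has_vector_derivative_star_origin:
  assumes "(f has_vector_derivative f') (at t)" "(g has_vector_derivative g') (at t)" "f t = 0" "g t = 0"
  shows "((\<lambda>t. f t \<star> g t) has_vector_derivative f' + g') (at t)"
  using has_vector_derivative_star[OF assms(1,2)] assms(3,4) by simp

lemma star_zero_derivative:
  assumes "(f has_vector_derivative 0) (at t)"
  shows "((\<lambda>t. X \<star> f t) has_vector_derivative 0) (at t)" "((\<lambda>t. f t \<star> X) has_vector_derivative 0) (at t)"
  using has_vector_derivative_star[OF has_vector_derivative_const assms, of X]
    has_vector_derivative_star[OF assms has_vector_derivative_const, of X] by simp_all

text \<open>The group law replaces the uniqueness theorem for ordinary differential equations: a curve with
  constant logarithmic derivative, multiplied by the inverse one-parameter subgroup, is constant.\<close>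

lemma integral_curve_eq:
  assumes "\<And>t. ((\<lambda>h. - c t \<star> c (t + h)) has_vector_derivative Y) (at 0)"
  shows "c t = c 0 \<star> (t *\<^sub>R Y)"
proof -
  define w where "w t = c t \<star> ((- t) *\<^sub>R Y)" for t
  have "((\<lambda>h. w (t + h)) has_vector_derivative 0) (at 0)" for t
  proof -
    define q where "q h = (- c t \<star> c (t + h)) \<star> ((- h) *\<^sub>R Y)" for h
    have "((\<lambda>h. (- h) *\<^sub>R Y) has_vector_derivative - Y) (at 0)"
      by (auto intro!: derivative_eq_intros)
    from has_vector_derivative_star_origin[where f = "\<lambda>h. - c t \<star> c (t + h)", OF assms[of t] this]
    have "(q has_vector_derivative 0) (at 0)" by (simp add: q_def[abs_def])
    then have "((\<lambda>h. c t \<star> q h \<star> ((- t) *\<^sub>R Y)) has_vector_derivative 0) (at 0)"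
      by (intro star_zero_derivative)
    moreover have "c t \<star> q h \<star> ((- t) *\<^sub>R Y) = w (t + h)" for h
      by (simp only: q_def w_def star_assoc star_cancel star_scale) (simp add: algebra_simps)
    ultimately show ?thesis by simp
  qed
  then have "w t = w 0" by (rule zero_derivative_const)
  then have "c t \<star> ((- t) *\<^sub>R Y) \<star> (t *\<^sub>R Y) = c 0 \<star> (t *\<^sub>R Y)" by (simp add: w_def)
  then show ?thesis by (simp only: star_assoc star_scale) simp
qed

section \<open>Conjugation, the adjoint action and the bracket\<close>

definition conj :: "'v \<Rightarrow> 'v \<Rightarrow> 'v"
  where "conj X Y = X \<star> Y \<star> - X"

lemma conj_star: "conj X (Y \<star> Y') = conj X Y \<star> conj X Y'"
  by (simp add: conj_def star_assoc)

lemma conj_conj: "conj X (conj X' Y) = conj (X \<star> X') Y"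
  by (simp add: conj_def star_assoc minus_star)

lemma conj_0 [simp]: "conj 0 Y = Y" "conj X 0 = 0"
  by (simp_all add: conj_def)

lemma minus_conj: "- conj X Y = conj X (- Y)"
  by (simp add: conj_def star_assoc minus_star)

lemma has_vector_derivative_conj:
  assumes "(f has_vector_derivative f') (at t)" "(g has_vector_derivative g') (at t)"
  shows "((\<lambda>t. conj (f t) (g t)) has_vector_derivative
     dstar (f t \<star> g t, - f t) (dstar (f t, g t) (f', g'), - f')) (at t)"
  unfolding conj_def
  by (intro has_vector_derivative_star has_vector_derivative_minus assms)

text \<open>The curve \<open>t \<mapsto> conj X (t *\<^sub>R Y)\<close> is a one-parameter subgroup,
  so \<open>integral_curve_eq\<close> makes it \<open>t\<close> times its velocity, and that
  velocity depends linearly on \<open>Y\<close>. In this chart conjugation is therefore the adjoint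
  action itself.\<close>

lemma linear_conj: "linear (conj X)"
proof -
  define L where "L Y = dstar (X, - X) (dstar (X, 0) (0, Y), 0)" for Y
  have *: "((\<lambda>t. conj X (t *\<^sub>R Y)) has_vector_derivative L Y) (at 0)" for Y
    using has_vector_derivative_conj[OF has_vector_derivative_const has_vector_derivative_scale, of X Y 0]
    by (simp add: L_def)
  have "conj X Y = L Y" for Y
  proof -
    define c where "c t = conj X (t *\<^sub>R Y)" for t
    have "- c t \<star> c (t + h) = conj X (h *\<^sub>R Y)" for t h
      unfolding c_def minus_conj scaleR_minus_left[symmetric] conj_star[symmetric] star_scale by simp
    then have "c 1 = c 0 \<star> (1 *\<^sub>R L Y)"
      by (intro integral_curve_eq) (simp add: *)
    then show ?thesis by (simp add: c_def)
  qed
  moreover have "linear L"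
  proof (rule linearI)
    note lin = linear_add[OF linear_dstar, symmetric] linear_cmul[OF linear_dstar, symmetric]
    show "L (Y + Y') = L Y + L Y'" for Y Y' by (simp add: L_def lin)
    show "L (r *\<^sub>R Y) = r *\<^sub>R L Y" for r Y by (simp add: L_def lin)
  qed
  moreover have "conj X = L" using calculation by blast
  ultimately show ?thesis by simp
qed

lemma bounded_linear_conj: "bounded_linear (conj X)"
  using linear_conj linear_conv_bounded_linear by blast

lemma Ad_eq: "Ad N (expo N X) Y = conj X Y"
proof -
  have "Ad N (expo N X) Y = vector_derivative (\<lambda>t. conj X (t *\<^sub>R Y)) (at 0)"
    by (simp add: Ad_def conj_def inv_expo expo_star star_def)
  also have "\<dots> = vector_derivative (\<lambda>t. t *\<^sub>R conj X Y) (at 0)"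
    by (simp add: linear_cmul[OF linear_conj])
  also have "\<dots> = conj X Y"
    by (rule vector_derivative_at) (rule has_vector_derivative_scale)
  finally show ?thesis .
qed

lemma has_vector_derivative_conj_scale: "((\<lambda>s. conj (s *\<^sub>R X) Y) has_vector_derivative bracket N X Y) (at 0)"
proof -
  have "(\<lambda>s. conj (s *\<^sub>R X) Y) differentiable at 0"
    using has_vector_derivative_conj[OF has_vector_derivative_scale has_vector_derivative_const]
    by (auto simp: has_vector_derivative_def differentiable_def)
  then show ?thesis
    by (simp add: bracket_def Ad_eq vector_derivative_works)
qed

text \<open>In this form linearity in \<open>X\<close> is visible, since a differential is linear;
  linearity in \<open>Y\<close> comes instead from that of \<open>conj\<close>.\<close>

lemma bracket_eq: "bracket N X Y = dstar (Y, 0) (dstar (0, Y) (X, 0), - X)"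
proof -
  have "((\<lambda>s. conj (s *\<^sub>R X) Y) has_vector_derivative dstar (Y, 0) (dstar (0, Y) (X, 0), - X)) (at 0)"
    using has_vector_derivative_conj[OF has_vector_derivative_scale has_vector_derivative_const, of X Y 0] by simp
  with has_vector_derivative_conj_scale show ?thesis
    by (rule vector_derivative_unique_at)
qed

lemma linear_bracket_left: "linear (\<lambda>X. bracket N X Y)"
proof (rule linearI)
  note lin = linear_add[OF linear_dstar, symmetric] linear_cmul[OF linear_dstar, symmetric]
  show "bracket N (X + X') Y = bracket N X Y + bracket N X' Y" for X X'
    by (simp add: bracket_eq lin)
  show "bracket N (r *\<^sub>R X) Y = r *\<^sub>R bracket N X Y" for r X
    by (simp add: bracket_eq lin)
qed

lemma linear_bracket_right: "linear (bracket N X)"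
proof (rule linearI)
  show "bracket N X (Y + Y') = bracket N X Y + bracket N X Y'" for Y Y'
  proof (rule vector_derivative_unique_at[OF has_vector_derivative_conj_scale])
    show "((\<lambda>s. conj (s *\<^sub>R X) (Y + Y')) has_vector_derivative bracket N X Y + bracket N X Y') (at 0)"
      unfolding linear_add[OF linear_conj]
      by (intro has_vector_derivative_add has_vector_derivative_conj_scale)
  qed
  show "bracket N X (r *\<^sub>R Y) = r *\<^sub>R bracket N X Y" for r Y
  proof (rule vector_derivative_unique_at[OF has_vector_derivative_conj_scale])
    show "((\<lambda>s. conj (s *\<^sub>R X) (r *\<^sub>R Y)) has_vector_derivative r *\<^sub>R bracket N X Y) (at 0)"
      unfolding linear_cmul[OF linear_conj]
      by (rule bounded_linear.has_vector_derivative[OF bounded_linear_scaleR_right has_vector_derivative_conj_scale])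
  qed
qed

lemma has_vector_derivative_conj_at_0:
  assumes "(c has_vector_derivative c') (at 0)"
  shows "((\<lambda>h. conj (h *\<^sub>R X) (c h)) has_vector_derivative bracket N X (c 0) + c') (at 0)"
proof -
  have "dstar (c 0, 0) (dstar (0, c 0) (X, c'), - X) = bracket N X (c 0) + c'"
    by (simp only: bracket_eq dstar_split[of "(0, c 0)" X c'] dstar_right)
       (use linear_add[OF linear_dstar, of "(c 0, 0)" "(dstar (0, c 0) (X, 0), - X)" "(c', 0)"] in simp)
  with has_vector_derivative_conj[OF has_vector_derivative_scale assms, of X] show ?thesis by simp
qed

text \<open>The velocity of a curve translated back to the identity. Classically
  \<open>logder X\<close> is the operator (1 - exp (- ad X)) / ad X, the differential of the
  exponential map in the left trivialisation.\<close>

definition logder :: "'v \<Rightarrow> 'v \<Rightarrow> 'v"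
  where "logder X Y = dstar (- X, X) (0, Y)"

lemma has_vector_derivative_logder:
  assumes "(c has_vector_derivative c') (at t)"
  shows "((\<lambda>h. - c t \<star> c (t + h)) has_vector_derivative logder (c t) c') (at 0)"
  unfolding has_vector_derivative_offset[of "\<lambda>s. - c t \<star> c s"]
  using has_vector_derivative_star[OF has_vector_derivative_const assms, of "- c t"]
  by (simp add: logder_def)

text \<open>\<open>G s\<close> is the velocity at \<open>t = 0\<close> of exp (- s X) exp (s (X + t
  Y)). Splitting \<open>s + h\<close> in this product gives the cocycle rule \<open>G_add\<close>,
  which reduces the derivative at \<open>s\<close> to the one at \<open>0\<close>.\<close>

lemma has_vector_derivative_scaled_logder:
  "((\<lambda>s. s *\<^sub>R logder (s *\<^sub>R X) Y) has_vector_derivative conj (- (s *\<^sub>R X)) Y) (at s)"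
proof -
  define F where "F s t = - (s *\<^sub>R X) \<star> (s *\<^sub>R (X + t *\<^sub>R Y))" for s t
  define G where "G s = s *\<^sub>R logder (s *\<^sub>R X) Y" for s
  have F0: "F s 0 = 0" for s by (simp add: F_def)
  have FG: "(F s has_vector_derivative G s) (at 0)" for s
  proof -
    have "((\<lambda>t. s *\<^sub>R (X + t *\<^sub>R Y)) has_vector_derivative s *\<^sub>R Y) (at 0)"
      by (auto intro!: derivative_eq_intros)
    from has_vector_derivative_star[OF has_vector_derivative_const this, of "- (s *\<^sub>R X)"] show ?thesis
      using linear_cmul[OF linear_dstar, of "(- (s *\<^sub>R X), s *\<^sub>R X)" s "(0, Y)"]
      by (simp add: F_def[abs_def] G_def logder_def)
  qed
  have G_add: "G (s + h) = conj (- (s *\<^sub>R X)) (G h) + G s" for h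
  proof -
    have "F (s + h) t = conj (- (s *\<^sub>R X)) (F h t) \<star> F s t" for t
    proof -
      have "conj (- (s *\<^sub>R X)) (F h t) \<star> F s t
          = (- s) *\<^sub>R X \<star> ((- h) *\<^sub>R X) \<star> (h *\<^sub>R (X + t *\<^sub>R Y) \<star> (s *\<^sub>R (X + t *\<^sub>R Y)))"
        by (simp add: F_def conj_def star_assoc)
      also have "\<dots> = F (s + h) t"
        unfolding star_scale F_def by (simp add: algebra_simps)
      finally show ?thesis by simp
    qed
    then have "F (s + h) = (\<lambda>t. conj (- (s *\<^sub>R X)) (F h t) \<star> F s t)" by blast
    then have "(F (s + h) has_vector_derivative conj (- (s *\<^sub>R X)) (G h) + G s) (at 0)"
      using has_vector_derivative_star_origin[where f = "\<lambda>t. conj (- (s *\<^sub>R X)) (F h t)" and g = "F s",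
          OF bounded_linear.has_vector_derivative[OF bounded_linear_conj FG] FG]
      by (simp add: F0)
    with FG show ?thesis by (rule vector_derivative_unique_at)
  qed
  \<comment> \<open>The factor \<open>s\<close> vanishes at \<open>0\<close>, so the product rule
    leaves only \<open>logder 0 Y\<close>, which is \<open>Y\<close>.\<close>
  have "(G has_vector_derivative Y) (at 0)"
  proof -
    obtain E where E: "\<And>p. ((\<lambda>p. dstar p (0, Y)) has_derivative E p) (at p)"
      using dstar_differentiable by blast
    have "((\<lambda>s. (- (s *\<^sub>R X), s *\<^sub>R X)) has_derivative (\<lambda>s. (- (s *\<^sub>R X), s *\<^sub>R X))) (at 0)"
      by (auto intro!: derivative_eq_intros)
    from has_derivative_compose[OF this E]
    have "((\<lambda>s. logder (s *\<^sub>R X) Y) has_derivative (\<lambda>s. E (0, 0) (- (s *\<^sub>R X), s *\<^sub>R X))) (at 0)"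
      by (simp add: logder_def)
    from has_derivative_scaleR[OF has_derivative_ident this] show ?thesis
      by (simp add: G_def[abs_def] has_vector_derivative_def logder_def)
  qed
  from has_vector_derivative_add_const[THEN iffD2, OF bounded_linear.has_vector_derivative[OF bounded_linear_conj this]]
  have "((\<lambda>h. G (s + h)) has_vector_derivative conj (- (s *\<^sub>R X)) Y) (at 0)"
    by (simp add: G_add)
  then show ?thesis unfolding has_vector_derivative_offset[of G] by (simp add: G_def[abs_def])
qed

section \<open>Linear maps that preserve the bracket\<close>

context
  fixes T :: "'v \<Rightarrow> 'v"
  assumes linear_T: "linear T" and T_bracket: "\<And>X Y. T (bracket N X Y) = bracket N (T X) (T Y)"
begin

lemma bounded_linear_T: "bounded_linear T"
  using linear_T linear_conv_bounded_linear by blast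

text \<open>\<open>v\<close> conjugates on the source side and undoes the image of this on the
  target side. Its derivative consists of a bracket with \<open>- T X\<close> and the image under
  \<open>T\<close> of a bracket with \<open>X\<close>, which cancel because \<open>T\<close>
  preserves brackets.\<close>

lemma bracket_hom_conj: "T (conj X Y) = conj (T X) (T Y)"
proof -
  define v where "v s = conj ((- s) *\<^sub>R T X) (T (conj (s *\<^sub>R X) Y))" for s
  have "((\<lambda>h. v (s + h)) has_vector_derivative 0) (at 0)" for s
  proof -
    define Y0 where "Y0 = conj (s *\<^sub>R X) Y"
    define q where "q h = conj (h *\<^sub>R (- T X)) (T (conj (h *\<^sub>R X) Y0))" for h
    have "(q has_vector_derivative bracket N (- T X) (T Y0) + T (bracket N X Y0)) (at 0)"
      using has_vector_derivative_conj_at_0[OF bounded_linear.has_vector_derivative[OF bounded_linear_T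
            has_vector_derivative_conj_scale[of X Y0]], of "- T X"] by (simp add: q_def[abs_def])
    then have "(q has_vector_derivative 0) (at 0)"
      by (simp only: T_bracket linear_neg[OF linear_bracket_left]) simp
    from bounded_linear.has_vector_derivative[OF bounded_linear_conj this, of "(- s) *\<^sub>R T X"]
    have "((\<lambda>h. conj ((- s) *\<^sub>R T X) (q h)) has_vector_derivative 0) (at 0)" by simp
    moreover have "conj ((- s) *\<^sub>R T X) (q h) = v (s + h)" for h
    proof -
      have "h *\<^sub>R (- T X) = (- h) *\<^sub>R T X" by simp
      then show ?thesis
        unfolding q_def v_def Y0_def by (simp only: conj_conj star_scale) (simp add: add.commute)
    qed
    ultimately show ?thesis by simp
  qed
  then have "v 1 = v 0" by (rule zero_derivative_const)
  then have "conj (- T X) (T (conj X Y)) = T Y" by (simp add: v_def)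
  then have "conj (T X) (conj (- T X) (T (conj X Y))) = conj (T X) (T Y)" by simp
  then show ?thesis by (simp add: conj_conj)
qed

text \<open>With arguments and values scaled by \<open>s\<close>, both sides have derivatives in
  \<open>s\<close> that agree by \<open>bracket_hom_conj\<close>, and both vanish at
  \<open>s = 0\<close>; the claim is the value at \<open>s = 1\<close>.\<close>

lemma bracket_hom_logder: "T (logder X Y) = logder (T X) (T Y)"
proof -
  define v where "v s = T (s *\<^sub>R logder (s *\<^sub>R X) Y) - s *\<^sub>R logder (s *\<^sub>R T X) (T Y)" for s
  have "(v has_vector_derivative T (conj (- (s *\<^sub>R X)) Y) - conj (- (s *\<^sub>R T X)) (T Y)) (at s)" for s
    unfolding v_def
    by (intro has_vector_derivative_diff has_vector_derivative_scaled_logder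
        bounded_linear.has_vector_derivative[OF bounded_linear_T])
  then have "((\<lambda>h. v (s + h)) has_vector_derivative 0) (at 0)" for s
    unfolding has_vector_derivative_offset[of v]
    by (simp add: bracket_hom_conj linear_neg[OF linear_T] linear_cmul[OF linear_T])
  then have "v 1 = v 0" by (rule zero_derivative_const)
  then show ?thesis by (simp add: v_def linear_0[OF linear_T])
qed

text \<open>Since \<open>T\<close> intertwines logarithmic derivatives, \<open>t \<mapsto> T (X \<star> t Y)\<close> has constant logarithmic
  derivative \<open>T Y\<close>.\<close>

lemma bracket_hom_star: "T (X \<star> Y) = T X \<star> T Y"
proof -
  define c where "c t = X \<star> (t *\<^sub>R Y)" for t
  define c' where "c' t = dstar (X, t *\<^sub>R Y) (0, Y)" for t
  have c: "(c has_vector_derivative c' t) (at t)" for t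
    using has_vector_derivative_star[OF has_vector_derivative_const has_vector_derivative_scale, of X Y t]
    by (simp add: c_def[abs_def] c'_def)
  have "- c t \<star> c (t + h) = h *\<^sub>R Y" for t h
    unfolding c_def minus_star scaleR_minus_left[symmetric] star_assoc star_cancel star_scale by simp
  then have "logder (c t) (c' t) = Y" for t
    using vector_derivative_unique_at[OF has_vector_derivative_logder[OF c, of t] ] has_vector_derivative_scale[of Y 0]
    by simp
  then have "logder (T (c t)) (T (c' t)) = T Y" for t
    by (metis bracket_hom_logder)
  then have "((\<lambda>h. - T (c t) \<star> T (c (t + h))) has_vector_derivative T Y) (at 0)" for t
    using has_vector_derivative_logder[OF bounded_linear.has_vector_derivative[OF bounded_linear_T c], of t] by simp
  then have "T (c 1) = T (c 0) \<star> (1 *\<^sub>R T Y)" by (rule integral_curve_eq)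
  then show ?thesis by (simp add: c_def)
qed

end

end

section \<open>Dilations and orbits\<close>

lemma inv_into_UNIV_eq:
  assumes "\<And>x. f (g x) = x" "\<And>y. g (f y) = y"
  shows "inv_into UNIV f = g"
proof
  fix x
  have "inj f" using assms(2) by (metis injI)
  then show "inv_into UNIV f x = g x" using inv_into_f_f[of f UNIV "g x"] assms(1) by simp
qed

locale strat_group =
  fixes N :: "('a::{second_countable_topology, t2_space}, 'v::euclidean_space) strat"
  assumes stratified: "stratified_group N"
begin

sublocale exp_group N
  using stratified by unfold_locales (simp add: stratified_group_def)

lemma subspace_layer: "j \<in> {1..step N} \<Longrightarrow> subspace (layer N j)"
  and step_pos: "1 \<le> step N"
  and layer_unique: "\<exists>!y. y \<in> Pi\<^sub>E {1..step N} (layer N) \<and> Y = (\<Sum>j=1..step N. y j)"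
  using stratified by (auto simp: stratified_group_def)

lemma bracket_layer:
  assumes "i \<in> {1..step N}" "j \<in> {1..step N}" "X \<in> layer N i" "Y \<in> layer N j"
  shows "bracket N X Y \<in> (if i + j \<le> step N then layer N (i + j) else {0})"
proof -
  have "\<forall>i\<in>{1..step N}. \<forall>j\<in>{1..step N}. \<forall>X\<in>layer N i. \<forall>Y\<in>layer N j.
        bracket N X Y \<in> (if i + j \<le> step N then layer N (i + j) else {0})"
    using stratified unfolding stratified_group_def by (elim conjE)
  with assms show ?thesis by blast
qed

text \<open>The layer components form an extensional function, so identities between them are stated
  for indices in \<open>{1..step N}\<close> only.\<close>

definition comp :: "'v \<Rightarrow> nat \<Rightarrow> 'v"
  where "comp Y = (THE y. y \<in> Pi\<^sub>E {1..step N} (layer N) \<and> Y = (\<Sum>j=1..step N. y j))"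

lemma comp_mem: "comp Y \<in> Pi\<^sub>E {1..step N} (layer N)"
  and comp_sum: "(\<Sum>j=1..step N. comp Y j) = Y"
  using theI'[OF layer_unique[of Y]] by (auto simp: comp_def)

lemma comp_layer: "j \<in> {1..step N} \<Longrightarrow> comp Y j \<in> layer N j"
  using comp_mem by (auto simp: PiE_iff)

lemma comp_eqI:
  assumes "\<And>j. j \<in> {1..step N} \<Longrightarrow> y j \<in> layer N j" "Y = (\<Sum>j=1..step N. y j)" "j \<in> {1..step N}"
  shows "comp Y j = y j"
proof -
  have "restrict y {1..step N} \<in> Pi\<^sub>E {1..step N} (layer N) \<and> Y = (\<Sum>j=1..step N. restrict y {1..step N} j)"
    using assms by auto
  then have "comp Y = restrict y {1..step N}"
    unfolding comp_def using the1_equality[OF layer_unique] by blast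
  then show ?thesis using assms(3) by simp
qed

text \<open>One operator for three needs: the dilations (\<open>c j = a ^ j\<close>), their
  infinitesimal generator (\<open>c j = real j\<close>) and the inverse of that generator
  (\<open>c j = 1 / real j\<close>).\<close>

definition gscale :: "(nat \<Rightarrow> real) \<Rightarrow> 'v \<Rightarrow> 'v"
  where "gscale c Y = (\<Sum>j=1..step N. c j *\<^sub>R comp Y j)"

lemma comp_add: "j \<in> {1..step N} \<Longrightarrow> comp (Y + Y') j = comp Y j + comp Y' j"
  by (rule comp_eqI) (auto simp: sum.distrib comp_sum simp del: One_nat_def intro!: subspace_add[OF subspace_layer] comp_layer)

lemma comp_scale: "j \<in> {1..step N} \<Longrightarrow> comp (r *\<^sub>R Y) j = r *\<^sub>R comp Y j"
  by (rule comp_eqI) (auto simp: comp_sum simp del: One_nat_def simp flip: scaleR_sum_right intro!: subspace_scale[OF subspace_layer] comp_layer)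

lemma comp_gscale: "j \<in> {1..step N} \<Longrightarrow> comp (gscale c Y) j = c j *\<^sub>R comp Y j"
  by (rule comp_eqI) (auto simp: gscale_def intro!: subspace_scale[OF subspace_layer] comp_layer)

lemma linear_gscale: "linear (gscale c)"
  by (rule linearI)
     (auto simp: gscale_def comp_add comp_scale scaleR_add_right sum.distrib scaleR_sum_right intro!: sum.cong)

lemma gscale_gscale: "gscale c (gscale d Y) = gscale (\<lambda>j. c j * d j) Y"
  unfolding gscale_def[of c] gscale_def[of "\<lambda>j. c j * d j"] by (rule sum.cong) (auto simp: comp_gscale)

lemma gscale_cong: "(\<And>j. j \<in> {1..step N} \<Longrightarrow> c j = d j) \<Longrightarrow> gscale c Y = gscale d Y"
  by (simp add: gscale_def)

lemma gscale_1 [simp]: "gscale (\<lambda>j. 1) Y = Y"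
  by (simp add: gscale_def comp_sum del: One_nat_def)

lemma gscale_layer:
  assumes "j \<in> {1..step N}" "Y \<in> layer N j"
  shows "gscale c Y = c j *\<^sub>R Y"
proof -
  have "comp Y i = (if i = j then Y else 0)" if "i \<in> {1..step N}" for i
    using assms that by (intro comp_eqI) (auto intro: subspace_0[OF subspace_layer])
  then have "gscale c Y = (\<Sum>i=1..step N. if i = j then c j *\<^sub>R Y else 0)"
    unfolding gscale_def by (intro sum.cong) auto
  also have "\<dots> = c j *\<^sub>R Y" using assms by simp
  finally show ?thesis .
qed

abbreviation dl :: "real \<Rightarrow> 'v \<Rightarrow> 'v"
  where "dl a \<equiv> gscale (\<lambda>j. a ^ j)"

lemma dl_dl: "dl a (dl b Y) = dl (a * b) Y"
  by (simp add: gscale_gscale power_mult_distrib)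

lemma dl_one [simp]: "dl 1 Y = Y"
  by simp

text \<open>Layers are indexed from \<open>1\<close>, so \<open>0 ^ j\<close> kills each of them.
  Dilations thus extend continuously to the parameter \<open>0\<close>, where limits are
  evaluated.\<close>

lemma dl_zero [simp]: "dl 0 Y = 0"
  using gscale_cong[of "\<lambda>j. 0 ^ j" "\<lambda>j. 0" Y] by (simp add: gscale_def)

lemma dl_layer_1: "Y \<in> layer N 1 \<Longrightarrow> dl a Y = a *\<^sub>R Y"
  using gscale_layer[of 1 Y] step_pos by simp

lemma gscale_0 [simp]: "gscale c 0 = 0"
  by (rule linear_0[OF linear_gscale])

lemma gscale_minus: "gscale c (- Y) = - gscale c Y"
  by (rule linear_neg[OF linear_gscale])

lemma bounded_linear_gscale: "bounded_linear (gscale c)"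
  using linear_gscale linear_conv_bounded_linear by blast

lemma dil_alg_eq: "dil_alg N a Y = dl a Y"
  unfolding dil_alg_def
proof (rule the_equality)
  show "\<exists>y\<in>Pi\<^sub>E {1..step N} (layer N). Y = (\<Sum>j=1..step N. y j) \<and> dl a Y = (\<Sum>j=1..step N. a ^ j *\<^sub>R y j)"
    using comp_mem comp_sum by (intro bexI[of _ "comp Y"]) (auto simp: gscale_def)
next
  fix W
  assume "\<exists>y\<in>Pi\<^sub>E {1..step N} (layer N). Y = (\<Sum>j=1..step N. y j) \<and> W = (\<Sum>j=1..step N. a ^ j *\<^sub>R y j)"
  then obtain y where y: "y \<in> Pi\<^sub>E {1..step N} (layer N)" "Y = (\<Sum>j=1..step N. y j)"
    "W = (\<Sum>j=1..step N. a ^ j *\<^sub>R y j)" by blast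
  have "comp Y j = y j" if "j \<in> {1..step N}" for j
    using y that by (intro comp_eqI) (auto simp: PiE_iff)
  then show "W = dl a Y" using y(3) by (simp add: gscale_def)
qed

text \<open>Bilinearity reduces this to two homogeneous components, for which both sides carry the
  factor \<open>a ^ (i + j)\<close>.\<close>

lemma dl_bracket: "dl a (bracket N X Y) = bracket N (dl a X) (dl a Y)"
proof -
  have *: "dl a (bracket N (comp X i) (comp Y j)) = bracket N (a ^ i *\<^sub>R comp X i) (a ^ j *\<^sub>R comp Y j)"
    if "i \<in> {1..step N}" "j \<in> {1..step N}" for i j
  proof -
    have mem: "bracket N (comp X i) (comp Y j) \<in> (if i + j \<le> step N then layer N (i + j) else {0})"
      using that by (intro bracket_layer comp_layer)
    have "dl a (bracket N (comp X i) (comp Y j)) = a ^ (i + j) *\<^sub>R bracket N (comp X i) (comp Y j)"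
    proof (cases "i + j \<le> step N")
      case True
      then show ?thesis using mem that by (intro gscale_layer) auto
    next
      case False
      then show ?thesis using mem by simp
    qed
    then show ?thesis
      by (simp only: linear_cmul[OF linear_bracket_left] linear_cmul[OF linear_bracket_right]) (simp add: power_add)
  qed
  have sums: "bracket N (\<Sum>i=1..step N. f i) (\<Sum>j=1..step N. g j)
      = (\<Sum>i=1..step N. \<Sum>j=1..step N. bracket N (f i) (g j))" for f g
    by (subst linear_sum[OF linear_bracket_left]) (simp add: linear_sum[OF linear_bracket_right])
  have "dl a (bracket N X Y) = dl a (bracket N (\<Sum>i=1..step N. comp X i) (\<Sum>j=1..step N. comp Y j))"
    by (simp only: comp_sum)
  also have "\<dots> = (\<Sum>i=1..step N. \<Sum>j=1..step N. dl a (bracket N (comp X i) (comp Y j)))"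
    by (simp only: sums linear_sum[OF linear_gscale])
  also have "\<dots> = bracket N (dl a X) (dl a Y)"
    unfolding gscale_def[of _ X] gscale_def[of _ Y] sums by (intro sum.cong refl *) auto
  finally show ?thesis .
qed

lemma dl_star: "dl a (X \<star> Y) = dl a X \<star> dl a Y"
  using dl_bracket by (intro bracket_hom_star linear_gscale)

lemma continuous_dl: "continuous_on S (\<lambda>a. dl a Y)"
  unfolding gscale_def by (intro continuous_intros)

lemma dil_expo: "dil N a (expo N Y) = expo N (dl a Y)"
  by (simp add: dil_def dil_alg_eq)

lemma dil_one [simp]: "dil N 1 n = n"
  by (simp add: dil_def dil_alg_eq)

lemma GA_simps [simp]:
  "x \<in> carrier (GA N) \<longleftrightarrow> 0 < snd x"
  "(n, a) \<otimes>\<^bsub>GA N\<^esub> (n', a') = (n \<otimes>\<^bsub>N\<^esub> dil N a n', a * a')"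
  "\<one>\<^bsub>GA N\<^esub> = (\<one>\<^bsub>N\<^esub>, 1)"
  by (auto simp: GA_def split: prod.splits)

lemma inv_into_log: "inv_into UNIV (logN N) = expo N"
  by (rule inv_into_UNIV_eq) auto

lemma inv_into_chartG: "inv_into UNIV (chartG N) = (\<lambda>(X, a). (expo N X, a))"
  by (rule inv_into_UNIV_eq) (auto simp: chartG_def)

lemma left_field_N: "left_field N (logN N) W g = dstar (logN N g, 0) (0, W)"
proof -
  have "((\<lambda>t. logN N g \<star> (t *\<^sub>R W)) has_vector_derivative dstar (logN N g, 0 *\<^sub>R W) (0, W)) (at 0)"
    by (intro has_vector_derivative_star has_vector_derivative_const has_vector_derivative_scale)
  then show ?thesis
    unfolding left_field_def inv_into_log by (simp add: star_def vector_derivative_at)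
qed

text \<open>Multiplying \<open>(n, b)\<close> on the right by
  \<open>(expo N (t *\<^sub>R W), 1)\<close> dilates the second factor by \<open>b\<close>, which on
  the first layer is multiplication by \<open>b\<close>. This factor accounts for the different
  horizontal speeds in \<open>G\<close> and in \<open>N\<close>.\<close>

lemma left_field_G:
  assumes "W \<in> layer N 1"
  shows "left_field (GA N) (chartG N) (W, 0) (n, b) = (b *\<^sub>R left_field N (logN N) W n, 0)"
proof -
  have "((\<lambda>t. logN N n \<star> (t *\<^sub>R (b *\<^sub>R W))) has_vector_derivative dstar (logN N n, 0 *\<^sub>R b *\<^sub>R W) (0, b *\<^sub>R W)) (at 0)"
    by (intro has_vector_derivative_star has_vector_derivative_const has_vector_derivative_scale)
  then have "((\<lambda>t. (logN N n \<star> (t *\<^sub>R (b *\<^sub>R W)), b)) has_vector_derivative (dstar (logN N n, 0) (0, b *\<^sub>R W), 0)) (at 0)"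
    by (auto intro!: derivative_eq_intros has_vector_derivative_Pair)
  moreover have "chartG N ((n, b) \<otimes>\<^bsub>GA N\<^esub> (expo N (t *\<^sub>R W), 1)) = (logN N n \<star> (t *\<^sub>R (b *\<^sub>R W)), b)" for t
    using assms by (simp add: chartG_def dil_expo star_def linear_cmul[OF linear_gscale] dl_layer_1)
  moreover have "dstar (logN N n, 0) (0, b *\<^sub>R W) = b *\<^sub>R dstar (logN N n, 0) (0, W)"
    using linear_cmul[OF linear_dstar, of "(logN N n, 0)" b "(0, W)"] by simp
  ultimately show ?thesis
    unfolding left_field_def[of "GA N"] inv_into_chartG left_field_N
    by (simp add: chartG_def[of N] vector_derivative_at del: GA_simps(2))
qed

lemma left_field_X0: "left_field (GA N) (chartG N) (0, 1) (n, b) = (0, b)"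
proof -
  have "((\<lambda>t. (logN N n, b * (1 + t))) has_vector_derivative (0, b)) (at 0)"
    by (auto intro!: derivative_eq_intros has_vector_derivative_Pair)
  moreover have "chartG N ((n, b) \<otimes>\<^bsub>GA N\<^esub> (expo N (t *\<^sub>R 0), 1 + t)) = (logN N n, b * (1 + t))" for t
    using dil_expo[of b 0] monoid.r_one[OF group.is_monoid[OF group_N], of n] by (simp add: chartG_def)
  ultimately show ?thesis
    unfolding left_field_def[of "GA N"] inv_into_chartG
    by (simp add: chartG_def[of N] vector_derivative_at del: GA_simps(2))
qed

text \<open>The curve being differentiated at \<open>h = 0\<close> is
  \<open>Y \<star> - dl (exp h) Y\<close>; \<open>gscale real\<close> generates the
  dilations.\<close>

definition orbit_velocity :: "'v \<Rightarrow> 'v"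
  where "orbit_velocity Y = dstar (Y, - Y) (0, - gscale real Y)"

lemma has_vector_derivative_dl_exp: "((\<lambda>t. dl (exp t) Y) has_vector_derivative gscale real Y) (at 0)"
  unfolding gscale_def
  by (rule has_vector_derivative_sum) (auto intro!: derivative_eq_intros)

lemma has_vector_derivative_orbit:
  "((\<lambda>h. Y \<star> - dl (exp h) Y) has_vector_derivative orbit_velocity Y) (at 0)"
  using has_vector_derivative_star[OF has_vector_derivative_const
      has_vector_derivative_minus[OF has_vector_derivative_dl_exp], of Y Y]
  by (simp add: orbit_velocity_def)

lemma dl_orbit_velocity: "dl a (orbit_velocity Y) = orbit_velocity (dl a Y)"
proof -
  have "((\<lambda>h. dl a (Y \<star> - dl (exp h) Y)) has_vector_derivative dl a (orbit_velocity Y)) (at 0)"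
    by (rule bounded_linear.has_vector_derivative[OF bounded_linear_gscale has_vector_derivative_orbit])
  moreover have "dl a (Y \<star> - dl (exp h) Y) = dl a Y \<star> - dl (exp h) (dl a Y)" for h
    by (simp only: dl_star gscale_minus dl_dl mult.commute)
  ultimately show ?thesis
    using vector_derivative_unique_at[OF _ has_vector_derivative_orbit[of "dl a Y"]] by simp
qed

lemma continuous_orbit_velocity: "continuous_on UNIV orbit_velocity"
  unfolding orbit_velocity_def
  by (intro continuous_on_dstar continuous_intros bounded_linear.continuous_on[OF bounded_linear_gscale])

text \<open>A differential varying with \<open>Y\<close> is applied to a vector depending linearly
  on \<open>Y\<close>. That vector vanishes at \<open>0\<close>, so only its own derivative survives
  the product rule, which the expansion in \<open>Basis\<close> makes applicable.\<close>

lemma has_derivative_orbit_velocity: "(orbit_velocity has_derivative (\<lambda>U. - gscale real U)) (at 0)"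
proof -
  define g where "g Y = - gscale real Y" for Y
  have g: "bounded_linear g"
    unfolding g_def by (intro bounded_linear_minus bounded_linear_gscale)
  have "\<exists>h'. ((\<lambda>Y. dstar (Y, - Y) (0, b)) has_derivative h') (at 0)" for b
  proof -
    obtain E where E: "\<And>p. ((\<lambda>p. dstar p (0, b)) has_derivative E p) (at p)"
      using dstar_differentiable by blast
    have "((\<lambda>Y. (Y, - Y)) has_derivative (\<lambda>Y. (Y, - Y))) (at 0)"
      by (auto intro!: derivative_eq_intros)
    from has_derivative_compose[OF this E] show ?thesis by blast
  qed
  then obtain h' where h': "\<And>b. ((\<lambda>Y. dstar (Y, - Y) (0, b)) has_derivative h' b) (at 0)" by metis
  have "((\<lambda>Y. \<Sum>b\<in>Basis. (g Y \<bullet> b) *\<^sub>R dstar (Y, - Y) (0, b)) has_derivative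
      (\<lambda>U. \<Sum>b\<in>Basis. (g 0 \<bullet> b) *\<^sub>R h' b U + (g U \<bullet> b) *\<^sub>R dstar (0, - 0) (0, b))) (at 0)"
    by (intro has_derivative_sum has_derivative_scaleR has_derivative_inner_left h'
        bounded_linear.has_derivative[OF g] has_derivative_ident)
  moreover have "(\<Sum>b\<in>Basis. (g Y \<bullet> b) *\<^sub>R dstar (Y, - Y) (0, b)) = orbit_velocity Y" for Y
  proof -
    have "(0, g Y) = (\<Sum>b\<in>Basis. (g Y \<bullet> b) *\<^sub>R (0::'v, b))"
      by (simp add: sum_prod euclidean_representation)
    then show ?thesis
      by (simp only: orbit_velocity_def g_def[symmetric] linear_sum[OF linear_dstar] linear_cmul[OF linear_dstar])
  qed
  moreover have "g 0 = 0" by (simp add: g_def)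
  ultimately have "(orbit_velocity has_derivative g) (at 0)"
    by (simp add: euclidean_representation)
  then show ?thesis by (simp add: g_def[abs_def])
qed

text \<open>The open mapping theorem, which asks for continuity and an invertible derivative at
  \<open>0\<close>, puts a ball about \<open>0\<close> into the range. A small dilation moves
  \<open>W\<close> into that ball, and homogeneity moves the solution back.\<close>

lemma orbit_velocity_surj: "\<exists>Y. orbit_velocity Y = W"
proof -
  have "orbit_velocity 0 \<in> interior (range orbit_velocity)"
  proof (rule sussmann_open_mapping[OF open_UNIV continuous_orbit_velocity UNIV_I has_derivative_orbit_velocity])
    \<comment> \<open>Layer indices start at \<open>1\<close>, so the generator of the dilations can
      be inverted layer by layer.\<close>
    show "bounded_linear (\<lambda>Y. - gscale (\<lambda>j. 1 / real j) Y)"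
      by (intro bounded_linear_minus bounded_linear_gscale)
    have "gscale (\<lambda>j. real j * (1 / real j)) Y = Y" for Y
      using gscale_cong[of "\<lambda>j. real j * (1 / real j)" "\<lambda>j. 1" Y] by simp
    then show "(\<lambda>U. - gscale real U) \<circ> (\<lambda>Y. - gscale (\<lambda>j. 1 / real j) Y) = id"
      by (auto simp: gscale_minus gscale_gscale)
  qed auto
  moreover have "orbit_velocity 0 = 0"
    using linear_0[OF linear_dstar] by (simp add: orbit_velocity_def)
  ultimately obtain e where e: "0 < e" "ball 0 e \<subseteq> range orbit_velocity"
    by (metis mem_interior)
  have "isCont (\<lambda>a. dl a W) 0"
    using continuous_dl[of UNIV W] by (simp add: continuous_on_eq_continuous_at)
  then have "((\<lambda>a. dl a W) \<longlongrightarrow> 0) (at_right 0)"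
    unfolding isCont_def dl_zero filterlim_at_split by blast
  then have "\<forall>\<^sub>F a in at_right 0. dist (dl a W) 0 < e"
    using e(1) by (rule tendstoD)
  then have "\<forall>\<^sub>F a in at_right (0::real). 0 < a \<and> dist (dl a W) 0 < e"
    using eventually_at_right_less by (rule eventually_conj[rotated])
  then obtain a :: real where a: "0 < a" "dl a W \<in> ball 0 e"
    using eventually_happens'[OF trivial_limit_at_right_real] by (auto simp: dist_commute)
  with e(2) obtain Y where "dl a W = orbit_velocity Y" by blast
  then have "orbit_velocity (dl (1 / a) Y) = dl (1 / a) (dl a W)" by (simp add: dl_orbit_velocity)
  also have "\<dots> = W" using a(1) unfolding dl_dl by simp
  finally show ?thesis by blast
qed

end

lemma multiplicative_real_eq_exp:
  fixes \<beta> :: "real \<Rightarrow> real"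
  assumes pos: "\<And>s. 0 < \<beta> s" and mult: "\<And>s t. \<beta> (s + t) = \<beta> s * \<beta> t"
    and deriv: "(\<beta> has_vector_derivative k) (at 0)"
  shows "\<beta> s = exp (k * s)"
proof -
  define w where "w s = \<beta> s * exp (- (k * s))" for s
  have \<beta>0: "\<beta> 0 = 1" using mult[of 0 0] pos[of 0] by simp
  have "((\<lambda>h. w (s + h)) has_vector_derivative 0) (at 0)" for s
  proof -
    have "((\<lambda>h. w s * (\<beta> h * exp (- (k * h)))) has_real_derivative 0) (at 0)"
      by (rule derivative_eq_intros deriv[unfolded has_real_derivative_iff_has_vector_derivative[symmetric]] refl
          | simp add: \<beta>0)+
    moreover have "w s * (\<beta> h * exp (- (k * h))) = w (s + h)" for h
      by (simp add: w_def mult exp_add[symmetric] algebra_simps flip: exp_minus)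
    ultimately show ?thesis by (simp add: has_real_derivative_iff_has_vector_derivative)
  qed
  then have "w s = w 0" by (rule zero_derivative_const)
  then show ?thesis by (simp add: w_def \<beta>0 exp_minus field_simps)
qed

lemma has_vector_derivative_mult_const:
  fixes t x :: real
  shows "((\<lambda>h. t * h) has_vector_derivative t) (at x)" "((\<lambda>h. h * t) has_vector_derivative t) (at x)"
  unfolding has_real_derivative_iff_has_vector_derivative[symmetric]
  by (auto intro!: derivative_eq_intros)

section \<open>One-parameter subgroups of the extended group\<close>

context strat_group
begin

text \<open>The \<open>N\<close>-component of the conjugate of \<open>(\<one>, a)\<close> by
  \<open>(expo N Y, 1)\<close>.\<close>

definition orbit :: "'v \<Rightarrow> real \<Rightarrow> 'a"
  where "orbit Y a = expo N (Y \<star> - dl a Y)"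

text \<open>This cocycle rule makes \<open>a \<mapsto> (orbit Y a, a)\<close> respect products in
  \<open>GA N\<close>.\<close>

lemma orbit_dil: "orbit Y (a * b) = orbit Y a \<otimes>\<^bsub>N\<^esub> dil N a (orbit Y b)"
proof -
  have "dl a Y \<star> dl a (- dl b Y) = dl a Y \<star> - dl (a * b) Y"
    by (simp add: gscale_minus dl_dl)
  then show ?thesis
    by (simp add: orbit_def dil_expo expo_star[symmetric] dl_star star_assoc)
qed

text \<open>Conjugation by \<open>Y\<close> turns the one-parameter subgroup into one whose \<open>N\<close>-component has velocity \<open>0\<close>.\<close>

lemma one_parameter_subgroup_eq:
  assumes Y: "orbit_velocity Y = W"
    and carrier: "\<And>s. \<eta> s \<in> carrier (GA N)"
    and hom: "\<And>s s'. \<eta> (s + s') = \<eta> s \<otimes>\<^bsub>GA N\<^esub> \<eta> s'"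
    and deriv: "((\<lambda>s. chartG N (\<eta> s)) has_vector_derivative t *\<^sub>R (W, 1)) (at 0)"
  shows "\<eta> s = (orbit Y (exp (t * s)), exp (t * s))"
proof -
  define \<nu> where "\<nu> s = logN N (fst (\<eta> s))" for s
  define \<beta> where "\<beta> s = snd (\<eta> s)" for s
  have chart: "chartG N (\<eta> s) = (\<nu> s, \<beta> s)" for s
    by (simp add: chartG_def \<nu>_def \<beta>_def split: prod.splits)
  have eta: "\<eta> s = (expo N (\<nu> s), \<beta> s)" for s
    by (simp add: \<nu>_def \<beta>_def)
  have \<nu>': "(\<nu> has_vector_derivative t *\<^sub>R W) (at 0)"
    using bounded_linear.has_vector_derivative[OF bounded_linear_fst deriv] by (simp add: chart)
  have \<beta>': "(\<beta> has_vector_derivative t) (at 0)"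
    using bounded_linear.has_vector_derivative[OF bounded_linear_snd deriv] by (simp add: chart)
  have \<nu>_add: "\<nu> (s + h) = \<nu> s \<star> dl (\<beta> s) (\<nu> h)" and \<beta>_add: "\<beta> (s + h) = \<beta> s * \<beta> h" for s h
    using hom[of s h] by (simp_all add: eta dil_expo expo_star[symmetric])
  have "\<beta> s = exp (t * s)" for s
    by (rule multiplicative_real_eq_exp[OF _ \<beta>_add \<beta>']) (use carrier in \<open>simp add: \<beta>_def\<close>)
  note \<beta> = this
  have \<nu>0: "\<nu> 0 = 0"
    using \<nu>_add[of 0 0] by (metis \<beta> dl_one exp_zero mult_zero_right star_cancel(2) star_minus(2) add_0)
  have ds: "((\<lambda>h. dl (exp (t * h)) Y) has_vector_derivative t *\<^sub>R gscale real Y) (at 0)"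
    using vector_diff_chain_at[of "\<lambda>h. t * h" t 0 "\<lambda>h. dl (exp h) Y" "gscale real Y"]
      has_vector_derivative_dl_exp[of Y] has_vector_derivative_mult_const(1)[of t 0] by (simp add: o_def)
  define \<kappa> where "\<kappa> s = - Y \<star> \<nu> s \<star> dl (exp (t * s)) Y" for s
  have \<kappa>_add: "\<kappa> (s + h) = \<kappa> s \<star> dl (exp (t * s)) (\<kappa> h)" for s h
  proof -
    have "exp (t * (s + h)) = exp (t * s) * exp (t * h)" by (simp add: distrib_left exp_add)
    then show ?thesis
      unfolding \<kappa>_def dl_star gscale_minus dl_dl \<nu>_add[of s h] \<beta> star_assoc star_cancel by simp
  qed
  have "(\<kappa> has_vector_derivative 0) (at 0)"
  proof -
    \<comment> \<open>The derivative \<open>L\<close> depends on \<open>f\<close> only through its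
      value and velocity at \<open>0\<close>. The model subgroup \<open>\<nu>1\<close> shares both
      with \<open>\<nu>\<close> and makes the product identically \<open>0\<close>, so
      \<open>L = 0\<close> without computing it.\<close>
    define \<nu>1 where "\<nu>1 s = Y \<star> - dl (exp (t * s)) Y" for s
    define L where "L = dstar (- Y \<star> \<nu> 0, dl (exp (t * 0)) Y) (dstar (- Y, \<nu> 0) (0, t *\<^sub>R W), t *\<^sub>R gscale real Y)"
    have *: "((\<lambda>s. - Y \<star> f s \<star> dl (exp (t * s)) Y) has_vector_derivative L) (at 0)"
      if "(f has_vector_derivative t *\<^sub>R W) (at 0)" "f 0 = 0" for f
      using has_vector_derivative_star[OF has_vector_derivative_star[OF has_vector_derivative_const that(1)] ds, of "- Y"]
        that(2) by (simp add: L_def \<nu>0)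
    have "(\<nu>1 has_vector_derivative t *\<^sub>R W) (at 0)"
      using vector_diff_chain_at[of "\<lambda>h. t * h" t 0 "\<lambda>h. Y \<star> - dl (exp h) Y" W]
        has_vector_derivative_orbit[of Y] Y has_vector_derivative_mult_const(1)[of t 0]
      by (simp add: o_def \<nu>1_def[abs_def])
    from *[OF this] have "((\<lambda>s. 0) has_vector_derivative L) (at 0)"
      by (simp add: \<nu>1_def star_assoc)
    then have "L = 0" using vector_derivative_unique_at[OF _ has_vector_derivative_const] by blast
    with *[OF \<nu>' \<nu>0] show ?thesis by (simp add: \<kappa>_def[abs_def])
  qed
  then have "((\<lambda>h. \<kappa> (s + h)) has_vector_derivative 0) (at 0)" for s
    unfolding \<kappa>_add using bounded_linear.has_vector_derivative[OF bounded_linear_gscale]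
    by (intro star_zero_derivative) (metis gscale_0)
  then have "\<kappa> s = \<kappa> 0" by (rule zero_derivative_const)
  then have "- Y \<star> \<nu> s \<star> dl (exp (t * s)) Y = 0" by (simp add: \<kappa>_def \<nu>0)
  then have "\<nu> s = Y \<star> - dl (exp (t * s)) Y"
    by (metis minus_minus star_0(1) star_assoc star_cancel(1) star_minus(1))
  then show ?thesis by (simp add: eta \<beta> orbit_def)
qed

lemma one_parameter_subgroup_orbit:
  fixes s s' t :: real
  assumes Y: "orbit_velocity Y = W"
  defines "\<eta> \<equiv> \<lambda>s. (orbit Y (exp (s * t)), exp (s * t))"
  shows "\<eta> s \<in> carrier (GA N)" "\<eta> (s + s') = \<eta> s \<otimes>\<^bsub>GA N\<^esub> \<eta> s'"
    "((\<lambda>s. chartG N (\<eta> s)) has_vector_derivative t *\<^sub>R (W, 1)) (at 0)"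
proof -
  show "\<eta> s \<in> carrier (GA N)" by (simp add: \<eta>_def)
  show "\<eta> (s + s') = \<eta> s \<otimes>\<^bsub>GA N\<^esub> \<eta> s'"
    by (simp add: \<eta>_def distrib_right exp_add orbit_dil)
  have "((\<lambda>h. (Y \<star> - dl (exp h) Y, exp h)) has_vector_derivative (W, 1)) (at 0)"
    using has_vector_derivative_orbit[of Y] DERIV_exp[of "0::real"] unfolding Y
    by (intro has_vector_derivative_Pair) (simp_all add: has_real_derivative_iff_has_vector_derivative)
  then show "((\<lambda>s. chartG N (\<eta> s)) has_vector_derivative t *\<^sub>R (W, 1)) (at 0)"
    using vector_diff_chain_at[of "\<lambda>h. h * t" t 0 "\<lambda>h. (Y \<star> - dl (exp h) Y, exp h)" "(W, 1)"]
      has_vector_derivative_mult_const(2)[of t 0]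
    by (simp add: o_def \<eta>_def chartG_def orbit_def)
qed

text \<open>\<open>lie_exp\<close> being a definite description, two halves are required: the orbit
  is a one-parameter subgroup with the right velocity, and \<open>one_parameter_subgroup_eq\<close>
  leaves no other.\<close>

lemma flow_eq:
  assumes "orbit_velocity Y = W"
  shows "flow N (W, 1) t = (orbit Y (exp t), exp t)"
  unfolding flow_def lie_exp_def
proof (rule the_equality)
  show "\<exists>\<eta>. (\<forall>s. \<eta> s \<in> carrier (GA N)) \<and> (\<forall>s s'. \<eta> (s + s') = \<eta> s \<otimes>\<^bsub>GA N\<^esub> \<eta> s') \<and>
      ((\<lambda>s. chartG N (\<eta> s)) has_vector_derivative t *\<^sub>R (W, 1)) (at 0) \<and> (orbit Y (exp t), exp t) = \<eta> 1"
    by (rule exI[of _ "\<lambda>s. (orbit Y (exp (s * t)), exp (s * t))"])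
       (intro conjI allI one_parameter_subgroup_orbit[OF assms]; simp)
  show "g = (orbit Y (exp t), exp t)"
    if "\<exists>\<eta>. (\<forall>s. \<eta> s \<in> carrier (GA N)) \<and> (\<forall>s s'. \<eta> (s + s') = \<eta> s \<otimes>\<^bsub>GA N\<^esub> \<eta> s') \<and>
      ((\<lambda>s. chartG N (\<eta> s)) has_vector_derivative t *\<^sub>R (W, 1)) (at 0) \<and> g = \<eta> 1" for g
    using that one_parameter_subgroup_eq[OF assms, where t = t and s = 1] by (metis mult_1_right)
qed

text \<open>\<open>representation\<close> is \<open>0\<close> for a dependent set and for vectors
  outside the span, so an inner product equal to \<open>1\<close> forces \<open>basis_g N\<close> to
  be independent with \<open>Z\<close> in its span. The second component of \<open>Z\<close> is then
  its coefficient at \<open>(0, 1)\<close>, the only basis vector whose second component is not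
  \<open>0\<close>.\<close>

lemma Z_set_snd:
  assumes "Z \<in> Z_set N"
  shows "snd Z = 1"
proof -
  let ?B = "basis_g N" and ?r = "representation (basis_g N)"
  have one: "(\<Sum>b\<in>?B. ?r Z b * ?r (0, 1) b) = 1"
    using assms by (simp add: Z_set_def inner_g_def)
  have indep: "independent ?B"
  proof (rule ccontr)
    assume "\<not> ?thesis"
    then have "?r Z b = 0" for b by (simp add: representation_def)
    with one show False by simp
  qed
  have span: "Z \<in> span ?B"
  proof (rule ccontr)
    assume "\<not> ?thesis"
    then have "?r Z b = 0" for b by (simp add: representation_def)
    with one show False by simp
  qed
  have fin: "finite ?B" using indep independent_imp_finite by blast
  have X0: "(0, 1) \<in> ?B" by (simp add: basis_g_def)
  have "?r (0, 1) b = (if b = (0, 1) then 1 else 0)" for b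
    using representation_basis[OF indep X0] by auto
  with one have "?r Z (0, 1) = 1" using fin X0 by (simp add: if_distrib cong: if_cong)
  moreover have "Z = (\<Sum>b\<in>?B. ?r Z b *\<^sub>R b)"
    using sum_representation_eq[OF indep span fin] by simp
  from arg_cong[OF this, of snd] have "snd Z = (\<Sum>b\<in>?B. ?r Z b * snd b)"
    by (simp add: snd_sum)
  moreover have "(\<Sum>b\<in>?B. ?r Z b * snd b) = (\<Sum>b\<in>?B. if b = (0, 1) then ?r Z (0, 1) else 0)"
    by (rule sum.cong) (auto simp: basis_g_def)
  ultimately show ?thesis using fin X0 by simp
qed

section \<open>Jacobians of right translations and the Haar measure\<close>

lemma dl_dstar: "dl a (dstar (X, Y) (U, 0)) = dstar (dl a X, dl a Y) (dl a U, 0)"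
proof -
  have U: "((\<lambda>t. X + t *\<^sub>R U) has_vector_derivative U) (at 0)" for X U
    by (auto intro!: derivative_eq_intros)
  note d = has_vector_derivative_star[OF U has_vector_derivative_const]
  have "((\<lambda>t. dl a ((X + t *\<^sub>R U) \<star> Y)) has_vector_derivative dl a (dstar (X, Y) (U, 0))) (at 0)"
    using bounded_linear.has_vector_derivative[OF bounded_linear_gscale d, of "\<lambda>j. a ^ j" X U Y] by simp
  moreover have "dl a ((X + t *\<^sub>R U) \<star> Y) = (dl a X + t *\<^sub>R dl a U) \<star> dl a Y" for t
    by (simp only: dl_star linear_add[OF linear_gscale] linear_cmul[OF linear_gscale])
  ultimately show ?thesis
    using vector_derivative_unique_at[OF _ d[of "dl a X" "dl a U" "dl a Y"]] by simp
qed

end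

text \<open>The Jacobian is invariant under dilations and equals \<open>1\<close> at the origin.\<close>

lemma det_dstar:
  fixes N :: "('a::{second_countable_topology, t2_space}, real ^ 'n::{finite, wellorder}) strat"
  assumes "stratified_group N"
  shows "det (matrix (\<lambda>U. exp_group.dstar N (X, Y) (U, 0))) = 1"
proof -
  interpret strat_group N using assms by unfold_locales
  have lin: "linear (\<lambda>U. dstar p (U, 0))" for p
    by (rule linearI) (use linear_add[OF linear_dstar, of p "(_, 0)" "(_, 0)"] linear_cmul[OF linear_dstar, of p _ "(_, 0)"] in auto)
  define q where "q a = det (matrix (\<lambda>U. dstar (dl a X, dl a Y) (U, 0)))" for a
  have q_eq: "q a = q 1" if "0 < a" for a
  proof -
    have "matrix (dl a) ** matrix (\<lambda>U. dstar (X, Y) (U, 0)) = matrix (\<lambda>U. dstar (dl a X, dl a Y) (U, 0)) ** matrix (dl a)"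
      using matrix_compose[OF lin[of "(X, Y)"] linear_gscale[of "\<lambda>j. a ^ j"]]
        matrix_compose[OF linear_gscale[of "\<lambda>j. a ^ j"] lin[of "(dl a X, dl a Y)"]]
      by (simp add: o_def dl_dstar)
    then have "det (matrix (dl a)) * q 1 = q a * det (matrix (dl a))"
      unfolding q_def by (simp only: dl_one flip: det_mul)
    moreover have "det (matrix (dl a)) \<noteq> 0"
    proof -
      have "matrix (dl (1 / a)) ** matrix (dl a) = matrix id"
        using matrix_compose[OF linear_gscale[of "\<lambda>j. a ^ j"] linear_gscale[of "\<lambda>j. (1 / a) ^ j"]] that
        by (simp add: o_def dl_dl id_def[abs_def] del: power_one_over)
      then have "det (matrix (dl (1 / a))) * det (matrix (dl a)) = 1"
        by (simp add: matrix_id_mat_1 flip: det_mul)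
      then show ?thesis by auto
    qed
    ultimately show ?thesis by simp
  qed
  have "continuous_on UNIV q"
    unfolding q_def det_def matrix_def
    by (intro continuous_intros continuous_on_dstar continuous_dl | simp)+
  then have "isCont q 0" by (simp add: continuous_on_eq_continuous_at)
  then have "(q \<longlongrightarrow> q 0) (at_right 0)"
    unfolding isCont_def filterlim_at_split by blast
  moreover have "\<forall>\<^sub>F a in at_right 0. q a = q 1"
    using eventually_at_right_less[of "0::real"] by eventually_elim (rule q_eq)
  then have "(q \<longlongrightarrow> q 1) (at_right 0)"
    by (rule tendsto_eventually)
  ultimately have "q 1 = q 0"
    using tendsto_unique trivial_limit_at_right_real by blast
  also have "q 0 = 1"
    using arg_cong[OF matrix_id_mat_1, of det] by (simp add: q_def id_def)
  finally show ?thesis unfolding q_def dl_one .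
qed

text \<open>The preimage of a box under right translation by \<open>Y\<close> is its image under
  right translation by \<open>- Y\<close>. The Jacobian there is \<open>1\<close>, so change of
  variables preserves the volume of boxes, which determine Lebesgue measure.\<close>

lemma lborel_star_right:
  fixes N :: "('a::{second_countable_topology, t2_space}, real ^ 'n::{finite, wellorder}) strat"
  assumes "stratified_group N"
  shows "distr lborel borel (\<lambda>X. exp_group.star N X Y) = lborel"
proof -
  interpret strat_group N using assms by unfold_locales
  have cont: "continuous_on UNIV (\<lambda>X. X \<star> Y)" for Y
    by (intro continuous_star continuous_intros)
  have meas [measurable]: "(\<lambda>X. X \<star> Y) \<in> borel_measurable borel" for Y
    using cont by (rule borel_measurable_continuous_onI)
  show ?thesis
  proof (rule lborel_eqI[symmetric])
    fix l u :: "real ^ 'n::{finite, wellorder}"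
    assume le: "\<And>b. b \<in> Basis \<Longrightarrow> l \<bullet> b \<le> u \<bullet> b"
    define f where "f X = X \<star> - Y" for X
    define f' where "f' X U = dstar (X, - Y) (U, 0)" for X U
    have f': "(f has_derivative f' X) (at X within S)" for X S
      unfolding f_def f'_def by (intro has_derivative_star has_derivative_ident has_derivative_const)
    have inj: "inj_on f S" for S
      by (rule inj_onI) (metis f_def star_assoc star_minus(2) star_0(1))
    have img: "f ` box l u = (\<lambda>X. X \<star> Y) -` box l u"
    proof (intro equalityI subsetI)
      fix X assume "X \<in> (\<lambda>X. X \<star> Y) -` box l u"
      moreover have "X = f (X \<star> Y)" by (simp add: f_def star_assoc)
      ultimately show "X \<in> f ` box l u" by blast
    qed (auto simp: f_def star_assoc)
    have det: "\<bar>det (matrix (f' X))\<bar> = 1" for X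
      using det_dstar[OF assms, of X "- Y"] by (simp add: f'_def[abs_def])
    have S: "box l u \<in> sets lebesgue" "box l u \<in> lmeasurable" by auto
    have int: "(\<lambda>X. \<bar>det (matrix (f' X))\<bar>) integrable_on box l u"
      unfolding det using S(2) lmeasurable_iff_integrable_on by blast
    have lm: "f ` box l u \<in> lmeasurable"
      using measurable_differentiable_image_eq[OF S(1) f' inj] int by simp
    have "measure lebesgue (f ` box l u) = measure lebesgue (box l u)"
      using measure_differentiable_image_eq[OF S(1) f' inj int] lmeasure_integral[OF S(2)]
      unfolding det by simp
    then have "emeasure lebesgue (f ` box l u) = emeasure lebesgue (box l u)"
      using emeasure_eq_measure2[OF lm] emeasure_eq_measure2[OF S(2)] by simp
    moreover have "f ` box l u \<in> sets borel"
      unfolding img using measurable_sets_borel[OF meas, of "box l u" Y] by simp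
    moreover have "emeasure lebesgue A = emeasure lborel A" if "A \<in> sets borel" for A :: "(real ^ 'n::{finite, wellorder}) set"
      using that by simp
    ultimately have "emeasure lborel ((\<lambda>X. X \<star> Y) -` box l u) = emeasure lborel (box l u)"
      unfolding img by simp
    then show "emeasure (distr lborel borel (\<lambda>X. X \<star> Y)) (box l u) = (\<Prod>b\<in>Basis. (u - l) \<bullet> b)"
      using le by (simp add: emeasure_distr emeasure_lborel_box)
  qed simp
qed

lemma sets_haar_N [simp, measurable_cong]: "sets (haar_N N) = sets borel"
  and space_haar_N [simp]: "space (haar_N N) = UNIV"
  by (simp_all add: haar_N_def)

lemma (in exp_group) measurable_expo [measurable]: "expo N \<in> borel_measurable borel"
  and measurable_log [measurable]: "logN N \<in> borel_measurable borel"
  using continuous_expo continuous_log by (auto intro: borel_measurable_continuous_onI)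

text \<open>\<open>logN N\<close> pushes this measure forward to Lebesgue measure, and
  sigma-finiteness passes back from an image measure.\<close>

lemma (in exp_group) sigma_finite_haar_N: "sigma_finite_measure (haar_N N)"
proof -
  have "distr (haar_N N) lborel (logN N) = lborel"
    by (simp add: haar_N_def distr_distr o_def distr_id2)
  then have "sigma_finite_measure (distr (haar_N N) lborel (logN N))"
    by (simp add: lborel.sigma_finite_measure_axioms)
  then show ?thesis
    by (rule sigma_finite_measure_distr) simp
qed

text \<open>Right translations are the ones that matter: flow coordinates multiply \<open>n\<close>
  on the right by a group element depending on the height alone.\<close>

lemma nn_integral_haar_N_right:
  fixes N :: "('a::{second_countable_topology, t2_space}, real ^ 'n::{finite, wellorder}) strat"
  assumes "stratified_group N" and [measurable]: "f \<in> borel_measurable borel"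
  shows "(\<integral>\<^sup>+ n. f (n \<otimes>\<^bsub>N\<^esub> g) \<partial>haar_N N) = (\<integral>\<^sup>+ n. f n \<partial>haar_N N)"
proof -
  interpret strat_group N using assms(1) by unfold_locales
  have cont: "continuous_on UNIV (\<lambda>X. X \<star> Y)" for Y
    by (intro continuous_star continuous_intros)
  have meas [measurable]: "(\<lambda>X. X \<star> Y) \<in> borel_measurable borel" for Y
    using cont by (rule borel_measurable_continuous_onI)
  have eq: "n \<otimes>\<^bsub>N\<^esub> g = expo N (logN N n \<star> logN N g)" for n
    by (simp add: star_def)
  have "(\<integral>\<^sup>+ n. f (n \<otimes>\<^bsub>N\<^esub> g) \<partial>haar_N N) = (\<integral>\<^sup>+ X. f (expo N (X \<star> logN N g)) \<partial>lborel)"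
    unfolding haar_N_def eq by (subst nn_integral_distr) auto
  also have "\<dots> = (\<integral>\<^sup>+ X. f (expo N X) \<partial>distr lborel borel (\<lambda>X. X \<star> logN N g))"
    by (subst nn_integral_distr) auto
  also have "\<dots> = (\<integral>\<^sup>+ n. f n \<partial>haar_N N)"
    unfolding lborel_star_right[OF assms(1)] haar_N_def by (subst nn_integral_distr) auto
  finally show ?thesis .
qed

section \<open>Lengths of horizontal curves\<close>

text \<open>The controls of a horizontal curve need not be measurable, so their lengths are lower integrals, for
  which only the following inequalities are available.\<close>

lemma nn_integral_leI:
  assumes "\<And>g. g \<in> borel_measurable M \<Longrightarrow> (\<And>x. g x \<le> f x) \<Longrightarrow> integral\<^sup>N M g \<le> B"
  shows "integral\<^sup>N M f \<le> B"
  unfolding nn_integral_def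
proof (rule SUP_least)
  fix g assume "g \<in> {g. simple_function M g \<and> g \<le> f}"
  then show "integral\<^sup>S M g \<le> B"
    using assms[of g] by (auto simp: le_fun_def nn_integral_eq_simple_integral borel_measurable_simple_function)
qed

text \<open>A measurable minorant of the scaled function, divided by \<open>c\<close>, is a minorant
  of \<open>f\<close>.\<close>

lemma nn_integral_cmult_le:
  assumes "0 < c"
  shows "(\<integral>\<^sup>+ x. ennreal c * f x \<partial>M) \<le> ennreal c * integral\<^sup>N M f"
proof (rule nn_integral_leI)
  fix g assume [measurable]: "g \<in> borel_measurable M" and g: "\<And>x. g x \<le> ennreal c * f x"
  have cc: "ennreal c * ennreal (1 / c) = 1"
    using assms by (simp flip: ennreal_mult' ennreal_1)
  have "g x = ennreal c * (ennreal (1 / c) * g x)" for x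
    by (simp add: cc flip: mult.assoc)
  then have "integral\<^sup>N M g = ennreal c * (\<integral>\<^sup>+ x. ennreal (1 / c) * g x \<partial>M)"
    by (simp flip: nn_integral_cmult)
  also have "\<dots> \<le> ennreal c * integral\<^sup>N M f"
  proof (intro mult_left_mono nn_integral_mono)
    fix x
    have "ennreal (1 / c) * g x \<le> ennreal (1 / c) * (ennreal c * f x)"
      using g by (intro mult_left_mono) auto
    also have "\<dots> = f x" by (simp add: cc mult.commute[of "ennreal (1 / c)"] flip: mult.assoc)
    finally show "ennreal (1 / c) * g x \<le> f x" .
  qed simp
  finally show "integral\<^sup>N M g \<le> ennreal c * integral\<^sup>N M f" .
qed

lemma nn_integral_real_affine_le:
  fixes f :: "real \<Rightarrow> ennreal"
  assumes "c \<noteq> 0"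
  shows "(\<integral>\<^sup>+ x. ennreal \<bar>c\<bar> * f (t + c * x) \<partial>lborel) \<le> (\<integral>\<^sup>+ x. f x \<partial>lborel)"
proof (rule nn_integral_leI)
  fix g assume g[measurable]: "g \<in> borel_measurable lborel" and le: "\<And>x. g x \<le> ennreal \<bar>c\<bar> * f (t + c * x)"
  have cc: "ennreal \<bar>c\<bar> * ennreal (1 / \<bar>c\<bar>) = 1"
    using assms by (simp flip: ennreal_mult' ennreal_1)
  define g' where "g' y = ennreal (1 / \<bar>c\<bar>) * g ((y - t) / c)" for y
  have [measurable]: "g' \<in> borel_measurable borel"
    using g unfolding g'_def by measurable
  have "integral\<^sup>N lborel g = (\<integral>\<^sup>+ x. ennreal \<bar>c\<bar> * g' (t + c * x) \<partial>lborel)"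
    using assms by (simp add: g'_def cc flip: mult.assoc)
  also have "\<dots> = ennreal \<bar>c\<bar> * (\<integral>\<^sup>+ x. g' (t + c * x) \<partial>lborel)"
    by (rule nn_integral_cmult) measurable
  also have "\<dots> = integral\<^sup>N lborel g'"
    using assms by (subst nn_integral_real_affine[of g' c t]) auto
  also have "\<dots> \<le> integral\<^sup>N lborel f"
  proof (rule nn_integral_mono)
    fix y
    have "g ((y - t) / c) \<le> ennreal \<bar>c\<bar> * f y"
      using le[of "(y - t) / c"] assms by simp
    then have "g' y \<le> ennreal (1 / \<bar>c\<bar>) * (ennreal \<bar>c\<bar> * f y)"
      unfolding g'_def by (intro mult_left_mono) auto
    also have "\<dots> = f y" by (simp add: cc mult.commute[of "ennreal (1 / \<bar>c\<bar>)"] flip: mult.assoc)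
    finally show "g' y \<le> f y" .
  qed
  finally show "integral\<^sup>N lborel g \<le> integral\<^sup>N lborel f" .
qed

text \<open>Lower integrals are in general only superadditive. Here the cut is along a measurable
  set, so a measurable minorant splits into its restrictions to the two pieces.\<close>

lemma nn_integral_split_le:
  assumes [measurable]: "A \<in> sets M"
  shows "integral\<^sup>N M f \<le> (\<integral>\<^sup>+ x\<in>A. f x \<partial>M) + (\<integral>\<^sup>+ x\<in>-A. f x \<partial>M)"
proof (rule nn_integral_leI)
  fix g assume [measurable]: "g \<in> borel_measurable M" and g: "\<And>x. g x \<le> f x"
  have "integral\<^sup>N M g = (\<integral>\<^sup>+ x. g x * indicator A x + g x * indicator (space M - A) x \<partial>M)"
    by (rule nn_integral_cong) (auto split: split_indicator)
  also have "\<dots> = (\<integral>\<^sup>+ x\<in>A. g x \<partial>M) + (\<integral>\<^sup>+ x\<in>space M - A. g x \<partial>M)"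
    by (rule nn_integral_add) auto
  also have "\<dots> \<le> (\<integral>\<^sup>+ x\<in>A. f x \<partial>M) + (\<integral>\<^sup>+ x\<in>-A. f x \<partial>M)"
    by (intro add_mono nn_integral_mono) (auto split: split_indicator simp: g)
  finally show "integral\<^sup>N M g \<le> (\<integral>\<^sup>+ x\<in>A. f x \<partial>M) + (\<integral>\<^sup>+ x\<in>-A. f x \<partial>M)" .
qed

text \<open>The derivative is given off a finite set and without measurability; that is recovered
  from its being a limit of difference quotients. If the integral is finite, the gauge-integral form
  of the fundamental theorem agrees with the Lebesgue integral; otherwise the bound is void.\<close>

lemma abs_diff_le_nn_integral_derivative:
  fixes \<gamma> :: "real \<Rightarrow> real"
  assumes ab: "a \<le> b" and cont: "continuous_on {a..b} \<gamma>" and K: "finite K"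
    and der: "\<And>t. t \<in> {a<..<b} - K \<Longrightarrow> (\<gamma> has_vector_derivative \<gamma>' t) (at t)"
  shows "ennreal \<bar>\<gamma> b - \<gamma> a\<bar> \<le> (\<integral>\<^sup>+ t\<in>{a..b}. ennreal \<bar>\<gamma>' t\<bar> \<partial>lborel)"
proof -
  define S where "S = {a<..<b} - K"
  have "open S" unfolding S_def using K by (intro open_Diff finite_imp_closed) auto
  then have S_meas [measurable]: "S \<in> sets borel" by simp
  define g where "g t = indicator S t * \<gamma>' t" for t
  \<comment> \<open>\<open>c\<close> continues \<open>\<gamma>\<close> by constants, so that the
    difference quotients make sense on the whole line.\<close>
  define c where "c t = \<gamma> (max a (min b t))" for t
  have "continuous_on UNIV c"
    unfolding c_def by (rule continuous_on_compose2[OF cont]) (use ab in \<open>auto intro!: continuous_intros\<close>)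
  then have c_meas [measurable]: "c \<in> borel_measurable borel" by (rule borel_measurable_continuous_onI)
  have der_c: "(c has_real_derivative \<gamma>' t) (at t)" if "t \<in> S" for t
  proof -
    have "(c has_vector_derivative \<gamma>' t) (at t)"
      by (rule has_vector_derivative_transform_within_open[OF der])
         (use that in \<open>auto simp: S_def c_def max_def min_def intro: open_greaterThanLessThan[of a b]\<close>)
    then show ?thesis by (simp add: has_real_derivative_iff_has_vector_derivative)
  qed
  define q where "q n t = indicator S t * ((c (t + 1 / real (Suc n)) - c t) / (1 / real (Suc n)))" for n t
  have lim: "(\<lambda>n. q n t) \<longlonglongrightarrow> g t" for t
  proof (cases "t \<in> S")
    case True
    have "((\<lambda>h. (c (t + h) - c t) / h) \<longlongrightarrow> \<gamma>' t) (at 0)"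
      using der_c[OF True] by (simp add: DERIV_def)
    moreover have "filterlim (\<lambda>n. 1 / real (Suc n)) (at 0) sequentially"
      unfolding filterlim_at using LIMSEQ_inverse_real_of_nat by (auto simp: inverse_eq_divide)
    ultimately have "(\<lambda>n. (c (t + 1 / real (Suc n)) - c t) / (1 / real (Suc n))) \<longlonglongrightarrow> \<gamma>' t"
      by (rule filterlim_compose)
    then show ?thesis using True by (simp add: q_def g_def)
  qed (simp add: q_def g_def)
  have q_meas: "q n \<in> borel_measurable borel" for n
    unfolding q_def by measurable
  have [measurable]: "g \<in> borel_measurable borel"
    by (rule borel_measurable_LIMSEQ_real[where u = q, OF lim q_meas])
  have le: "(\<integral>\<^sup>+ t. ennreal \<bar>g t\<bar> \<partial>lborel) \<le> (\<integral>\<^sup>+ t\<in>{a..b}. ennreal \<bar>\<gamma>' t\<bar> \<partial>lborel)"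
    by (rule nn_integral_mono) (auto simp: g_def S_def split: split_indicator)
  show ?thesis
  proof (cases "(\<integral>\<^sup>+ t. ennreal \<bar>g t\<bar> \<partial>lborel) = \<infinity>")
    case True
    with le have "\<infinity> \<le> (\<integral>\<^sup>+ t\<in>{a..b}. ennreal \<bar>\<gamma>' t\<bar> \<partial>lborel)" by simp
    then show ?thesis by (rule order_trans[rotated]) simp
  next
    case False
    then have int: "integrable lborel g"
      by (intro integrableI_bounded) (auto simp: less_top)
    have "(g has_integral (\<gamma> b - \<gamma> a)) {a..b}"
      by (rule fundamental_theorem_of_calculus_interior_strong[OF K ab _ cont])
         (use der in \<open>auto simp: g_def S_def\<close>)
    then have "((\<lambda>t. if t \<in> {a..b} then g t else 0) has_integral (\<gamma> b - \<gamma> a)) UNIV"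
      by (simp only: has_integral_restrict_UNIV)
    moreover have "(\<lambda>t. if t \<in> {a..b} then g t else 0) = g"
      by (auto simp: g_def S_def fun_eq_iff)
    ultimately have "\<gamma> b - \<gamma> a = integral\<^sup>L lborel g"
      using has_integral_integral_lborel[OF int] has_integral_unique by metis
    with integral_norm_bound_ennreal[OF int] le show ?thesis by simp
  qed
qed

definition control_length :: "'e set \<Rightarrow> (real \<Rightarrow> 'e \<Rightarrow> real) \<Rightarrow> ennreal"
  where "control_length F u = (\<integral>\<^sup>+ t\<in>{0..1}. ennreal (sqrt (\<Sum>W\<in>F. (u t W)\<^sup>2)) \<partial>lborel)"

text \<open>The infimum need not be attained, so distances are estimated by strict inequalities,
  each witnessed by a single curve.\<close>

lemma cc_dist_less_iff:
  "cc_dist M \<kappa> F g h < R \<longleftrightarrow>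
     (\<exists>\<eta> u. horizontal_curve M \<kappa> F \<eta> u \<and> \<eta> 0 = g \<and> \<eta> 1 = h \<and> control_length F u < R)"
  unfolding cc_dist_def Inf_less_iff control_length_def by blast

lemma sqrt_sum_scale: "sqrt (\<Sum>W\<in>F. (c * f W)\<^sup>2) = \<bar>c\<bar> * sqrt (\<Sum>W\<in>F. (f W)\<^sup>2)"
  by (simp add: power_mult_distrib real_sqrt_mult flip: sum_distrib_left)

text \<open>The length is only bounded from above, because substitution in a lower integral is
  available as an inequality.\<close>

lemma horizontal_curve_reverse:
  assumes "horizontal_curve M \<kappa> F \<eta> u"
  shows "horizontal_curve M \<kappa> F (\<lambda>t. \<eta> (1 - t)) (\<lambda>t W. - u (1 - t) W)"
    and "control_length F (\<lambda>t W. - u (1 - t) W) \<le> control_length F u"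
proof -
  obtain K where K: "finite K" and der: "\<And>t. t \<in> {0..1} - K \<Longrightarrow> ((\<lambda>t. \<kappa> (\<eta> t)) has_vector_derivative
            (\<Sum>W\<in>F. u t W *\<^sub>R left_field M \<kappa> W (\<eta> t))) (at t)"
    using assms unfolding horizontal_curve_def by blast
  have "valid_path (\<lambda>t. \<kappa> (\<eta> t))"
    using assms by (auto simp: horizontal_curve_def valid_path_def)
  then have "(\<lambda>t. \<kappa> (\<eta> (1 - t))) piecewise_C1_differentiable_on {0..1}"
    using valid_path_imp_reverse by (fastforce simp: valid_path_def reversepath_def o_def)
  moreover have "((\<lambda>t. \<kappa> (\<eta> (1 - t))) has_vector_derivative
            (\<Sum>W\<in>F. (- u (1 - t) W) *\<^sub>R left_field M \<kappa> W (\<eta> (1 - t)))) (at t)"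
    if "t \<in> {0..1} - (\<lambda>x. 1 - x) ` K" for t
  proof -
    have "1 - t \<in> {0..1} - K"
      using that by (auto intro: rev_image_eqI[of "1 - t"])
    moreover have "((\<lambda>t. 1 - t) has_vector_derivative - 1) (at t)"
      by (auto intro!: derivative_eq_intros)
    ultimately show ?thesis
      using vector_diff_chain_at[of "\<lambda>t. 1 - t" "-1" t "\<lambda>t. \<kappa> (\<eta> t)"] der
      by (simp add: o_def sum_negf)
  qed
  ultimately show "horizontal_curve M \<kappa> F (\<lambda>t. \<eta> (1 - t)) (\<lambda>t W. - u (1 - t) W)"
    using assms K unfolding horizontal_curve_def
    by (intro conjI exI[of _ "(\<lambda>x. 1 - x) ` K"]) auto
  show "control_length F (\<lambda>t W. - u (1 - t) W) \<le> control_length F u"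
    unfolding control_length_def
    using nn_integral_real_affine_le[of "-1" "\<lambda>t. ennreal (sqrt (\<Sum>W\<in>F. (u t W)\<^sup>2)) * indicator {0..1} t" 1]
    by (simp add: indicator_def cong: if_cong) (simp add: conj_commute)
qed

text \<open>Each curve is run at double speed on half of the unit interval, which doubles the
  controls; the corner at \<open>1 / 2\<close> goes into the exceptional set.\<close>

lemma horizontal_curve_join:
  assumes 1: "horizontal_curve M \<kappa> F \<eta>1 u1" and 2: "horizontal_curve M \<kappa> F \<eta>2 u2" and eq: "\<eta>1 1 = \<eta>2 0"
  defines "\<eta> \<equiv> \<lambda>t. if t \<le> 1 / 2 then \<eta>1 (2 * t) else \<eta>2 (2 * t - 1)"
    and "u \<equiv> \<lambda>t W. if t \<le> 1 / 2 then 2 * u1 (2 * t) W else 2 * u2 (2 * t - 1) W"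
  shows "horizontal_curve M \<kappa> F \<eta> u" "control_length F u \<le> control_length F u1 + control_length F u2"
proof -
  obtain K1 where K1: "finite K1" and der1: "\<And>t. t \<in> {0..1} - K1 \<Longrightarrow> ((\<lambda>t. \<kappa> (\<eta>1 t)) has_vector_derivative
            (\<Sum>W\<in>F. u1 t W *\<^sub>R left_field M \<kappa> W (\<eta>1 t))) (at t)"
    using 1 unfolding horizontal_curve_def by blast
  obtain K2 where K2: "finite K2" and der2: "\<And>t. t \<in> {0..1} - K2 \<Longrightarrow> ((\<lambda>t. \<kappa> (\<eta>2 t)) has_vector_derivative
            (\<Sum>W\<in>F. u2 t W *\<^sub>R left_field M \<kappa> W (\<eta>2 t))) (at t)"
    using 2 unfolding horizontal_curve_def by blast
  define K where "K = {1 / 2} \<union> (\<lambda>x. x / 2) ` K1 \<union> (\<lambda>x. (x + 1) / 2) ` K2"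
  have "valid_path ((\<lambda>t. \<kappa> (\<eta>1 t)) +++ (\<lambda>t. \<kappa> (\<eta>2 t)))"
    using 1 2 eq by (intro valid_path_join) (auto simp: horizontal_curve_def valid_path_def pathfinish_def pathstart_def)
  moreover have "(\<lambda>t. \<kappa> (\<eta>1 t)) +++ (\<lambda>t. \<kappa> (\<eta>2 t)) = (\<lambda>t. \<kappa> (\<eta> t))"
    by (auto simp: joinpaths_def \<eta>_def)
  ultimately have "(\<lambda>t. \<kappa> (\<eta> t)) piecewise_C1_differentiable_on {0..1}"
    by (simp add: valid_path_def)
  moreover have "((\<lambda>t. \<kappa> (\<eta> t)) has_vector_derivative (\<Sum>W\<in>F. u t W *\<^sub>R left_field M \<kappa> W (\<eta> t))) (at t)"
    if t: "t \<in> {0..1} - K" for t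
  proof (cases "t < 1 / 2")
    case True
    have "2 * t \<in> {0..1} - K1"
      using t True by (auto simp: K_def image_iff mult.commute)
    moreover have "((\<lambda>t. 2 * t) has_vector_derivative 2) (at t)"
      by (auto intro!: derivative_eq_intros)
    ultimately have "((\<lambda>t. \<kappa> (\<eta>1 (2 * t))) has_vector_derivative
        2 *\<^sub>R (\<Sum>W\<in>F. u1 (2 * t) W *\<^sub>R left_field M \<kappa> W (\<eta>1 (2 * t)))) (at t)"
      using vector_diff_chain_at[of "\<lambda>t. 2 * t" 2 t "\<lambda>t. \<kappa> (\<eta>1 t)"] der1 by (simp add: o_def)
    then have "((\<lambda>t. \<kappa> (\<eta>1 (2 * t))) has_vector_derivative (\<Sum>W\<in>F. u t W *\<^sub>R left_field M \<kappa> W (\<eta> t))) (at t)"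
      using True by (simp add: u_def \<eta>_def scaleR_sum_right)
    then show ?thesis
      by (rule has_vector_derivative_transform_within_open[OF _ open_lessThan[of "1 / 2"]]) (use True in \<open>auto simp: \<eta>_def\<close>)
  next
    case False
    then have gt: "1 / 2 < t" using t by (auto simp: K_def)
    have "2 * t - 1 \<in> {0..1} - K2"
      using t gt by (auto simp: K_def image_iff)
    moreover have "((\<lambda>t. 2 * t - 1) has_vector_derivative 2) (at t)"
      by (auto intro!: derivative_eq_intros)
    ultimately have "((\<lambda>t. \<kappa> (\<eta>2 (2 * t - 1))) has_vector_derivative
        2 *\<^sub>R (\<Sum>W\<in>F. u2 (2 * t - 1) W *\<^sub>R left_field M \<kappa> W (\<eta>2 (2 * t - 1)))) (at t)"
      using vector_diff_chain_at[of "\<lambda>t. 2 * t - 1" 2 t "\<lambda>t. \<kappa> (\<eta>2 t)"] der2 by (simp add: o_def)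
    then have "((\<lambda>t. \<kappa> (\<eta>2 (2 * t - 1))) has_vector_derivative (\<Sum>W\<in>F. u t W *\<^sub>R left_field M \<kappa> W (\<eta> t))) (at t)"
      using gt by (simp add: u_def \<eta>_def scaleR_sum_right)
    then show ?thesis
      by (rule has_vector_derivative_transform_within_open[OF _ open_greaterThan[of "1 / 2"]]) (use gt in \<open>auto simp: \<eta>_def\<close>)
  qed
  moreover have "finite K" using K1 K2 by (simp add: K_def)
  moreover have "\<eta> t \<in> carrier M" if "t \<in> {0..1}" for t
    using 1 2 that by (auto simp: horizontal_curve_def \<eta>_def)
  ultimately show "horizontal_curve M \<kappa> F \<eta> u"
    unfolding horizontal_curve_def by blast
  have two: "ennreal (sqrt (\<Sum>W\<in>F. (2 * f W)\<^sup>2)) = 2 * ennreal (sqrt (\<Sum>W\<in>F. (f W)\<^sup>2))" for f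
    by (simp only: sqrt_sum_scale) (simp add: ennreal_mult')
  let ?s = "\<lambda>u t. ennreal (sqrt (\<Sum>W\<in>F. (u t W)\<^sup>2)) * indicator {0..1} t"
  have "control_length F u \<le> (\<integral>\<^sup>+ t\<in>{..1/2}. ?s u t \<partial>lborel) + (\<integral>\<^sup>+ t\<in>-{..1/2}. ?s u t \<partial>lborel)"
    unfolding control_length_def by (rule nn_integral_split_le) simp
  also have "(\<integral>\<^sup>+ t\<in>{..1/2}. ?s u t \<partial>lborel) \<le> (\<integral>\<^sup>+ t. ennreal \<bar>2\<bar> * ?s u1 (0 + 2 * t) \<partial>lborel)"
    by (rule nn_integral_mono)
       (use two[simplified] in \<open>auto simp: u_def split: split_indicator\<close>)
  also have "\<dots> \<le> control_length F u1"
    unfolding control_length_def by (rule nn_integral_real_affine_le) simp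
  also have "(\<integral>\<^sup>+ t\<in>-{..1/2}. ?s u t \<partial>lborel) \<le> (\<integral>\<^sup>+ t. ennreal \<bar>2\<bar> * ?s u2 (- 1 + 2 * t) \<partial>lborel)"
    by (rule nn_integral_mono)
       (use two[simplified] in \<open>auto simp: u_def split: split_indicator\<close>)
  also have "\<dots> \<le> control_length F u2"
    unfolding control_length_def by (rule nn_integral_real_affine_le) simp
  finally show "control_length F u \<le> control_length F u1 + control_length F u2"
    by (simp add: add_mono)
qed

lemma cc_dist_less_sym: "cc_dist M \<kappa> F g h < R \<Longrightarrow> cc_dist M \<kappa> F h g < R"
  unfolding cc_dist_less_iff
proof (elim exE conjE)
  fix \<eta> u
  assume "horizontal_curve M \<kappa> F \<eta> u" "\<eta> 0 = g" "\<eta> 1 = h" "control_length F u < R"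
  with horizontal_curve_reverse[of M \<kappa> F \<eta> u]
  show "\<exists>\<eta> u. horizontal_curve M \<kappa> F \<eta> u \<and> \<eta> 0 = h \<and> \<eta> 1 = g \<and> control_length F u < R"
    by (intro exI[of _ "\<lambda>t. \<eta> (1 - t)"] exI[of _ "\<lambda>t W. - u (1 - t) W"]) auto
qed

lemma cc_dist_less_trans:
  assumes "cc_dist M \<kappa> F g h < ennreal R" "cc_dist M \<kappa> F h k < ennreal R'"
  shows "cc_dist M \<kappa> F g k < ennreal (R + R')"
proof -
  obtain \<eta>1 u1 where 1: "horizontal_curve M \<kappa> F \<eta>1 u1" "\<eta>1 0 = g" "\<eta>1 1 = h" "control_length F u1 < R"
    using assms(1) by (auto simp: cc_dist_less_iff)
  obtain \<eta>2 u2 where 2: "horizontal_curve M \<kappa> F \<eta>2 u2" "\<eta>2 0 = h" "\<eta>2 1 = k" "control_length F u2 < R'"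
    using assms(2) by (auto simp: cc_dist_less_iff)
  have pos: "0 < R" "0 < R'"
    using 1(4) 2(4) by (auto simp flip: ennreal_less_zero_iff intro: le_less_trans[OF zero_le])
  note J = horizontal_curve_join[OF 1(1) 2(1)]
  have "control_length F u1 + control_length F u2 < ennreal R + ennreal R'"
    using 1(4) 2(4) by (rule add_strict_mono)
  then have "control_length F u1 + control_length F u2 < ennreal (R + R')"
    using pos by simp
  moreover define \<eta> where "\<eta> t = (if t \<le> 1 / 2 then \<eta>1 (2 * t) else \<eta>2 (2 * t - 1))" for t
  define u where "u t W = (if t \<le> 1 / 2 then 2 * u1 (2 * t) W else 2 * u2 (2 * t - 1) W)" for t W
  have "\<eta>1 1 = \<eta>2 0" using 1 2 by simp
  from J[OF this] have "horizontal_curve M \<kappa> F \<eta> u" "control_length F u \<le> control_length F u1 + control_length F u2"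
    by (simp_all add: \<eta>_def[abs_def] u_def[abs_def])
  moreover have "\<eta> 0 = g" "\<eta> 1 = k" using 1 2 by (simp_all add: \<eta>_def)
  ultimately show ?thesis
    unfolding cc_dist_less_iff by (blast intro: le_less_trans)
qed

section \<open>The distance on the extended group\<close>

context strat_group
begin

definition horizontal_frame :: "'v set"
  where "horizontal_frame = frame N 1 ` {1..rank N 1}"

lemma finite_horizontal_frame [simp]: "finite horizontal_frame"
  by (simp add: horizontal_frame_def)

lemma horizontal_frame_layer:
  assumes "W \<in> horizontal_frame"
  shows "W \<in> layer N 1"
proof -
  have "span horizontal_frame = layer N 1"
    using stratified step_pos by (simp add: stratified_group_def horizontal_frame_def)
  with span_base[OF assms] show ?thesis by simp
qed

definition frame_G :: "('v \<times> real) set"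
  where "frame_G = insert (0, 1) ((\<lambda>W. (W, 0)) ` horizontal_frame)"

lemma d_N_eq: "d_N N = cc_dist N (logN N) horizontal_frame"
  by (simp add: d_N_def horizontal_frame_def)

lemma d_G_eq: "d_G N = cc_dist (GA N) (chartG N) frame_G"
  by (simp add: d_G_def frame_G_def horizontal_frame_def image_image)

lemma sum_frame_G: "(\<Sum>W\<in>frame_G. f W) = f (0, 1) + (\<Sum>W\<in>horizontal_frame. f (W, 0))"
proof -
  have "inj_on (\<lambda>W. (W, 0::real)) horizontal_frame" by (auto intro: inj_onI)
  then show ?thesis
    unfolding frame_G_def by (subst sum.insert) (auto simp: sum.reindex)
qed

lemma velocity_G:
  "(\<Sum>W\<in>frame_G. c W *\<^sub>R left_field (GA N) (chartG N) W (n, b))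
    = (\<Sum>W\<in>horizontal_frame. (b * c (W, 0)) *\<^sub>R left_field N (logN N) W n, b * c (0, 1))"
proof -
  have "(\<Sum>W\<in>horizontal_frame. c (W, 0) *\<^sub>R left_field (GA N) (chartG N) (W, 0) (n, b))
      = (\<Sum>W\<in>horizontal_frame. ((b * c (W, 0)) *\<^sub>R left_field N (logN N) W n, 0))"
  proof (rule sum.cong[OF refl])
    fix W assume "W \<in> horizontal_frame"
    from left_field_G[OF horizontal_frame_layer[OF this]]
    show "c (W, 0) *\<^sub>R left_field (GA N) (chartG N) (W, 0) (n, b) = ((b * c (W, 0)) *\<^sub>R left_field N (logN N) W n, 0)"
      by (simp add: mult.commute)
  qed
  then show ?thesis
    by (simp add: sum_frame_G left_field_X0 sum_prod mult.commute)
qed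

lemma sqrt_sum_frame_G_ge:
  "\<bar>c (0, 1)\<bar> \<le> sqrt (\<Sum>W\<in>frame_G. (c W)\<^sup>2)"
  "sqrt (\<Sum>W\<in>horizontal_frame. (c (W, 0))\<^sup>2) \<le> sqrt (\<Sum>W\<in>frame_G. (c W)\<^sup>2)"
  unfolding sum_frame_G by (rule real_le_rsqrt, simp add: sum_nonneg) (rule real_sqrt_le_mono, simp)

text \<open>The vertical line is traversed with the constant control \<open>k\<close> along
  \<open>(0, 1)\<close>, which makes the height exponential in time and the length
  \<open>\<bar>k\<bar>\<close>.\<close>

lemma d_G_less_vertical:
  assumes "0 < b" "0 < b'" "\<bar>ln b - ln b'\<bar> < R"
  shows "d_G N (n, b) (n, b') < ennreal R"
proof -
  define k where "k = ln b' - ln b"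
  define \<eta> where "\<eta> t = (n, b * exp (t * k))" for t
  define u :: "real \<Rightarrow> 'v \<times> real \<Rightarrow> real" where "u t W = (if W = (0, 1) then k else 0)" for t W
  have der: "((\<lambda>t. chartG N (\<eta> t)) has_vector_derivative (0, b * exp (t * k) * k)) (at t)" for t
  proof -
    have "((\<lambda>t. b * exp (t * k)) has_real_derivative b * exp (t * k) * k) (at t)"
      by (auto intro!: derivative_eq_intros)
    then show ?thesis
      unfolding has_real_derivative_iff_has_vector_derivative \<eta>_def chartG_def
      by (auto intro!: has_vector_derivative_Pair)
  qed
  have "horizontal_curve (GA N) (chartG N) frame_G \<eta> u"
    unfolding horizontal_curve_def
  proof (intro conjI ballI exI[of _ "{}"])
    show "(\<lambda>t. chartG N (\<eta> t)) piecewise_C1_differentiable_on {0..1}"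
      by (rule C1_differentiable_imp_piecewise)
         (unfold C1_differentiable_on_def, rule exI[of _ "\<lambda>t. (0, b * exp (t * k) * k)"],
          use der in \<open>auto intro!: continuous_intros\<close>)
    show "((\<lambda>t. chartG N (\<eta> t)) has_vector_derivative
        (\<Sum>W\<in>frame_G. u t W *\<^sub>R left_field (GA N) (chartG N) W (\<eta> t))) (at t)" for t
      using der[of t] unfolding \<eta>_def velocity_G by (simp add: u_def)
  qed (use assms in \<open>auto simp: \<eta>_def\<close>)
  moreover have "\<eta> 0 = (n, b)" "\<eta> 1 = (n, b')"
    using assms by (simp_all add: \<eta>_def k_def exp_diff)
  moreover have "control_length frame_G u = ennreal \<bar>k\<bar>"
  proof -
    have "sqrt (\<Sum>W\<in>frame_G. (u t W)\<^sup>2) = \<bar>k\<bar>" for t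
      unfolding sum_frame_G by (simp add: u_def)
    then show ?thesis by (simp add: control_length_def nn_integral_cmult)
  qed
  moreover have "ennreal \<bar>k\<bar> < ennreal R"
    using assms(3) by (simp add: k_def ennreal_less_iff abs_minus_commute)
  ultimately show ?thesis
    unfolding d_G_eq cc_dist_less_iff by metis
qed

text \<open>At height \<open>h\<close> the horizontal fields are \<open>h\<close> times those of
  \<open>N\<close>, so lifting a curve of \<open>N\<close> to that height divides its controls by
  \<open>h\<close>.\<close>

lemma d_G_less_horizontal:
  assumes "d_N N n n' < ennreal \<rho>" "0 < h"
  shows "d_G N (n, h) (n', h) < ennreal (\<rho> / h)"
proof -
  obtain \<nu> v where \<nu>: "horizontal_curve N (logN N) horizontal_frame \<nu> v" "\<nu> 0 = n" "\<nu> 1 = n'"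
    and len: "control_length horizontal_frame v < \<rho>"
    using assms(1) by (auto simp: d_N_eq cc_dist_less_iff)
  obtain K where K: "finite K" and der: "\<And>t. t \<in> {0..1} - K \<Longrightarrow> ((\<lambda>t. logN N (\<nu> t)) has_vector_derivative
            (\<Sum>W\<in>horizontal_frame. v t W *\<^sub>R left_field N (logN N) W (\<nu> t))) (at t)"
    using \<nu>(1) unfolding horizontal_curve_def by blast
  define \<eta> where "\<eta> t = (\<nu> t, h)" for t
  define u :: "real \<Rightarrow> 'v \<times> real \<Rightarrow> real" where "u t W = (if snd W = 0 then v t (fst W) / h else 0)" for t W
  have "horizontal_curve (GA N) (chartG N) frame_G \<eta> u"
    unfolding horizontal_curve_def
  proof (intro conjI ballI exI[of _ K])
    obtain S D where S: "finite S" and D: "\<And>t. t \<in> {0..1} - S \<Longrightarrow> ((\<lambda>t. logN N (\<nu> t)) has_vector_derivative D t) (at t)"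
      "continuous_on ({0..1} - S) D" "continuous_on {0..1} (\<lambda>t. logN N (\<nu> t))"
      using \<nu>(1) unfolding horizontal_curve_def piecewise_C1_differentiable_on_def C1_differentiable_on_def by metis
    have "(\<lambda>t. (logN N (\<nu> t), h)) C1_differentiable_on ({0..1} - S)"
      unfolding C1_differentiable_on_def using D
      by (intro exI[of _ "\<lambda>t. (D t, 0)"]) (auto intro!: has_vector_derivative_Pair continuous_intros)
    then show "(\<lambda>t. chartG N (\<eta> t)) piecewise_C1_differentiable_on {0..1}"
      using S D(3) by (auto simp: piecewise_C1_differentiable_on_def \<eta>_def chartG_def intro!: continuous_intros)
    show "((\<lambda>t. chartG N (\<eta> t)) has_vector_derivative
        (\<Sum>W\<in>frame_G. u t W *\<^sub>R left_field (GA N) (chartG N) W (\<eta> t))) (at t)" if "t \<in> {0..1} - K" for t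
      using der[OF that] assms(2) unfolding \<eta>_def velocity_G
      by (auto simp: u_def chartG_def intro!: has_vector_derivative_Pair)
  qed (use assms K in \<open>auto simp: \<eta>_def\<close>)
  moreover have "\<eta> 0 = (n, h)" "\<eta> 1 = (n', h)"
    using \<nu> by (simp_all add: \<eta>_def)
  moreover have "control_length frame_G u < ennreal (\<rho> / h)"
  proof -
    have \<rho>: "0 < \<rho>" using len by (auto simp flip: ennreal_less_zero_iff intro: le_less_trans[OF zero_le])
    have sq: "sqrt (\<Sum>W\<in>frame_G. (u t W)\<^sup>2) = (1 / h) * sqrt (\<Sum>W\<in>horizontal_frame. (v t W)\<^sup>2)" for t
      using sqrt_sum_scale[of "1 / h" "v t" horizontal_frame] assms(2) unfolding sum_frame_G by (simp add: u_def)
    have "control_length frame_G u = (\<integral>\<^sup>+ t. ennreal (1 / h) * (ennreal (sqrt (\<Sum>W\<in>horizontal_frame. (v t W)\<^sup>2)) * indicator {0..1} t) \<partial>lborel)"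
      unfolding control_length_def sq using assms(2) by (subst ennreal_mult') (auto simp: mult.assoc)
    also have "\<dots> \<le> ennreal (1 / h) * control_length horizontal_frame v"
      unfolding control_length_def using assms(2) by (intro nn_integral_cmult_le) simp
    also have "\<dots> < ennreal (1 / h) * ennreal \<rho>"
      using len assms(2) by (intro ennreal_mult_strict_left_mono) auto
    also have "\<dots> = ennreal (\<rho> / h)"
      using assms(2) \<rho> by (simp flip: ennreal_mult')
    finally show ?thesis .
  qed
  ultimately show ?thesis
    unfolding d_G_eq cc_dist_less_iff by metis
qed

text \<open>Three legs: vertically to an auxiliary height \<open>h\<close>, horizontally there,
  vertically to the target. A high \<open>h\<close> cheapens the middle leg at the expense of the
  other two.\<close>

lemma d_G_lessI:
  assumes "d_N N n n' < ennreal \<rho>" "0 < b" "0 < b'" "0 < h" "\<bar>ln b - ln h\<bar> < R" "\<bar>ln h - ln b'\<bar> < R'"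
  shows "d_G N (n, b) (n', b') < ennreal (R + \<rho> / h + R')"
  using cc_dist_less_trans[OF cc_dist_less_trans[OF d_G_less_vertical[OF assms(2,4,5), of n, unfolded d_G_eq]
        d_G_less_horizontal[OF assms(1,4), unfolded d_G_eq]] d_G_less_vertical[OF assms(4,3,6), of n', unfolded d_G_eq]]
  by (simp add: d_G_eq)

text \<open>The control along \<open>(0, 1)\<close> is the logarithmic derivative of the height, so
  heights on the curve stay below \<open>b * exp R\<close>. The projection to \<open>N\<close> then
  has controls at most that many times those in \<open>G\<close>.\<close>

lemma d_G_lessD:
  assumes "d_G N (n', b') (n, b) < ennreal R"
  shows "\<bar>ln b' - ln b\<bar> < R" "d_N N n' n < ennreal (b * exp R * R)"
proof -
  obtain \<eta> u where \<eta>: "horizontal_curve (GA N) (chartG N) frame_G \<eta> u" "\<eta> 0 = (n', b')" "\<eta> 1 = (n, b)"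
    and len: "control_length frame_G u < R"
    using assms by (auto simp: d_G_eq cc_dist_less_iff)
  have R: "0 < R" using len by (auto simp flip: ennreal_less_zero_iff intro: le_less_trans[OF zero_le])
  obtain K where K: "finite K" and der0: "\<And>t. t \<in> {0..1} - K \<Longrightarrow> ((\<lambda>t. chartG N (\<eta> t)) has_vector_derivative
            (\<Sum>W\<in>frame_G. u t W *\<^sub>R left_field (GA N) (chartG N) W (\<eta> t))) (at t)"
    using \<eta>(1) unfolding horizontal_curve_def by blast
  define \<nu> where "\<nu> t = fst (\<eta> t)" for t
  define \<beta> where "\<beta> t = snd (\<eta> t)" for t
  have chart: "chartG N (\<eta> t) = (logN N (\<nu> t), \<beta> t)" for t
    by (simp add: chartG_def \<nu>_def \<beta>_def split: prod.splits)
  have \<beta>: "0 < \<beta> t" if "t \<in> {0..1}" for t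
    using \<eta>(1) that by (auto simp: horizontal_curve_def \<beta>_def)
  have ends: "\<nu> 0 = n'" "\<nu> 1 = n" "\<beta> 0 = b'" "\<beta> 1 = b"
    using \<eta> by (simp_all add: \<nu>_def \<beta>_def)
  have der: "((\<lambda>t. chartG N (\<eta> t)) has_vector_derivative
       (\<Sum>W\<in>horizontal_frame. (\<beta> t * u t (W, 0)) *\<^sub>R left_field N (logN N) W (\<nu> t), \<beta> t * u t (0, 1))) (at t)"
    if "t \<in> {0..1} - K" for t
    using der0[OF that] velocity_G[of "u t" "\<nu> t" "\<beta> t"] by (simp add: \<nu>_def \<beta>_def)
  obtain S D where S: "finite S" and D: "\<And>t. t \<in> {0..1} - S \<Longrightarrow> ((\<lambda>t. chartG N (\<eta> t)) has_vector_derivative D t) (at t)"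
    "continuous_on ({0..1} - S) D" "continuous_on {0..1} (\<lambda>t. chartG N (\<eta> t))"
    using \<eta>(1) unfolding horizontal_curve_def piecewise_C1_differentiable_on_def C1_differentiable_on_def by metis
  have cont_\<beta>: "continuous_on {0..1} \<beta>" and cont_\<nu>: "continuous_on {0..1} (\<lambda>t. logN N (\<nu> t))"
    using continuous_on_snd[OF D(3)] continuous_on_fst[OF D(3)] by (simp_all add: chart)
  \<comment> \<open>The integral runs from \<open>s\<close> to the endpoint \<open>1\<close>, so
    that every height on the curve is compared with the final height \<open>b\<close>.\<close>
  have ln: "\<bar>ln b - ln (\<beta> s)\<bar> < R" if s: "s \<in> {0..1}" for s
  proof -
    have "ennreal \<bar>ln (\<beta> 1) - ln (\<beta> s)\<bar> \<le> (\<integral>\<^sup>+ t\<in>{s..1}. ennreal \<bar>u t (0, 1)\<bar> \<partial>lborel)"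
    proof (rule abs_diff_le_nn_integral_derivative[OF _ _ K])
      show "continuous_on {s..1} (\<lambda>t. ln (\<beta> t))"
      proof (rule continuous_on_ln)
        show "continuous_on {s..1} \<beta>"
          using s by (intro continuous_on_subset[OF cont_\<beta>]) auto
        show "\<forall>t\<in>{s..1}. \<beta> t \<noteq> 0"
        proof
          fix t assume "t \<in> {s..1}"
          with s have "0 < \<beta> t" by (intro \<beta>) auto
          then show "\<beta> t \<noteq> 0" by simp
        qed
      qed
      show "((\<lambda>t. ln (\<beta> t)) has_vector_derivative u t (0, 1)) (at t)" if "t \<in> {s<..<1} - K" for t
      proof -
        have t: "t \<in> {0..1} - K" using that s by auto
        have "(\<beta> has_vector_derivative \<beta> t * u t (0, 1)) (at t)"
          using bounded_linear.has_vector_derivative[OF bounded_linear_snd der[OF t]] by (simp add: chart)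
        then have "((\<lambda>t. ln (\<beta> t)) has_real_derivative \<beta> t * u t (0, 1) / \<beta> t) (at t)"
          using \<beta>[of t] t unfolding has_real_derivative_iff_has_vector_derivative[symmetric]
          by (auto intro!: derivative_eq_intros)
        then show ?thesis
          using \<beta>[of t] t by (simp add: has_real_derivative_iff_has_vector_derivative)
      qed
    qed (use s in auto)
    also have "\<dots> \<le> control_length frame_G u"
      unfolding control_length_def
      by (rule nn_integral_mono) (use s sqrt_sum_frame_G_ge(1) in \<open>auto split: split_indicator intro!: ennreal_leI\<close>)
    also note len
    finally show ?thesis using R ends by (simp add: ennreal_less_iff)
  qed
  from ln[of 0] show "\<bar>ln b' - ln b\<bar> < R" using ends by (simp add: abs_minus_commute)
  have b: "0 < b" using \<beta>[of 1] ends by simp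
  have \<beta>_le: "\<beta> t \<le> b * exp R" if "t \<in> {0..1}" for t
  proof -
    have "ln (\<beta> t) \<le> ln (b * exp R)" using ln[OF that] b by (simp add: ln_mult)
    then show ?thesis using \<beta>[OF that] b by simp
  qed
  define v where "v t W = \<beta> t * u t (W, 0)" for t W
  have "horizontal_curve N (logN N) horizontal_frame \<nu> v"
    unfolding horizontal_curve_def
  proof (intro conjI ballI exI[of _ K])
    have "(\<lambda>t. logN N (\<nu> t)) C1_differentiable_on ({0..1} - S)"
      unfolding C1_differentiable_on_def
    proof (intro exI[of _ "\<lambda>t. fst (D t)"] conjI ballI)
      show "((\<lambda>t. logN N (\<nu> t)) has_vector_derivative fst (D t)) (at t)" if "t \<in> {0..1} - S" for t
        using bounded_linear.has_vector_derivative[OF bounded_linear_fst D(1)[OF that]] by (simp add: chart)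
    qed (intro continuous_intros D(2))
    then show "(\<lambda>t. logN N (\<nu> t)) piecewise_C1_differentiable_on {0..1}"
      using S cont_\<nu> by (auto simp: piecewise_C1_differentiable_on_def)
    show "((\<lambda>t. logN N (\<nu> t)) has_vector_derivative
        (\<Sum>W\<in>horizontal_frame. v t W *\<^sub>R left_field N (logN N) W (\<nu> t))) (at t)" if "t \<in> {0..1} - K" for t
      using bounded_linear.has_vector_derivative[OF bounded_linear_fst der[OF that]] by (simp add: chart v_def)
  qed (use K in auto)
  moreover have "control_length horizontal_frame v < ennreal (b * exp R * R)"
  proof -
    have "ennreal (sqrt (\<Sum>W\<in>horizontal_frame. (v t W)\<^sup>2)) \<le> ennreal (b * exp R) * ennreal (sqrt (\<Sum>W\<in>frame_G. (u t W)\<^sup>2))"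
      if "t \<in> {0..1}" for t
    proof -
      have "sqrt (\<Sum>W\<in>horizontal_frame. (v t W)\<^sup>2) \<le> (b * exp R) * sqrt (\<Sum>W\<in>frame_G. (u t W)\<^sup>2)"
        unfolding v_def sqrt_sum_scale
        using \<beta>[OF that] \<beta>_le[OF that] b sqrt_sum_frame_G_ge(2)[of "u t"] by (intro mult_mono) (auto simp: sum_nonneg)
      then show ?thesis using b by (simp add: ennreal_leI flip: ennreal_mult')
    qed
    then have "control_length horizontal_frame v \<le> (\<integral>\<^sup>+ t. ennreal (b * exp R) * (ennreal (sqrt (\<Sum>W\<in>frame_G. (u t W)\<^sup>2)) * indicator {0..1} t) \<partial>lborel)"
      unfolding control_length_def by (intro nn_integral_mono) (auto split: split_indicator)
    also have "\<dots> \<le> ennreal (b * exp R) * control_length frame_G u"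
      unfolding control_length_def using b by (intro nn_integral_cmult_le) simp
    also have "\<dots> < ennreal (b * exp R) * ennreal R"
      using len b by (intro ennreal_mult_strict_left_mono) auto
    also have "\<dots> = ennreal (b * exp R * R)" using b by (simp flip: ennreal_mult')
    finally show ?thesis .
  qed
  ultimately show "d_N N n' n < ennreal (b * exp R * R)"
    unfolding d_N_eq cc_dist_less_iff using ends by blast
qed

text \<open>On a compact ball of the chart the frame fields are bounded, so a curve leaving the ball
  of radius \<open>R\<close> has length at least \<open>R / C\<close>. This makes sets of small
  metric diameter small in the topology.\<close>

lemma dball_d_N_subset_open:
  assumes "open U" "n \<in> U"
  shows "\<exists>\<epsilon>>0. dball (d_N N) UNIV n \<epsilon> \<subseteq> U"
proof -
  define X0 where "X0 = logN N n"
  have "open (expo N -` U)"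
    using assms(1) continuous_expo by (simp add: continuous_on_open_vimage)
  moreover have "X0 \<in> expo N -` U" using assms(2) by (simp add: X0_def)
  ultimately obtain R where R: "0 < R" "cball X0 R \<subseteq> expo N -` U"
    by (meson open_contains_cball)
  have "\<exists>B. \<forall>X\<in>cball X0 R. norm (dstar (X, 0) (0, W)) \<le> B" for W
  proof -
    have "compact ((\<lambda>X. dstar (X, 0) (0, W)) ` cball X0 R)"
      by (intro compact_continuous_image continuous_on_dstar continuous_intros compact_cball)
    then show ?thesis
      using bounded_iff compact_imp_bounded by (metis (no_types, lifting) image_eqI)
  qed
  then obtain B where B: "\<And>W X. X \<in> cball X0 R \<Longrightarrow> norm (dstar (X, 0) (0, W)) \<le> B W" by metis
  have B0: "0 \<le> B W" for W using B[of X0 W] R(1) norm_ge_zero order_trans by (metis centre_in_cball less_imp_le)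
  define C where "C = (\<Sum>W\<in>horizontal_frame. B W) + 1"
  have C: "0 < C" using B0 by (simp add: C_def sum_nonneg add_nonneg_pos)
  have speed: "norm (\<Sum>W\<in>horizontal_frame. c W *\<^sub>R dstar (X, 0) (0, W)) \<le> C * sqrt (\<Sum>W\<in>horizontal_frame. (c W)\<^sup>2)"
    if X: "X \<in> cball X0 R" for X c
  proof -
    let ?s = "sqrt (\<Sum>W\<in>horizontal_frame. (c W)\<^sup>2)"
    have "norm (\<Sum>W\<in>horizontal_frame. c W *\<^sub>R dstar (X, 0) (0, W)) \<le> (\<Sum>W\<in>horizontal_frame. ?s * B W)"
    proof (rule sum_norm_le)
      fix W assume W: "W \<in> horizontal_frame"
      have "(c W)\<^sup>2 \<le> (\<Sum>W\<in>horizontal_frame. (c W)\<^sup>2)"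
        using W by (intro member_le_sum) auto
      then have "\<bar>c W\<bar> \<le> ?s" by (rule real_le_rsqrt[OF order_trans[rotated]]) simp
      then show "norm (c W *\<^sub>R dstar (X, 0) (0, W)) \<le> ?s * B W"
        using B[OF X] by (auto intro!: mult_mono sum_nonneg)
    qed
    also have "\<dots> = (C - 1) * ?s"
      by (simp add: C_def sum_distrib_right mult.commute)
    also have "\<dots> \<le> C * ?s"
      by (intro mult_right_mono) (auto simp: sum_nonneg)
    finally show ?thesis .
  qed
  show ?thesis
  proof (intro exI[of _ "R / C"] conjI subsetI)
    show "0 < R / C" using R C by simp
    fix h assume "h \<in> dball (d_N N) UNIV n (R / C)"
    then obtain \<eta> u where \<eta>: "horizontal_curve N (logN N) horizontal_frame \<eta> u" "\<eta> 0 = n" "\<eta> 1 = h"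
      and len: "control_length horizontal_frame u < ennreal (R / C)"
      by (auto simp: dball_def d_N_eq cc_dist_less_iff)
    define Y where "Y t = logN N (\<eta> t)" for t
    have Y0: "Y 0 = X0" using \<eta> by (simp add: Y_def X0_def)
    have cont: "continuous_on {0..1} Y"
      using \<eta>(1) unfolding horizontal_curve_def piecewise_C1_differentiable_on_def Y_def by blast
    obtain K where K: "finite K" and der: "\<And>t. t \<in> {0..1} - K \<Longrightarrow> (Y has_vector_derivative
            (\<Sum>W\<in>horizontal_frame. u t W *\<^sub>R dstar (Y t, 0) (0, W))) (at t)"
      using \<eta>(1) unfolding horizontal_curve_def left_field_N Y_def by blast
    show "h \<in> U"
    proof (rule ccontr)
      assume "h \<notin> U"
      then have "Y 1 \<notin> cball X0 R" using R(2) \<eta>(3) by (auto simp: Y_def)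
      \<comment> \<open>The least element of \<open>T\<close> is the first exit time; before it the
        curve stays in the ball where \<open>speed\<close> applies.\<close>
      define T where "T = {t\<in>{0..1}. R \<le> norm (Y t - X0)}"
      have "1 \<in> T" using \<open>Y 1 \<notin> cball X0 R\<close> by (auto simp: T_def dist_norm norm_minus_commute)
      moreover have "compact T"
      proof -
        have "closed T"
          unfolding T_def by (intro continuous_on_closed_Collect_le continuous_intros cont)
        moreover have "bounded T"
          by (rule bounded_subset[OF bounded_closed_interval[of 0 "1::real"]]) (auto simp: T_def)
        ultimately show ?thesis by (simp add: compact_eq_bounded_closed)
      qed
      ultimately obtain s where s: "s \<in> T" "\<And>t. t \<in> T \<Longrightarrow> s \<le> t"
        using compact_attains_inf[of T] by blast
      \<comment> \<open>Projecting onto the direction of the exit point reduces the vector-valued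
        estimate to the scalar one.\<close>
      define e where "e = (1 / norm (Y s - X0)) *\<^sub>R (Y s - X0)"
      have ge: "R \<le> norm (Y s - X0)" using s by (simp add: T_def)
      have e: "norm e = 1" "(Y s - X0) \<bullet> e = norm (Y s - X0)"
        using ge R(1) by (auto simp: e_def norm_eq_sqrt_inner[symmetric] dot_square_norm power2_eq_square)
      define \<gamma>' where "\<gamma>' t = (if t \<in> {0<..<s} then (\<Sum>W\<in>horizontal_frame. u t W *\<^sub>R dstar (Y t, 0) (0, W)) \<bullet> e else 0)" for t
      have "ennreal \<bar>Y s \<bullet> e - Y 0 \<bullet> e\<bar> \<le> (\<integral>\<^sup>+ t\<in>{0..s}. ennreal \<bar>\<gamma>' t\<bar> \<partial>lborel)"
      proof (rule abs_diff_le_nn_integral_derivative[OF _ _ K])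
        show "continuous_on {0..s} (\<lambda>t. Y t \<bullet> e)"
          using s by (intro continuous_intros continuous_on_subset[OF cont]) (auto simp: T_def)
        show "((\<lambda>t. Y t \<bullet> e) has_vector_derivative \<gamma>' t) (at t)" if "t \<in> {0<..<s} - K" for t
          using bounded_linear.has_vector_derivative[OF bounded_linear_inner_left der, of t e] that s(1)
          by (simp add: \<gamma>'_def T_def)
      qed (use s in \<open>auto simp: T_def\<close>)
      also have "\<dots> \<le> (\<integral>\<^sup>+ t. ennreal C * (ennreal (sqrt (\<Sum>W\<in>horizontal_frame. (u t W)\<^sup>2)) * indicator {0..1} t) \<partial>lborel)"
      proof (rule nn_integral_mono)
        fix t
        show "ennreal \<bar>\<gamma>' t\<bar> * indicator {0..s} t \<le> ennreal C * (ennreal (sqrt (\<Sum>W\<in>horizontal_frame. (u t W)\<^sup>2)) * indicator {0..1} t)"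
        proof (cases "t \<in> {0<..<s}")
          case True
          then have t: "t \<in> {0..1}" using s(1) by (auto simp: T_def)
          have "Y t \<in> cball X0 R"
            using True t s(2)[of t] by (force simp: T_def dist_norm norm_minus_commute)
          from speed[OF this, of "u t"] have "\<bar>\<gamma>' t\<bar> \<le> C * sqrt (\<Sum>W\<in>horizontal_frame. (u t W)\<^sup>2)"
            using Cauchy_Schwarz_ineq2[of "\<Sum>W\<in>horizontal_frame. u t W *\<^sub>R dstar (Y t, 0) (0, W)" e] True e(1)
            by (simp add: \<gamma>'_def)
          then show ?thesis using C t True by (simp add: ennreal_leI flip: ennreal_mult')
        qed (auto simp: \<gamma>'_def)
      qed
      also have "\<dots> \<le> ennreal C * control_length horizontal_frame u"
        unfolding control_length_def using C by (rule nn_integral_cmult_le)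
      also have "\<dots> < ennreal C * ennreal (R / C)"
        using len C by (intro ennreal_mult_strict_left_mono) auto
      also have "\<dots> = ennreal R" using C R by (simp flip: ennreal_mult')
      finally have "\<bar>Y s \<bullet> e - Y 0 \<bullet> e\<bar> < R" using R by (simp add: ennreal_less_iff)
      then show False using e(2) ge by (simp add: Y0 inner_diff_left)
    qed
  qed
qed

end

section \<open>Labels of admissible cylinders\<close>

text \<open>The cylinder with label \<open>L\<close> consists of the points \<open>(n, 1) exp (ln b Z)\<close> with \<open>(n, b) \<in> strip L\<close>.\<close>

fun strip :: "'x cyl \<Rightarrow> ('x \<times> real) set" where
  "strip (r, k, E, a) = E \<times> {a / r<..<a * r}"

fun log_height :: "'x cyl \<Rightarrow> real" where
  "log_height (r, k, E, a) = ln r"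

fun base :: "'x cyl \<Rightarrow> 'x set" where
  "base (r, k, E, a) = E"

text \<open>The heights at which the cylinder or one of its vertical halves begins or ends; vertical
  sons, being open, miss the middle one.\<close>

fun levels :: "'x cyl \<Rightarrow> real set" where
  "levels (r, k, E, a) = {a / r, a, a * r}"

declare strip.simps [simp del] sons.simps [simp del]

text \<open>The combinatorial side of the construction: nesting of cubes and arithmetic of
  admissibility, without distance or measure.\<close>

locale cylinder_system =
  fixes Q :: "int \<Rightarrow> 'x set set" and \<delta> \<gamma> \<Lambda> r0 :: real and k0 :: int and Q0 :: "'x set"
  assumes \<delta>: "0 < \<delta>" "\<delta> < 1"
    and disjoint_Q: "disjoint (Q k)"
    and countable_Q: "countable (Q k)"
    and nonempty_Q: "E \<in> Q k \<Longrightarrow> E \<noteq> {}"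
    and parent_ex1: "E \<in> Q k \<Longrightarrow> \<exists>!R. R \<in> Q (k - 1) \<and> E \<subseteq> R"
    and finite_sons: "E \<in> Q k \<Longrightarrow> finite (cube_sons Q k E)"
    and \<gamma>: "5 \<le> \<gamma>" and \<Lambda>: "exp 3 / \<delta> < \<Lambda>"
    and large_P0: "large_admissible Q \<delta> \<gamma> \<Lambda> (r0, k0, Q0, 1)"
begin

lemma cube_parent: "E \<in> Q k \<Longrightarrow> cube_parent Q k E \<in> Q (k - 1) \<and> E \<subseteq> cube_parent Q k E"
  unfolding cube_parent_def by (rule theI') (rule parent_ex1)

lemma cube_sonsD: "E' \<in> cube_sons Q k E \<Longrightarrow> E' \<in> Q (k + 1) \<and> E' \<subseteq> E \<and> cube_parent Q (k + 1) E' = E"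
  using cube_parent[of E' "k + 1"] by (auto simp: cube_sons_def)

lemma cube_sons_cover:
  assumes "E \<in> Q k" "n \<in> E" "n \<in> \<Union>(Q (k + 1))"
  shows "\<exists>E'\<in>cube_sons Q k E. n \<in> E'"
proof -
  obtain E' where E': "E' \<in> Q (k + 1)" "n \<in> E'" using assms(3) by blast
  have "cube_parent Q (k + 1) E' \<in> Q k" "n \<in> cube_parent Q (k + 1) E'"
    using cube_parent[OF E'(1)] E'(2) by auto
  then have "cube_parent Q (k + 1) E' = E"
    using disjointD[OF disjoint_Q _ assms(1)] assms(2) by blast
  then show ?thesis using E' by (auto simp: cube_sons_def)
qed

lemma \<Lambda>\<delta>: "exp 3 < \<delta> * \<Lambda>"
  using \<Lambda> \<delta> by (simp add: field_simps)

lemma \<Lambda>_pos: "0 < \<Lambda>"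
  using \<Lambda> \<delta> by (smt (verit) divide_pos_pos exp_gt_zero)

lemma powi_Suc: "\<delta> powi (k + 1) = \<delta> * \<delta> powi k" "\<delta> powi (k - 1) = \<delta> powi k / \<delta>"
  using \<delta> by (simp_all add: power_int_add_1' power_int_diff)

lemma powi_pos [simp]: "0 < \<delta> powi k"
  using \<delta> by simp

abbreviation adm where "adm \<equiv> admissible Q \<delta> \<gamma> \<Lambda>"
abbreviation large where "large \<equiv> large_admissible Q \<delta> \<gamma> \<Lambda>"
abbreviation son where "son \<equiv> sons Q \<delta> \<gamma> \<Lambda>"

lemma admD: "adm (r, k, E, a) \<Longrightarrow> E \<in> Q k \<and> 0 < a \<and> 1 < r"
  by (auto simp: admissible_def intro: less_trans[of 1 "exp 1"])

text \<open>Here the constant \<open>exp 3\<close> in the bound for \<open>\<Lambda>\<close> is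
  exhausted: with \<open>s = ln r\<close> this settles the range in which a large cylinder has small
  halves, and equality holds at \<open>s = 2\<close>. Convexity reduces the claim to the two ends of
  the interval.\<close>

lemma small_split_exp_bound:
  assumes "1 < s" "s \<le> (2::real)"
  shows "2 * exp (5 / 2 * s) \<le> s * exp 5"
proof -
  have conv: "convex_on UNIV (\<lambda>x::real. exp (5 / 2 * x))"
    by (rule f''_ge0_imp_convex[where f' = "\<lambda>x. 5 / 2 * exp (5 / 2 * x)" and f'' = "\<lambda>x. 25 / 4 * exp (5 / 2 * x)"])
       (auto intro!: derivative_eq_intros)
  define t where "t = s - 1"
  have t: "0 \<le> t" "t \<le> 1" "s = (1 - t) * 1 + t * 2" using assms by (auto simp: t_def)
  have "exp (5 / 2 * s) \<le> (1 - t) * exp (5 / 2) + t * exp 5"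
    using convex_onD[OF conv, of t 1 2] t by simp
  also have "exp (5 / 2) \<le> exp (5::real) / 2"
  proof -
    have "2 \<le> exp (5 / 2 :: real)" using exp_ge_add_one_self[of "5 / 2 :: real"] by simp
    then have "2 * exp (5 / 2 :: real) \<le> exp (5 / 2) * exp (5 / 2)" by (intro mult_right_mono) auto
    also have "\<dots> = exp (5::real)" by (simp flip: exp_add)
    finally show ?thesis by simp
  qed
  then have "(1 - t) * exp (5 / 2) + t * exp 5 \<le> (1 - t) * (exp 5 / 2) + t * exp 5"
    using t by (intro add_mono mult_left_mono) auto
  also have "\<dots> = s * exp 5 / 2" using t(3) by (simp add: field_simps t_def)
  finally show ?thesis using t by (simp add: mult_left_mono)
qed

text \<open>The lower bounds for the two vertical halves always hold. If an upper bound fails, then it fails for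
  the lower half, and since \<open>\<Lambda> > exp 3 / \<delta>\<close>, there is room to replace \<open>\<delta> powi k\<close> by \<open>\<delta> powi (k + 1)\<close>.\<close>

lemma sons_horizontal_admissible:
  assumes P: "adm (r, k, E, a)" and E': "E' \<in> Q (k + 1)"
    and not: "\<not> (adm (sqrt r, k, E, a / sqrt r) \<and> adm (sqrt r, k, E, a * sqrt r))"
  shows "adm (r, k + 1, E', a)"
proof -
  have E: "E \<in> Q k" "0 < a" "1 < r" using admD[OF P] by auto
  define w where "w = \<delta> powi k"
  have w: "0 < w" by (simp add: w_def)
  have w': "\<delta> powi (k + 1) = \<delta> * w" by (simp add: w_def powi_Suc)
  have sr: "1 < sqrt r" "sqrt r * sqrt r = r" "0 < sqrt r" using E(3) by auto
  have "sqrt r * 1 \<le> sqrt r * sqrt r" using sr by (intro mult_left_mono) auto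
  then have "sqrt r \<le> r" using sr by simp
  note sr = sr this
  have lns: "ln (sqrt r) = ln r / 2" using E(3) by (simp add: ln_sqrt)
  have lnr: "0 < ln r" using E(3) by simp
  have \<delta>w: "\<delta> * w \<le> w" using \<delta> w by simp
  \<comment> \<open>\<open>sqrt r\<close> exceeds \<open>exp 1\<close> exactly when \<open>r\<close>
    exceeds \<open>exp 2\<close>, so the cases are: cylinder and halves small; cylinder large and
    halves small; cylinder and halves large.\<close>
  consider (small) "r \<le> exp 1" | (mid) "exp 1 < r" "r \<le> exp 2" | (big) "exp 2 < r" by linarith
  then show ?thesis
  proof cases
    case small
    have b: "a * (exp 1)\<^sup>2 * ln r \<le> w" "w \<le> \<Lambda> * a * (exp 1)\<^sup>2 * ln r"
      using P small by (auto simp: admissible_def w_def)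
    have up: "\<Lambda> * (a / sqrt r) * (exp 1)\<^sup>2 * (ln r / 2) < w"
    proof (rule ccontr)
      assume "\<not> ?thesis"
      then have le: "w \<le> \<Lambda> * (a / sqrt r) * (exp 1)\<^sup>2 * (ln r / 2)" by simp
      have "a / sqrt r \<le> a * sqrt r"
        using E sr by (simp add: field_simps)
      then have le2: "\<Lambda> * (a / sqrt r) * (exp 1)\<^sup>2 * (ln r / 2) \<le> \<Lambda> * (a * sqrt r) * (exp 1)\<^sup>2 * (ln r / 2)"
        using \<Lambda>_pos lnr by (intro mult_right_mono mult_left_mono) auto
      \<comment> \<open>This is offset by the halving of \<open>ln r\<close>, so the upper half
        inherits its lower inequality from the cylinder.\<close>
      have "sqrt r \<le> 2"
      proof -
        have "r \<le> 4" using small exp_le by linarith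
        then show ?thesis by (simp add: real_le_lsqrt)
      qed
      then have "a * sqrt r * (1 / 2) \<le> a * 1" using E by simp
      then have "a * sqrt r * (1 / 2) * ((exp 1)\<^sup>2 * ln r) \<le> a * 1 * ((exp 1)\<^sup>2 * ln r)"
        using lnr by (intro mult_right_mono) auto
      then have lo2: "a * sqrt r * (exp 1)\<^sup>2 * (ln r / 2) \<le> w" using b(1) by (simp add: mult_ac)
      have "a / sqrt r \<le> a * sqrt r" by fact
      then have "a / sqrt r * ((exp 1)\<^sup>2 * (ln r / 2)) \<le> a * sqrt r * ((exp 1)\<^sup>2 * (ln r / 2))"
        using lnr by (intro mult_right_mono) auto
      then have lo1: "a / sqrt r * (exp 1)\<^sup>2 * (ln r / 2) \<le> w" using lo2 by (simp add: mult_ac)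
      have "sqrt r \<le> exp 1" using sr small by linarith
      then have "adm (sqrt r, k, E, a / sqrt r)" "adm (sqrt r, k, E, a * sqrt r)"
        using E sr le le2 lo1 lo2 by (auto simp: admissible_def lns w_def)
      then show False using not by simp
    qed
    have "a * (exp 1)\<^sup>2 * ln r \<le> \<delta> * w"
    proof -
      have "2 * sqrt r \<le> exp 3"
      proof -
        have "sqrt r \<le> exp 1" using sr small by linarith
        moreover have "2 \<le> exp (2::real)" using exp_ge_add_one_self[of "2::real"] by simp
        ultimately have "2 * sqrt r \<le> exp 2 * exp 1" using E(3) by (intro mult_mono) auto
        then show ?thesis by (simp flip: exp_add)
      qed
      then have "1 \<le> \<delta> * \<Lambda> / (2 * sqrt r)" using \<Lambda>\<delta> sr by (simp add: field_simps)
      then have "1 * (a * (exp 1)\<^sup>2 * ln r) \<le> \<delta> * \<Lambda> / (2 * sqrt r) * (a * (exp 1)\<^sup>2 * ln r)"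
        using E lnr by (intro mult_right_mono) auto
      also have "\<dots> = \<delta> * (\<Lambda> * (a / sqrt r) * (exp 1)\<^sup>2 * (ln r / 2))" by (simp add: field_simps)
      also have "\<dots> \<le> \<delta> * w" by (rule mult_left_mono[OF less_imp_le[OF up]]) (use \<delta> in simp)
      finally show ?thesis by simp
    qed
    then show ?thesis using small E E' b \<delta>w by (auto simp: admissible_def w')
  next
    case mid
    have "\<not> r \<le> exp 1" using mid by simp
    then have b: "a * r\<^sup>2 \<le> w" "w \<le> \<Lambda> * a * r powr \<gamma>"
      using P by (auto simp: admissible_def w_def)
    define x where "x = ln r"
    have x: "1 < x" "x \<le> 2"
    proof -
      have "ln (exp 1) < ln r" using mid E(3) by (subst ln_less_cancel_iff) auto
      then show "1 < x" by (simp add: x_def)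
      have "ln r \<le> ln (exp 2)" using mid E(3) by (subst ln_le_cancel_iff) auto
      then show "x \<le> 2" by (simp add: x_def)
    qed
    have e2: "(exp 1)\<^sup>2 = exp (2::real)" using exp_double[of "1::real"] by simp
    have r_exp: "r = exp x" using E(3) by (simp add: x_def)
    have "sqrt r = exp (x / 2)"
      by (rule real_sqrt_unique) (simp_all add: r_exp power2_eq_square flip: exp_add)
    moreover have "r\<^sup>2 = exp (2 * x)" by (simp add: r_exp exp_double)
    ultimately have rx: "r = exp x" "sqrt r = exp (x / 2)" "r\<^sup>2 = exp (2 * x)" using r_exp by auto
    have up: "\<Lambda> * (a / sqrt r) * (exp 1)\<^sup>2 * (ln r / 2) < w"
    proof (rule ccontr)
      assume "\<not> ?thesis"
      then have le: "w \<le> \<Lambda> * (a / sqrt r) * (exp 1)\<^sup>2 * (ln r / 2)" by simp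
      have div_le: "a / sqrt r \<le> a * sqrt r" using E sr by (simp add: field_simps)
      then have le2: "\<Lambda> * (a / sqrt r) * (exp 1)\<^sup>2 * (ln r / 2) \<le> \<Lambda> * (a * sqrt r) * (exp 1)\<^sup>2 * (ln r / 2)"
        using \<Lambda>_pos lnr by (intro mult_right_mono mult_left_mono) auto
      have "exp 2 * x / 2 \<le> exp (3 / 2 * x)"
      proof -
        have "x / 2 \<le> exp (x / 2 - 1)" using exp_ge_add_one_self[of "x / 2 - 1"] by simp
        then have "exp 2 * (x / 2) \<le> exp 2 * exp (x / 2 - 1)" by simp
        also have "\<dots> = exp (x / 2 + 1)" by (simp flip: exp_add)
        also have "\<dots> \<le> exp (3 / 2 * x)" using x by simp
        finally show ?thesis by simp
      qed
      then have "exp (x / 2) * (exp 2 * x / 2) \<le> exp (x / 2) * exp (3 / 2 * x)" by simp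
      also have "\<dots> = exp (2 * x)" by (simp flip: exp_add)
      finally have "a * (exp (x / 2) * (exp 2 * x / 2)) \<le> a * exp (2 * x)" using E by simp
      then have lo2: "a * sqrt r * (exp 1)\<^sup>2 * (ln r / 2) \<le> w"
        using b(1) unfolding rx(2,3) x_def[symmetric] e2 by (simp add: mult_ac)
      have "a / sqrt r * ((exp 1)\<^sup>2 * (ln r / 2)) \<le> a * sqrt r * ((exp 1)\<^sup>2 * (ln r / 2))"
        using lnr div_le by (intro mult_right_mono) auto
      then have lo1: "a / sqrt r * (exp 1)\<^sup>2 * (ln r / 2) \<le> w" using lo2 by (simp add: mult_ac)
      have "sqrt r \<le> exp 1" using x by (simp only: rx(2)) simp
      then have "adm (sqrt r, k, E, a / sqrt r)" "adm (sqrt r, k, E, a * sqrt r)"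
        using E sr le le2 lo1 lo2 by (auto simp: admissible_def lns w_def)
      then show False using not by simp
    qed
    have "a * r\<^sup>2 \<le> \<delta> * w"
    proof -
      have "exp (x / 2) * (2 * exp (2 * x)) = 2 * exp (5 / 2 * x)" by (simp flip: exp_add)
      also have "\<dots> \<le> x * exp 5" by (rule small_split_exp_bound) (use x in auto)
      finally have "exp (2 * x) * 2 * exp (x / 2) \<le> x * exp 5" by (simp add: mult_ac)
      then have "exp (2 * x) \<le> x * exp 5 / exp (x / 2) / 2" by (simp add: pos_le_divide_eq mult_ac)
      then have "a * exp (2 * x) \<le> a * (x * exp 5 / exp (x / 2) / 2)"
        by (rule mult_left_mono) (use E in simp)
      also have "\<dots> = exp 3 * (a / exp (x / 2) * exp 2 * (x / 2))"
      proof -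
        have "exp 5 = exp 3 * exp (2::real)" by (simp flip: exp_add)
        then show ?thesis by simp
      qed
      also have "\<dots> \<le> \<delta> * \<Lambda> * (a / exp (x / 2) * exp 2 * (x / 2))"
        using \<Lambda>\<delta> E x by (intro mult_right_mono) auto
      also have "\<dots> = \<delta> * (\<Lambda> * (a / sqrt r) * (exp 1)\<^sup>2 * (ln r / 2))"
        unfolding rx(2) x_def[symmetric] e2 by (simp add: mult_ac)
      also have "\<dots> \<le> \<delta> * w" by (rule mult_left_mono[OF less_imp_le[OF up]]) (use \<delta> in simp)
      finally show ?thesis by (simp only: rx(3))
    qed
    then show ?thesis using mid E E' b \<delta>w by (auto simp: admissible_def w')
  next
    case big
    then have r1: "exp 1 < r" by (rule less_trans[rotated]) simp
    then have b: "a * r\<^sup>2 \<le> w" "w \<le> \<Lambda> * a * r powr \<gamma>"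
      using P by (auto simp: admissible_def w_def)
    have pw: "sqrt r powr \<gamma> = r powr (\<gamma> / 2)"
      using E by (simp add: powr_half_sqrt[symmetric] powr_powr)
    have div_eq: "r powr (\<gamma> / 2) / sqrt r = r powr ((\<gamma> - 1) / 2)"
      using E by (simp add: powr_half_sqrt[symmetric] diff_divide_distrib flip: powr_diff)
    have up: "\<Lambda> * (a / sqrt r) * r powr (\<gamma> / 2) < w"
    proof (rule ccontr)
      assume "\<not> ?thesis"
      then have le: "w \<le> \<Lambda> * (a / sqrt r) * r powr (\<gamma> / 2)" by simp
      have div_le: "a / sqrt r \<le> a * sqrt r" using E sr by (simp add: field_simps)
      then have le2: "\<Lambda> * (a / sqrt r) * r powr (\<gamma> / 2) \<le> \<Lambda> * (a * sqrt r) * r powr (\<gamma> / 2)"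
        using \<Lambda>_pos by (intro mult_right_mono mult_left_mono) auto
      have "a * sqrt r * (sqrt r)\<^sup>2 = a * sqrt r * r" using E by simp
      also have "\<dots> \<le> a * r * r" using E sr by (intro mult_right_mono mult_left_mono) auto
      also have "\<dots> = a * r\<^sup>2" by (simp add: power2_eq_square)
      also note b(1)
      finally have lo2: "a * sqrt r * (sqrt r)\<^sup>2 \<le> w" .
      have "a / sqrt r * r \<le> a * sqrt r * r" using div_le E by (intro mult_right_mono) auto
      then have lo1: "a / sqrt r * (sqrt r)\<^sup>2 \<le> w" using lo2 E by simp
      have "exp 1 < sqrt r"
      proof -
        have "sqrt (exp 2) < sqrt r" using big by simp
        moreover have "sqrt (exp 2) = exp (1::real)" by (rule real_sqrt_unique) (simp_all add: power2_eq_square flip: exp_add)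
        ultimately show ?thesis by simp
      qed
      then have "adm (sqrt r, k, E, a / sqrt r)" "adm (sqrt r, k, E, a * sqrt r)"
        using E sr le le2 lo1 lo2 by (auto simp: admissible_def pw w_def)
      then show False using not by simp
    qed
    have "a * r\<^sup>2 \<le> \<delta> * w"
    proof -
      have "r\<^sup>2 = r powr 2" using E by simp
      \<comment> \<open>Here \<open>5 \<le> \<gamma>\<close> enters, as
        \<open>2 \<le> (\<gamma> - 1) / 2\<close>.\<close>
      also have "\<dots> \<le> r powr ((\<gamma> - 1) / 2)" using E \<gamma> by (intro powr_mono) auto
      finally have "a * r\<^sup>2 \<le> a * r powr ((\<gamma> - 1) / 2)" using E by simp
      also have "\<dots> \<le> exp 3 * (a * r powr ((\<gamma> - 1) / 2))"
        using mult_right_mono[of 1 "exp 3" "a * r powr ((\<gamma> - 1) / 2)"] E by simp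
      also have "\<dots> \<le> \<delta> * \<Lambda> * (a * r powr ((\<gamma> - 1) / 2))"
        using \<Lambda>\<delta> E by (intro mult_right_mono) auto
      also have "\<dots> = \<delta> * (\<Lambda> * (a / sqrt r) * r powr (\<gamma> / 2))" by (simp flip: div_eq)
      also have "\<dots> \<le> \<delta> * w" by (rule mult_left_mono[OF less_imp_le[OF up]]) (use \<delta> in simp)
      finally show ?thesis .
    qed
    then show ?thesis using r1 E E' b \<delta>w by (auto simp: admissible_def w')
  qed
qed

lemma sons_cases:
  assumes "adm P" "L \<in> son P"
  obtains (vertical) r k E a where "P = (r, k, E, a)" "L = (sqrt r, k, E, a / sqrt r) \<or> L = (sqrt r, k, E, a * sqrt r)"
      "adm (sqrt r, k, E, a / sqrt r)" "adm (sqrt r, k, E, a * sqrt r)"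
      "son P = {(sqrt r, k, E, a / sqrt r), (sqrt r, k, E, a * sqrt r)}"
    | (horizontal) r k E a E' where "P = (r, k, E, a)" "L = (r, k + 1, E', a)" "E' \<in> cube_sons Q k E"
      "son P = {(r, k + 1, E', a) |E'. E' \<in> cube_sons Q k E}" "adm (r, k + 1, E', a)"
proof -
  obtain r k E a where P: "P = (r, k, E, a)" by (cases P)
  show ?thesis
  proof (cases "adm (sqrt r, k, E, a / sqrt r) \<and> adm (sqrt r, k, E, a * sqrt r)")
    case True
    then show ?thesis using assms P vertical[of r k E a] by (auto simp: sons.simps Let_def)
  next
    case False
    then obtain E' where E': "E' \<in> cube_sons Q k E" "L = (r, k + 1, E', a)"
      using assms P by (auto simp: sons.simps Let_def)
    have "adm (r, k + 1, E', a)"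
      using sons_horizontal_admissible[of r k E a E'] assms(1) P False cube_sonsD[OF E'(1)] by blast
    then show ?thesis using False assms P horizontal[of r k E a E'] E' by (auto simp: sons.simps Let_def)
  qed
qed

lemma adm_son: "adm P \<Longrightarrow> L \<in> son P \<Longrightarrow> adm L"
  by (erule (1) sons_cases) auto

lemma strip_vertical:
  assumes "1 < r" "0 < a"
  shows "strip (sqrt r, k, E, a / sqrt r) = E \<times> {a / r<..<a}" "strip (sqrt r, k, E, a * sqrt r) = E \<times> {a<..<a * r}"
proof -
  have "a / sqrt r / sqrt r = a / r" "a / sqrt r * sqrt r = a" "a * sqrt r / sqrt r = a" "a * sqrt r * sqrt r = a * r"
    using assms by (simp_all add: mult.assoc)
  then show "strip (sqrt r, k, E, a / sqrt r) = E \<times> {a / r<..<a}" "strip (sqrt r, k, E, a * sqrt r) = E \<times> {a<..<a * r}"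
    by (simp_all only: strip.simps)
qed

lemma adm_order: "adm (r, k, E, a) \<Longrightarrow> a / r < a \<and> a < a * r \<and> 0 < a / r"
  using admD[of r k E a] by (auto simp: field_simps)

lemma strip_son_subset:
  assumes "adm P" "L \<in> son P"
  shows "strip L \<subseteq> strip P"
  using assms
proof (cases rule: sons_cases)
  case (vertical r k E a)
  then have adm: "adm (r, k, E, a)" using assms(1) by simp
  have o: "a / r < a" "a < a * r" using adm_order[OF adm] by auto
  have "{a / r<..<a} \<subseteq> {a / r<..<a * r}" "{a<..<a * r} \<subseteq> {a / r<..<a * r}"
    by (rule subsetI, metis greaterThanLessThan_iff less_trans o)+
  then show ?thesis
    using vertical admD[OF adm] strip_vertical[of r a k E] by (auto simp: strip.simps(1)[of r])
next
  case (horizontal r k E a E')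
  then show ?thesis using cube_sonsD[of E' k E] by (auto simp: strip.simps)
qed

lemma strip_sons_disjoint:
  assumes "adm P" "L \<in> son P" "L' \<in> son P" "L \<noteq> L'"
  shows "strip L \<inter> strip L' = {}"
  using assms(1,2)
proof (cases rule: sons_cases)
  case (vertical r k E a)
  then show ?thesis
    using assms(1,3,4) adm_order[of r k E a] admD[of r k E a] strip_vertical[of r a k E] by auto
next
  case (horizontal r k E a E')
  then obtain E'' where E'': "L' = (r, k + 1, E'', a)" "E'' \<in> cube_sons Q k E"
    using assms(3) by auto
  then have "E' \<inter> E'' = {}"
    using disjointD[OF disjoint_Q, of E' "k + 1" E''] cube_sonsD horizontal(2,3) assms(4) by auto
  then show ?thesis using horizontal(2) E''(1) by (auto simp: strip.simps)
qed

lemma countable_sons: "adm P \<Longrightarrow> countable (son P)"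
proof -
  assume "adm P"
  obtain r k E a where P: "P = (r, k, E, a)" by (cases P)
  have "finite (cube_sons Q k E)" using finite_sons admD \<open>adm P\<close> P by blast
  then show ?thesis using P by (auto simp: sons.simps Let_def countable_finite)
qed

lemma sons_cover:
  assumes "adm P" "(n, b) \<in> strip P" "b \<notin> levels P" "\<And>k. n \<in> \<Union>(Q k)"
  shows "\<exists>L\<in>son P. (n, b) \<in> strip L"
proof -
  obtain r k E a where P: "P = (r, k, E, a)" by (cases P)
  have E: "E \<in> Q k" "0 < a" "1 < r" using admD assms(1) P by blast+
  show ?thesis
  proof (cases "adm (sqrt r, k, E, a / sqrt r) \<and> adm (sqrt r, k, E, a * sqrt r)")
    case True
    have "b < a \<or> a < b" using assms(3) P by auto
    then have "(n, b) \<in> strip (sqrt r, k, E, a / sqrt r) \<or> (n, b) \<in> strip (sqrt r, k, E, a * sqrt r)"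
      using assms(2) P E strip_vertical[of r a k E] by (auto simp: strip.simps(1)[of r])
    then show ?thesis using True P by (auto simp: sons.simps Let_def)
  next
    case False
    have "n \<in> E" using assms(2) P by (simp add: strip.simps)
    then obtain E' where "E' \<in> cube_sons Q k E" "n \<in> E'"
      using cube_sons_cover[OF E(1) _ assms(4)] by blast
    then show ?thesis using False P assms(2) by (auto simp: sons.simps strip.simps Let_def)
  qed
qed

lemma sons_iter_adm: "adm P \<Longrightarrow> L \<in> sons_iter Q \<delta> \<gamma> \<Lambda> m P \<Longrightarrow> adm L"
proof (induction m arbitrary: L)
  case (Suc m)
  then obtain R where "R \<in> sons_iter Q \<delta> \<gamma> \<Lambda> m P" "L \<in> son R" by auto
  then show ?case using Suc adm_son by blast
qed simp

lemma sons_iter_subset: "adm P \<Longrightarrow> L \<in> sons_iter Q \<delta> \<gamma> \<Lambda> m P \<Longrightarrow> strip L \<subseteq> strip P"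
proof (induction m arbitrary: L)
  case (Suc m)
  then obtain R where "R \<in> sons_iter Q \<delta> \<gamma> \<Lambda> m P" "L \<in> son R" by auto
  then show ?case using Suc sons_iter_adm strip_son_subset by blast
qed simp

lemma sons_iter_disjoint:
  "adm P \<Longrightarrow> L \<in> sons_iter Q \<delta> \<gamma> \<Lambda> m P \<Longrightarrow> L' \<in> sons_iter Q \<delta> \<gamma> \<Lambda> m P \<Longrightarrow> L \<noteq> L' \<Longrightarrow> strip L \<inter> strip L' = {}"
proof (induction m arbitrary: L L')
  case (Suc m)
  then obtain R R' where R: "R \<in> sons_iter Q \<delta> \<gamma> \<Lambda> m P" "L \<in> son R" "R' \<in> sons_iter Q \<delta> \<gamma> \<Lambda> m P" "L' \<in> son R'" by auto
  then have adm: "adm R" "adm R'" using Suc(2) sons_iter_adm by auto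
  show ?case
  proof (cases "R = R'")
    case True
    then show ?thesis using strip_sons_disjoint[OF adm(1)] R Suc(5) by simp
  next
    case False
    from Suc.IH[OF Suc(2) R(1,3) False] strip_son_subset[OF adm(1) R(2)] strip_son_subset[OF adm(2) R(4)]
    show ?thesis by blast
  qed
qed simp

lemma countable_sons_iter:
  assumes "adm P"
  shows "countable (sons_iter Q \<delta> \<gamma> \<Lambda> m P)"
proof (induction m)
  case (Suc m)
  show ?case
    unfolding sons_iter.simps by (rule countable_UN[OF Suc]) (rule countable_sons[OF sons_iter_adm[OF assms]])
qed simp

lemma same_type_disjoint:
  assumes "L \<in> same_type Q P" "L' \<in> same_type Q P" "L \<noteq> L'"
  shows "strip L \<inter> strip L' = {}"
proof -
  obtain r k E a where P: "P = (r, k, E, a)" by (cases P)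
  with assms obtain E1 E2 where "L = (r, k, E1, a)" "L' = (r, k, E2, a)" "E1 \<in> Q k" "E2 \<in> Q k" "E1 \<noteq> E2" by auto
  then show ?thesis using disjointD[OF disjoint_Q, of E1 k E2] by (auto simp: strip.simps)
qed

lemma countable_same_type: "countable (same_type Q P)"
proof -
  obtain r k E a where P: "P = (r, k, E, a)" by (cases P)
  have "same_type Q P = (\<lambda>E'. (r, k, E', a)) ` Q k" using P by auto
  then show ?thesis using countable_Q by simp
qed

end

section \<open>Vertical enlargements and the main sequence\<close>

context cylinder_system
begin

text \<open>Passing to the parent cube increases \<open>\<delta> powi k\<close>, so the lower
  inequality persists and it is the upper one that fails; since \<open>\<delta> * \<Lambda>\<close>
  exceeds \<open>1\<close>, this leaves a bound without the factor \<open>\<Lambda>\<close>.\<close>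

lemma vertical_bound:
  assumes P: "large (r, k, E, a)" and not: "\<not> adm (p_side Q (r, k, E, a))"
  shows "a * r powr \<gamma> < \<delta> powi k"
proof (rule ccontr)
  assume "\<not> ?thesis"
  then have le: "\<delta> powi k \<le> a * r powr \<gamma>" by simp
  have E: "E \<in> Q k" "0 < a" "exp 1 < r" "a * r\<^sup>2 \<le> \<delta> powi k" using P by auto
  have "\<delta> powi k * 1 \<le> \<delta> powi k / \<delta>"
    using \<delta> by (simp add: field_simps)
  then have "a * r\<^sup>2 \<le> \<delta> powi (k - 1)" using E(4) unfolding powi_Suc by linarith
  moreover have "\<delta> powi (k - 1) \<le> \<Lambda> * a * r powr \<gamma>"
  proof -
    have "1 \<le> exp (3::real)" by simp
    then have "1 \<le> \<delta> * \<Lambda>" using \<Lambda>\<delta> by linarith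
    then have "1 * (a * r powr \<gamma>) \<le> \<delta> * \<Lambda> * (a * r powr \<gamma>)"
      using E by (intro mult_right_mono) auto
    with le have "\<delta> powi k \<le> \<delta> * (\<Lambda> * a * r powr \<gamma>)" by (simp add: mult_ac)
    then show ?thesis unfolding powi_Suc using \<delta> by (simp add: field_simps)
  qed
  ultimately have "adm (p_side Q (r, k, E, a))"
    using E cube_parent[OF E(1)] by (simp add: admissible_def)
  with not show False by simp
qed

text \<open>The lower inequalities of the four cylinders ask for
  \<open>a * r ^ n \<le> \<delta> powi k\<close> with \<open>n\<close> at most \<open>5\<close>, the
  value \<open>5\<close> occurring for \<open>p_up\<close>; this is what
  \<open>5 \<le> \<gamma>\<close> provides. The upper ones follow from that of the original cylinder
  because \<open>a * r powr \<gamma>\<close> does not decrease.\<close>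

lemma vertical_large:
  assumes P: "large (r, k, E, a)" and b: "a * r powr \<gamma> < \<delta> powi k"
  shows "large (p_up (r, k, E, a))" "large (rest_up (r, k, E, a))"
    "large (p_down (r, k, E, a))" "large (rest_down (r, k, E, a))"
proof -
  define w where "w = \<delta> powi k"
  have E: "E \<in> Q k" "0 < a" "exp 1 < r" "w \<le> \<Lambda> * a * r powr \<gamma>" using P by (auto simp: w_def)
  have r: "1 < r" using E(3) by (auto intro: less_trans[of 1 "exp 1"])
  have pw: "r ^ n \<le> r ^ 5" if "n \<le> 5" for n using r that by (intro power_increasing) auto
  have "r ^ 5 = r powr 5" using r by simp
  also have "\<dots> \<le> r powr \<gamma>" using r \<gamma> by (intro powr_mono) auto
  finally have p5: "r ^ n \<le> r powr \<gamma>" if "n \<le> 5" for n using pw[OF that] by simp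
  have lo: "a * r ^ n \<le> w" if "n \<le> 5" for n
  proof -
    have "a * r ^ n \<le> a * r powr \<gamma>" using p5[OF that] E by simp
    with b show ?thesis by (simp add: w_def)
  qed
  have up: "w \<le> \<Lambda> * c" if "a * r powr \<gamma> \<le> c" for c
  proof -
    have "\<Lambda> * (a * r powr \<gamma>) \<le> \<Lambda> * c" using that \<Lambda>_pos by simp
    with E(4) show ?thesis by (simp add: mult_ac)
  qed
  have exp_less: "exp 1 < r ^ n" if "n \<noteq> 0" for n
    using E(3) r power_increasing[of 1 n r] that by auto
  have powr_pow: "(r ^ n) powr \<gamma> = (r powr \<gamma>) ^ n" for n
    using r by (simp add: powr_power powr_realpow[symmetric] powr_powr mult.commute)
  have g1: "1 \<le> r powr \<gamma>" using r \<gamma> by (simp add: ge_one_powr_ge_zero)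
  have gn: "r powr \<gamma> * r ^ m \<le> (r powr \<gamma>) ^ Suc n" if "m \<le> 5" "n \<noteq> 0" for m n
  proof -
    have "r ^ m \<le> r powr \<gamma>" using p5[OF that(1)] .
    also have "\<dots> \<le> (r powr \<gamma>) ^ n" using power_increasing[of 1 n "r powr \<gamma>"] g1 that(2) by auto
    finally show ?thesis using r by simp
  qed
  show "large (p_up (r, k, E, a))"
  proof -
    have "a * r * (r\<^sup>2)\<^sup>2 \<le> w" using lo[of 5] by (simp add: eval_nat_numeral mult_ac)
    moreover have "w \<le> \<Lambda> * (a * r * (r\<^sup>2) powr \<gamma>)"
    proof (rule up)
      have "r powr \<gamma> * 1 \<le> (r powr \<gamma>) ^ 2 * r"
        using gn[of 0 1] r g1 by (intro mult_mono) (auto simp: numeral_2_eq_2)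
      then show "a * r powr \<gamma> \<le> a * r * (r\<^sup>2) powr \<gamma>"
        unfolding powr_pow using E by (simp add: mult_ac)
    qed
    ultimately show ?thesis using E exp_less[of 2] r by (simp add: w_def mult.assoc)
  qed
  show "large (rest_up (r, k, E, a))"
  proof -
    have "a * r\<^sup>2 * r\<^sup>2 \<le> w" using lo[of 4] by (simp add: eval_nat_numeral mult_ac)
    moreover have "w \<le> \<Lambda> * (a * r\<^sup>2 * r powr \<gamma>)"
    proof (rule up)
      have "1 * r powr \<gamma> \<le> r\<^sup>2 * r powr \<gamma>" using r by (intro mult_right_mono) auto
      then show "a * r powr \<gamma> \<le> a * r\<^sup>2 * r powr \<gamma>" using E by (simp add: mult.assoc)
    qed
    ultimately show ?thesis using E r by (simp add: w_def mult.assoc)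
  qed
  show "large (p_down (r, k, E, a))"
  proof -
    have "a / r\<^sup>2 * (r ^ 3)\<^sup>2 \<le> w" using lo[of 4] r by (simp add: eval_nat_numeral field_simps)
    moreover have "w \<le> \<Lambda> * (a / r\<^sup>2 * (r ^ 3) powr \<gamma>)"
    proof (rule up)
      have "r powr \<gamma> * r\<^sup>2 \<le> (r powr \<gamma>) ^ 3" using gn[of 2 2] by (simp add: eval_nat_numeral)
      then have "a * (r powr \<gamma> * r\<^sup>2) \<le> a * (r powr \<gamma>) ^ 3" using E by simp
      then show "a * r powr \<gamma> \<le> a / r\<^sup>2 * (r ^ 3) powr \<gamma>"
        unfolding powr_pow using r by (simp add: pos_le_divide_eq mult.assoc)
    qed
    ultimately show ?thesis using E exp_less[of 3] r by (simp add: w_def mult.assoc)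
  qed
  show "large (rest_down (r, k, E, a))"
  proof -
    have "a / r ^ 3 * (r\<^sup>2)\<^sup>2 \<le> w" using lo[of 1] r by (simp add: eval_nat_numeral field_simps)
    moreover have "w \<le> \<Lambda> * (a / r ^ 3 * (r\<^sup>2) powr \<gamma>)"
    proof (rule up)
      have "r powr \<gamma> * r ^ 3 \<le> (r powr \<gamma>) ^ 2" using gn[of 3 1] by (simp add: eval_nat_numeral)
      then have "a * (r powr \<gamma> * r ^ 3) \<le> a * (r powr \<gamma>) ^ 2" using E by simp
      then show "a * r powr \<gamma> \<le> a / r ^ 3 * (r\<^sup>2) powr \<gamma>"
        unfolding powr_pow using r by (simp add: pos_le_divide_eq mult.assoc)
    qed
    ultimately show ?thesis using E exp_less[of 2] r by (simp add: w_def mult.assoc)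
  qed
qed

abbreviation P0 where "P0 \<equiv> (r0, k0, Q0, 1::real)"

definition P where "P i = fst (main_seq Q \<delta> \<gamma> \<Lambda> P0 i)"
definition upward where "upward i = snd (main_seq Q \<delta> \<gamma> \<Lambda> P0 i)"
definition horizontal where "horizontal i \<longleftrightarrow> adm (p_side Q (P i))"
definition hr where "hr i = fst (P i)"
definition gen where "gen i = fst (snd (P i))"
definition cube where "cube i = fst (snd (snd (P i)))"
definition mid where "mid i = snd (snd (snd (P i)))"
definition lo where "lo i = mid i / hr i"
definition hi where "hi i = mid i * hr i"

lemma P_eq: "P i = (hr i, gen i, cube i, mid i)"
  by (simp add: hr_def gen_def cube_def mid_def)

lemma P_0: "P 0 = P0" "upward 0"
  by (simp_all add: P_def upward_def)

lemma P_Suc: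
  "P (Suc i) = (if horizontal i then p_side Q (P i) else if upward i then p_up (P i) else p_down (P i))"
  "upward (Suc i) = (if horizontal i then upward i else \<not> upward i)"
  by (simp_all add: P_def upward_def horizontal_def split: prod.splits)

abbreviation Smain where "Smain \<equiv> S_main Q \<delta> \<gamma> \<Lambda> P0"
abbreviation Srest where "Srest \<equiv> S_rest Q \<delta> \<gamma> \<Lambda> P0"

lemma Smain_iff: "L \<in> Smain i \<longleftrightarrow> (\<exists>E\<in>Q (gen i). L = (hr i, gen i, E, mid i))"
  unfolding S_main_def P_def[symmetric] P_eq[of i] by auto

lemma Srest_eq:
  "Srest i = (if horizontal i then {} else if upward i then same_type Q (rest_up (P i)) else same_type Q (rest_down (P i)))"
  by (simp add: S_rest_def P_def upward_def horizontal_def split: prod.splits)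

text \<open>A horizontal step keeps \<open>r\<close> above \<open>exp 1\<close>, which rules out the
  small type; when it is not possible, \<open>vertical_bound\<close> supplies the hypothesis of
  \<open>vertical_large\<close>.\<close>

lemma large_P: "large (P i)"
proof (induction i)
  case 0
  then show ?case using large_P0 by (simp add: P_0)
next
  case (Suc i)
  show ?case
  proof (cases "horizontal i")
    case True
    then have "adm (p_side Q (P i))" by (simp add: horizontal_def)
    moreover have "\<not> hr i \<le> exp 1" using Suc unfolding P_eq[of i] by auto
    ultimately show ?thesis using True by (simp add: P_Suc admissible_def P_eq[of i])
  next
    case False
    then have "mid i * hr i powr \<gamma> < \<delta> powi gen i"
      using vertical_bound[of "hr i" "gen i" "cube i" "mid i"] Suc unfolding horizontal_def P_eq[of i] by blast
    from vertical_large(1,3)[OF Suc[unfolded P_eq[of i]] this] False show ?thesis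
      by (simp only: P_Suc P_eq[of i] if_False split: if_split) blast
  qed
qed

lemma large_Srest:
  assumes "L \<in> Srest i"
  shows "large L"
proof -
  have nh: "\<not> horizontal i" using assms by (auto simp: Srest_eq split: if_splits)
  then have "mid i * hr i powr \<gamma> < \<delta> powi gen i"
    using vertical_bound[of "hr i" "gen i" "cube i" "mid i"] large_P[of i] unfolding horizontal_def P_eq[of i] by blast
  from vertical_large(2,4)[OF large_P[of i, unfolded P_eq[of i]] this]
  show ?thesis using assms nh unfolding Srest_eq P_eq[of i] by (auto split: if_splits)
qed

lemma P_bounds: "0 < mid i" "exp 1 < hr i" "1 < hr i"
  using large_P[of i] unfolding P_eq[of i] by (auto intro: less_trans[of 1 "exp 1"])

lemma lo_less_hi: "0 < lo i" "lo i < mid i" "mid i < hi i"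
  using P_bounds[of i] by (auto simp: lo_def hi_def field_simps)

lemma adm_Smain: "L \<in> Smain i \<Longrightarrow> adm L"
  using large_P[of i] unfolding P_eq[of i] by (auto simp: Smain_iff admissible_def)

lemma adm_Srest: "L \<in> Srest i \<Longrightarrow> adm L"
  using large_Srest by (simp add: admissible_def)

lemma step_horizontal:
  assumes "horizontal i"
  shows "hr (Suc i) = hr i" "gen (Suc i) = gen i - 1" "mid (Suc i) = mid i" "lo (Suc i) = lo i" "hi (Suc i) = hi i"
  using assms P_Suc(1)[of i] P_eq[of i] P_eq[of "Suc i"] by (auto simp: lo_def hi_def)

lemma step_up:
  assumes "\<not> horizontal i" "upward i"
  shows "hr (Suc i) = (hr i)\<^sup>2" "gen (Suc i) = gen i" "mid (Suc i) = mid i * hr i" "lo (Suc i) = lo i" "hi (Suc i) = hi i * (hr i)\<^sup>2"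
proof -
  show 1: "hr (Suc i) = (hr i)\<^sup>2" "gen (Suc i) = gen i" "mid (Suc i) = mid i * hr i"
    using assms P_Suc(1)[of i] P_eq[of i] P_eq[of "Suc i"] by auto
  show "lo (Suc i) = lo i" "hi (Suc i) = hi i * (hr i)\<^sup>2"
    using P_bounds[of i] by (simp_all add: lo_def hi_def 1 power2_eq_square)
qed

lemma step_down:
  assumes "\<not> horizontal i" "\<not> upward i"
  shows "hr (Suc i) = (hr i) ^ 3" "gen (Suc i) = gen i" "mid (Suc i) = mid i / (hr i)\<^sup>2" "lo (Suc i) = lo i / (hr i) ^ 4" "hi (Suc i) = hi i"
proof -
  show 1: "hr (Suc i) = (hr i) ^ 3" "gen (Suc i) = gen i" "mid (Suc i) = mid i / (hr i)\<^sup>2"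
    using assms P_Suc(1)[of i] P_eq[of i] P_eq[of "Suc i"] by auto
  show "lo (Suc i) = lo i / (hr i) ^ 4" "hi (Suc i) = hi i"
    using P_bounds[of i] by (simp_all add: lo_def hi_def 1 eval_nat_numeral field_simps)
qed

lemma lo_Suc: "lo (Suc i) \<le> lo i" and hi_Suc: "hi i \<le> hi (Suc i)" and hr_Suc: "hr i \<le> hr (Suc i)"
proof -
  have r: "1 < hr i" by (rule P_bounds)
  have pw: "1 \<le> hr i ^ n" for n using r by simp
  have "lo (Suc i) \<le> lo i \<and> hi i \<le> hi (Suc i) \<and> hr i \<le> hr (Suc i)"
  proof (cases "horizontal i")
    case True
    then show ?thesis by (simp add: step_horizontal)
  next
    case False
    show ?thesis
    proof (cases "upward i")
      case True
      have "hi i * 1 \<le> hi i * (hr i)\<^sup>2" using pw[of 2] lo_less_hi[of i] by (intro mult_left_mono) auto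
      moreover have "hr i ^ 1 \<le> (hr i)\<^sup>2" using r by (intro power_increasing) auto
      ultimately show ?thesis using step_up[OF False True] by simp
    next
      case down: False
      have "lo i * 1 \<le> lo i * hr i ^ 4" using pw[of 4] lo_less_hi[of i] by (intro mult_left_mono) auto
      then have "lo i / hr i ^ 4 \<le> lo i" using r by (simp add: pos_divide_le_eq)
      moreover have "hr i ^ 1 \<le> hr i ^ 3" using r by (intro power_increasing) auto
      ultimately show ?thesis using step_down[OF False down] by simp
    qed
  qed
  then show "lo (Suc i) \<le> lo i" "hi i \<le> hi (Suc i)" "hr i \<le> hr (Suc i)" by auto
qed

lemma lo_antimono: "i \<le> j \<Longrightarrow> lo j \<le> lo i"
  using lift_Suc_antimono_le[of lo] lo_Suc by blast

lemma hi_mono: "i \<le> j \<Longrightarrow> hi i \<le> hi j"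
  using lift_Suc_mono_le[of hi] hi_Suc by blast

lemma hr_mono: "i \<le> j \<Longrightarrow> hr i \<le> hr j"
  using lift_Suc_mono_le[of hr] hr_Suc by blast

lemma strip_Smain: "strip (hr i, gen i, E, mid i) = E \<times> {lo i<..<hi i}"
  by (simp add: strip.simps lo_def hi_def)

text \<open>The remainder fills exactly the heights gained by a vertical step. The logarithmic
  height of the enlarged cylinder is \<open>2\<close> times its own for an upward step and
  \<open>3 / 2\<close> times for a downward one; \<open>3\<close> is the common bound that also
  serves main cylinders.\<close>

lemma Srest_strip:
  assumes "L \<in> Srest i"
  shows "\<not> horizontal i" "gen (Suc i) = gen i" "base L \<in> Q (gen i)"
    "strip L = base L \<times> (if upward i then {hi i<..<hi (Suc i)} else {lo (Suc i)<..<lo i})"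
    "ln (hr (Suc i)) \<le> 3 * log_height L"
proof -
  show nh: "\<not> horizontal i" using assms by (auto simp: Srest_eq split: if_splits)
  have r: "1 < hr i" "hr i \<noteq> 0" using P_bounds[of i] by auto
  have "gen (Suc i) = gen i \<and> base L \<in> Q (gen i) \<and>
    strip L = base L \<times> (if upward i then {hi i<..<hi (Suc i)} else {lo (Suc i)<..<lo i}) \<and> ln (hr (Suc i)) \<le> 3 * log_height L"
  proof (cases "upward i")
    case True
    then obtain E where L: "L = (hr i, gen i, E, mid i * (hr i)\<^sup>2)" "E \<in> Q (gen i)"
      using assms nh unfolding Srest_eq P_eq[of i] by auto
    have "mid i * (hr i)\<^sup>2 / hr i = hi i" "mid i * (hr i)\<^sup>2 * hr i = hi (Suc i)"
      using r step_up(5)[OF nh True] by (simp_all add: hi_def power2_eq_square)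
    then have "strip L = E \<times> {hi i<..<hi (Suc i)}" by (simp only: L strip.simps)
    moreover have "ln (hr (Suc i)) \<le> 3 * log_height L"
      using step_up(1)[OF nh True] r by (simp add: L ln_realpow)
    ultimately show ?thesis using True step_up(2)[OF nh True] L by simp
  next
    case False
    then obtain E where L: "L = ((hr i)\<^sup>2, gen i, E, mid i / hr i ^ 3)" "E \<in> Q (gen i)"
      using assms nh unfolding Srest_eq P_eq[of i] by auto
    have "mid i / hr i ^ 3 / (hr i)\<^sup>2 = lo (Suc i)" "mid i / hr i ^ 3 * (hr i)\<^sup>2 = lo i"
      using r step_down(4)[OF nh False] by (simp_all add: lo_def eval_nat_numeral field_simps)
    then have "strip L = E \<times> {lo (Suc i)<..<lo i}" by (simp only: L strip.simps)
    moreover have "ln (hr (Suc i)) \<le> 3 * log_height L"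
      using step_down(1)[OF nh False] r by (simp add: L ln_realpow)
    ultimately show ?thesis using False step_down(2)[OF nh False] L by simp
  qed
  then show "gen (Suc i) = gen i" "base L \<in> Q (gen i)"
    "strip L = base L \<times> (if upward i then {hi i<..<hi (Suc i)} else {lo (Suc i)<..<lo i})"
    "ln (hr (Suc i)) \<le> 3 * log_height L" by auto
qed

lemma Srest_heights:
  assumes "L \<in> Srest i" "(n, b) \<in> strip L"
  shows "lo (Suc i) < b" "b < hi (Suc i)" "b \<le> lo i \<or> hi i \<le> b"
proof -
  have "lo (Suc i) < b \<and> b < hi (Suc i) \<and> (b \<le> lo i \<or> hi i \<le> b)"
    using assms(2) lo_Suc[of i] hi_Suc[of i] lo_less_hi[of i] unfolding Srest_strip(4)[OF assms(1)]
    by (auto split: if_splits)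
  then show "lo (Suc i) < b" "b < hi (Suc i)" "b \<le> lo i \<or> hi i \<le> b" by auto
qed

lemma Smain_heights:
  assumes "L \<in> Smain i" "(n, b) \<in> strip L"
  shows "lo i < b" "b < hi i"
  using assms by (auto simp: Smain_iff strip_Smain)

text \<open>Heights alone separate the two: main cylinders of index \<open>i\<close> lie between
  \<open>lo i\<close> and \<open>hi i\<close>, while remainders of index \<open>l \<ge> i\<close>
  lie outside the larger interval from \<open>lo l\<close> to \<open>hi l\<close>.\<close>

lemma Smain_Srest_disjoint:
  assumes "L \<in> Smain i" "L' \<in> Srest l" "i \<le> l"
  shows "strip L \<inter> strip L' = {}"
proof -
  have "False" if "(n, b) \<in> strip L" "(n, b) \<in> strip L'" for n b
    using Smain_heights[OF assms(1) that(1)] Srest_heights(3)[OF assms(2) that(2)]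
      lo_antimono[OF assms(3)] hi_mono[OF assms(3)] by linarith
  then show ?thesis by fast
qed

lemma Srest_Srest_disjoint:
  assumes "L \<in> Srest i" "L' \<in> Srest l" "i < l"
  shows "strip L \<inter> strip L' = {}"
proof -
  have "Suc i \<le> l" using assms(3) by simp
  have "False" if "(n, b) \<in> strip L" "(n, b) \<in> strip L'" for n b
    using Srest_heights(1,2)[OF assms(1) that(1)] Srest_heights(3)[OF assms(2) that(2)]
      lo_antimono[OF \<open>Suc i \<le> l\<close>] hi_mono[OF \<open>Suc i \<le> l\<close>] by linarith
  then show ?thesis by fast
qed

lemma Srest_disjoint:
  assumes "L \<in> Srest i" "L' \<in> Srest i" "L \<noteq> L'"
  shows "strip L \<inter> strip L' = {}"
  using assms same_type_disjoint unfolding Srest_eq by (metis empty_iff)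

lemma Smain_disjoint:
  assumes "L \<in> Smain i" "L' \<in> Smain i" "L \<noteq> L'"
  shows "strip L \<inter> strip L' = {}"
  using assms same_type_disjoint unfolding S_main_def by metis

end

section \<open>Exhaustion by the main sequence; nesting and disjointness of the levels\<close>

context cylinder_system
begin

text \<open>Horizontal steps multiply \<open>\<delta> powi gen i\<close> by
  \<open>1 / \<delta>\<close> and leave \<open>mid i\<close> and \<open>hr i\<close> fixed, so the
  upper inequality eventually fails.\<close>

lemma vertical_later: "\<exists>j\<ge>i. \<not> horizontal j"
proof (rule ccontr)
  assume "\<not> ?thesis"
  then have h: "\<And>j. i \<le> j \<Longrightarrow> horizontal j" by blast
  have const: "gen (i + n) = gen i - int n \<and> hr (i + n) = hr i \<and> mid (i + n) = mid i" for n
    by (induction n) (use step_horizontal[OF h] in auto)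
  define B where "B = \<Lambda> * mid i * hr i powr \<gamma> / \<delta> powi gen i"
  have "(1 / \<delta>) ^ n \<le> B" for n
  proof -
    have "\<delta> powi (gen i - int n) \<le> \<Lambda> * mid i * hr i powr \<gamma>"
      using large_P[of "i + n"] const[of n] unfolding P_eq[of "i + n"] by auto
    moreover have "\<delta> powi (gen i - int n) = \<delta> powi gen i * (1 / \<delta>) ^ n"
      using \<delta> by (simp add: power_int_diff power_divide)
    ultimately show ?thesis by (simp add: B_def field_simps)
  qed
  moreover have "1 < 1 / \<delta>" using \<delta> by simp
  then obtain n where "B < (1 / \<delta>) ^ n" using real_arch_pow by blast
  ultimately show False by (meson not_le)
qed

lemma next_vertical: "\<exists>j\<ge>i. \<not> horizontal j \<and> upward j = upward i"
proof -
  define j where "j = (LEAST j. i \<le> j \<and> \<not> horizontal j)"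
  have j: "i \<le> j" "\<not> horizontal j"
    using LeastI_ex[OF vertical_later[of i]] by (auto simp: j_def)
  have h: "horizontal m" if "i \<le> m" "m < j" for m
    using not_less_Least[of m "\<lambda>j. i \<le> j \<and> \<not> horizontal j"] that by (auto simp: j_def)
  have "upward m = upward i" if "m \<le> j" "i \<le> m" for m
    using that(2,1) by (induction m rule: dec_induct) (auto simp: P_Suc h)
  then show ?thesis using j by blast
qed

text \<open>The direction is constant up to the next vertical step and flips there, so both
  directions recur indefinitely.\<close>

lemma next_vertical_direction: "\<exists>j\<ge>i. \<not> horizontal j \<and> upward j = v"
proof -
  obtain j where j: "i \<le> j" "\<not> horizontal j" "upward j = upward i" using next_vertical by blast
  show ?thesis
  proof (cases "upward i = v")
    case False
    obtain j' where "Suc j \<le> j'" "\<not> horizontal j'" "upward j' = upward (Suc j)" using next_vertical by blast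
    moreover have "upward (Suc j) = v" using j False by (auto simp: P_Suc)
    ultimately show ?thesis using j(1) by (intro exI[of _ j']) auto
  qed (use j in blast)
qed

lemma hr_power_ge_2: "2 \<le> hr i ^ n" if "n \<noteq> 0"
proof -
  have "2 \<le> hr i" using P_bounds(2)[of i] exp_ge_add_one_self[of "1::real"] by linarith
  also have "\<dots> \<le> hr i ^ n" using P_bounds(3)[of i] that power_increasing[of 1 n "hr i"] by auto
  finally show ?thesis .
qed

lemma hi_unbounded: "\<exists>i. b < hi i"
proof -
  have "\<exists>i. 2 ^ n * hi 0 \<le> hi i" for n
  proof (induction n)
    case (Suc n)
    then obtain i where i: "2 ^ n * hi 0 \<le> hi i" by blast
    obtain j where j: "i \<le> j" "\<not> horizontal j" "upward j" using next_vertical_direction[of i True] by auto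
    have "2 * hi j \<le> (hr j)\<^sup>2 * hi j" using hr_power_ge_2[of 2 j] lo_less_hi[of j] by (intro mult_right_mono) auto
    then have "2 * hi j \<le> hi (Suc j)" using step_up[OF j(2,3)] by (simp add: mult.commute)
    then have "2 ^ Suc n * hi 0 \<le> hi (Suc j)" using i hi_mono[OF j(1)] by simp
    then show ?case by blast
  qed auto
  moreover obtain n where "b / hi 0 < 2 ^ n" using real_arch_pow[of 2] by auto
  moreover have "0 < hi 0" using lo_less_hi[of 0] by linarith
  ultimately show ?thesis by (metis less_le_trans pos_divide_less_eq)
qed

lemma lo_unbounded: "0 < b \<Longrightarrow> \<exists>i. lo i < b"
proof -
  assume b: "0 < b"
  have "\<exists>i. 2 ^ n * lo i \<le> lo 0" for n
  proof (induction n)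
    case (Suc n)
    then obtain i where i: "2 ^ n * lo i \<le> lo 0" by blast
    obtain j where j: "i \<le> j" "\<not> horizontal j" "\<not> upward j" using next_vertical_direction[of i False] by auto
    have "2 * lo (Suc j) \<le> hr j ^ 4 * lo (Suc j)"
      using hr_power_ge_2[of 4 j] lo_less_hi[of "Suc j"] by (intro mult_right_mono) auto
    also have "\<dots> = lo j" using step_down[OF j(2,3)] P_bounds[of j] by simp
    also have "\<dots> \<le> lo i" using lo_antimono[OF j(1)] .
    finally have "2 ^ n * (2 * lo (Suc j)) \<le> 2 ^ n * lo i" by simp
    also note i
    finally have "2 ^ Suc n * lo (Suc j) \<le> lo 0" by (simp add: mult_ac)
    then show ?case by blast
  qed auto
  moreover obtain n where "lo 0 / b < 2 ^ n" using real_arch_pow[of 2] by auto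
  ultimately obtain i where "2 ^ n * lo i \<le> lo 0" "lo 0 < 2 ^ n * b"
    using b by (metis pos_divide_less_eq)
  then have "2 ^ n * lo i < 2 ^ n * b" by linarith
  then show ?thesis by auto
qed

lemma exhaust_heights:
  assumes "0 < b"
  shows "\<exists>i. lo i < b \<and> b < hi i"
proof -
  obtain i j where "lo i < b" "b < hi j" using hi_unbounded lo_unbounded assms by blast
  then have "lo (max i j) < b" "b < hi (max i j)"
    using lo_antimono[of i "max i j"] hi_mono[of j "max i j"] by auto
  then show ?thesis by blast
qed

text \<open>\<open>(hr i)\<^sup>2\<close> is the ratio of \<open>hi i\<close> to
  \<open>lo i\<close>; \<open>hi\<close> is unbounded while \<open>lo\<close> does not
  increase.\<close>

lemma ln_hr_unbounded: "\<exists>i. B < ln (hr i)"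
proof -
  obtain i where i: "exp (2 * B) * lo 0 < hi i" using hi_unbounded by blast
  have "exp (2 * B) * lo i \<le> exp (2 * B) * lo 0" using lo_antimono[of 0 i] by simp
  with i have "exp (2 * B) * lo i < hi i" by linarith
  then have "exp (2 * B) < hi i / lo i" using lo_less_hi(1)[of i] by (simp add: pos_less_divide_eq)
  also have "hi i / lo i = (hr i)\<^sup>2" using P_bounds[of i] by (simp add: lo_def hi_def power2_eq_square)
  finally have "ln (exp (2 * B)) < ln ((hr i)\<^sup>2)" using P_bounds[of i] by (subst ln_less_cancel_iff) auto
  then show ?thesis using P_bounds[of i] by (auto simp: ln_realpow)
qed

abbreviation DL where "DL \<equiv> D_level Q \<delta> \<gamma> \<Lambda> P0"
abbreviation descendants where "descendants \<equiv> sons_iter Q \<delta> \<gamma> \<Lambda>"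

text \<open>The case \<open>l = i\<close> with zero iterations absorbs the separate term
  \<open>S_rest\<close> of the definition, so a level has just two kinds of members.\<close>

lemma DL_neg_iff:
  "L \<in> DL (- int i) \<longleftrightarrow> L \<in> Smain i \<or> (\<exists>l\<ge>i. \<exists>R\<in>Srest l. L \<in> descendants (l - i) R)"
proof -
  have "L \<in> DL (- int i) \<longleftrightarrow> L \<in> Smain i \<or> L \<in> Srest i \<or> (\<exists>l>i. \<exists>R\<in>Srest l. L \<in> descendants (l - i) R)"
    by (simp add: D_level_def D_nonpos_def) blast
  moreover have "L \<in> Srest i \<longleftrightarrow> (\<exists>R\<in>Srest i. L \<in> descendants (i - i) R)" by simp
  ultimately show ?thesis by (metis le_eq_less_or_eq)
qed

lemma Smain_DL: "L \<in> Smain i \<Longrightarrow> L \<in> DL (- int i)"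
  and descendants_DL: "R \<in> Srest l \<Longrightarrow> i \<le> l \<Longrightarrow> L \<in> descendants (l - i) R \<Longrightarrow> L \<in> DL (- int i)"
  by (auto simp only: DL_neg_iff)

lemma DL_nonneg: "0 \<le> j \<Longrightarrow> DL j = D_nonneg Q \<delta> \<gamma> \<Lambda> P0 (nat j)"
  by (cases "j = 0") (auto simp: D_level_def)

lemma DL_Suc: "0 \<le> j \<Longrightarrow> DL (j + 1) = (\<Union>R\<in>DL j. son R)"
  by (simp add: DL_nonneg nat_add_distrib)

lemma level_cases:
  obtains (neg) i where "j = - int i" | (pos) m where "j = int (Suc m)"
proof (cases "j \<le> 0")
  case True
  then show ?thesis using neg[of "nat (- j)"] by simp
next
  case False
  then show ?thesis using pos[of "nat (j - 1)"] by simp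
qed

lemma adm_DL: "L \<in> DL j \<Longrightarrow> adm L"
proof (cases j rule: level_cases)
  case (neg i)
  then show "L \<in> DL j \<Longrightarrow> adm L"
    using adm_Smain adm_Srest sons_iter_adm unfolding neg DL_neg_iff by blast
next
  case (pos m)
  have "L \<in> DL (int m) \<Longrightarrow> adm L" for L m
  proof (induction m arbitrary: L)
    case 0
    then show ?case
      using adm_Smain adm_Srest sons_iter_adm DL_neg_iff[of L 0] unfolding of_nat_0 minus_zero by blast
  next
    case (Suc m)
    then obtain R where "R \<in> DL (int m)" "L \<in> son R" using DL_Suc[of "int m"] by (auto simp: add.commute)
    then show ?case using Suc.IH adm_son by blast
  qed
  then show "L \<in> DL j \<Longrightarrow> adm L" using pos by blast
qed

lemma strip_nonempty: "adm L \<Longrightarrow> strip L \<noteq> {}"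
proof -
  assume adm: "adm L"
  obtain r k E a where L: "L = (r, k, E, a)" by (cases L)
  have "E \<noteq> {}" "a / r < a * r" using admD nonempty_Q adm adm_order L by (blast, meson less_trans)
  then show ?thesis by (auto simp: L strip.simps)
qed

lemma DL_disjoint_neg:
  assumes "L \<in> DL (- int i)" "L' \<in> DL (- int i)" "L \<noteq> L'"
  shows "strip L \<inter> strip L' = {}"
proof -
  have main_rest: "strip L \<inter> strip L' = {}"
    if "L \<in> Smain i" "l \<ge> i" "R \<in> Srest l" "L' \<in> descendants (l - i) R" for L L' l R
    using Smain_Srest_disjoint[OF that(1,3,2)] sons_iter_subset[OF adm_Srest[OF that(3)] that(4)] by blast
  have rest_rest: "strip L \<inter> strip L' = {}"
    if "R \<in> Srest l" "L \<in> descendants (l - i) R" "R' \<in> Srest l'" "L' \<in> descendants (l' - i) R'" "L \<noteq> L'" for L L' l l' R R'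
  proof (cases "R = R' \<and> l = l'")
    case True
    then show ?thesis using sons_iter_disjoint[OF adm_Srest[OF that(1)] that(2)] that(4,5) by blast
  next
    case False
    have "strip R \<inter> strip R' = {}"
    proof (cases "l = l'")
      case True
      then show ?thesis using Srest_disjoint[of R l R'] that(1,3) False by blast
    next
      case ne: False
      then consider "l < l'" | "l' < l" by linarith
      then show ?thesis
        using Srest_Srest_disjoint[OF that(1,3)] Srest_Srest_disjoint[OF that(3,1)] by cases blast+
    qed
    then show ?thesis
      using sons_iter_subset[OF adm_Srest[OF that(1)] that(2)] sons_iter_subset[OF adm_Srest[OF that(3)] that(4)] by blast
  qed
  from assms(1,2) show ?thesis
    unfolding DL_neg_iff
    using Smain_disjoint[of L i L'] main_rest[of L _ _ L'] main_rest[of L' _ _ L] rest_rest[of _ _ L _ _ L'] assms(3)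
    by (metis Int_commute)
qed

lemma DL_disjoint:
  assumes "L \<in> DL j" "L' \<in> DL j" "L \<noteq> L'"
  shows "strip L \<inter> strip L' = {}"
proof -
  have "strip L \<inter> strip L' = {}" if "L \<in> DL (int m)" "L' \<in> DL (int m)" "L \<noteq> L'" for m L L'
    using that
  proof (induction m arbitrary: L L')
    case 0
    then show ?case using DL_disjoint_neg[of L 0 L'] by simp
  next
    case (Suc m)
    then obtain R R' where R: "R \<in> DL (int m)" "L \<in> son R" "R' \<in> DL (int m)" "L' \<in> son R'"
      using DL_Suc[of "int m"] by (auto simp: add.commute)
    show ?case
    proof (cases "R = R'")
      case True
      then show ?thesis using strip_sons_disjoint[OF adm_DL[OF R(1)]] R Suc(4) by blast
    next
      case False
      then have "strip R \<inter> strip R' = {}" using Suc.IH R by blast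
      then show ?thesis
        using strip_son_subset[OF adm_DL[OF R(1)] R(2)] strip_son_subset[OF adm_DL[OF R(3)] R(4)] by blast
    qed
  qed
  then show ?thesis
    using assms DL_disjoint_neg by (cases j rule: level_cases) blast+
qed

lemma countable_DL: "countable (DL j)"
proof -
  have S: "countable (Smain i)" "countable (Srest i)" for i
    by (auto simp: S_main_def Srest_eq countable_same_type)
  have neg: "countable (DL (- int i))" for i
  proof -
    have "DL (- int i) \<subseteq> Smain i \<union> (\<Union>l. \<Union>R\<in>Srest l. descendants (l - i) R)"
      using DL_neg_iff by auto
    moreover have "countable (Smain i \<union> (\<Union>l. \<Union>R\<in>Srest l. descendants (l - i) R))"
      by (intro countable_Un countable_UN S countable_sons_iter adm_Srest) auto
    ultimately show ?thesis by (rule countable_subset)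
  qed
  have nonneg: "countable (DL (int m))" for m
  proof (induction m)
    case 0
    then show ?case using neg[of 0] by simp
  next
    case (Suc m)
    have "DL (int (Suc m)) = (\<Union>R\<in>DL (int m). son R)" using DL_Suc[of "int m"] by (simp add: add.commute)
    then show ?case using countable_UN[OF Suc, of son] countable_sons[OF adm_DL] by metis
  qed
  show ?thesis
  proof (cases "0 \<le> j")
    case True
    then show ?thesis using nonneg[of "nat j"] by simp
  next
    case False
    then show ?thesis using neg[of "nat (- j)"] by simp
  qed
qed

text \<open>The data from which measures are compared: equal bases and logarithmic heights within a
  factor \<open>3\<close>, or equal heights and the parent cube. The \<open>3\<close> comes from
  \<open>p_down\<close>, which replaces \<open>r\<close> by \<open>r ^ 3\<close>.\<close>

definition child :: "'x cyl \<Rightarrow> 'x cyl \<Rightarrow> bool" where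
  "child L R \<longleftrightarrow> strip L \<subseteq> strip R \<and>
     (base L = base R \<and> log_height R \<le> 3 * log_height L \<or>
      log_height R = log_height L \<and> (\<exists>k. base L \<in> Q k \<and> base R = cube_parent Q k (base L)))"

lemma child_son:
  assumes "adm R" "L \<in> son R"
  shows "child L R"
  using assms
proof (cases rule: sons_cases)
  case (vertical r k E a)
  then have "1 < r" using admD assms(1) by blast
  then have "ln r \<le> 3 * ln (sqrt r)" by (simp add: ln_sqrt)
  then show ?thesis using vertical strip_son_subset[OF assms] by (auto simp: child_def)
next
  case (horizontal r k E a E')
  then show ?thesis using strip_son_subset[OF assms] cube_sonsD[of E' k E] by (auto simp: child_def)
qed

lemma child_Smain:
  assumes "L \<in> Smain i"
  shows "\<exists>R\<in>Smain (Suc i). child L R"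
proof -
  obtain E where E: "E \<in> Q (gen i)" "L = (hr i, gen i, E, mid i)" using assms by (auto simp: Smain_iff)
  define E' where "E' = (if horizontal i then cube_parent Q (gen i) E else E)"
  define R where "R = (hr (Suc i), gen (Suc i), E', mid (Suc i))"
  have g: "gen (Suc i) = (if horizontal i then gen i - 1 else gen i)"
    using step_horizontal(2)[of i] step_up(2)[of i] step_down(2)[of i] by auto
  have "E' \<in> Q (gen (Suc i)) \<and> E \<subseteq> E'" using cube_parent[OF E(1)] E(1) by (auto simp: E'_def g)
  then have "R \<in> Smain (Suc i)" "strip L \<subseteq> strip R"
    using lo_Suc[of i] hi_Suc[of i] by (auto simp: Smain_iff R_def E(2) strip_Smain)
  moreover have "base L = base R \<and> log_height R \<le> 3 * log_height L \<or>
      log_height R = log_height L \<and> (\<exists>k. base L \<in> Q k \<and> base R = cube_parent Q k (base L))"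
  proof (cases "horizontal i")
    case True
    then show ?thesis using E step_horizontal(1)[OF True] by (auto simp: R_def E'_def)
  next
    case False
    have r: "1 < hr i" by (rule P_bounds)
    then have "ln (hr (Suc i)) \<le> 3 * ln (hr i)"
      using step_up(1)[OF False] step_down(1)[OF False] by (cases "upward i") (auto simp: ln_realpow)
    then show ?thesis using False E by (auto simp: R_def E'_def)
  qed
  ultimately show ?thesis by (auto simp: child_def)
qed

lemma child_Srest:
  assumes "L \<in> Srest i"
  shows "\<exists>R\<in>Smain (Suc i). child L R"
proof -
  note S = Srest_strip[OF assms]
  define R where "R = (hr (Suc i), gen (Suc i), base L, mid (Suc i))"
  have "R \<in> Smain (Suc i)" using S by (auto simp: Smain_iff R_def)
  moreover have "strip L \<subseteq> strip R"
    unfolding R_def strip_Smain S(4) using lo_Suc[of i] hi_Suc[of i] lo_less_hi[of i] by auto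
  ultimately show ?thesis using S(5) by (auto simp: child_def R_def)
qed

text \<open>On nonpositive levels a parent is not always found by inverting \<open>sons\<close>:
  main cylinders, and remainders when they first appear, sit inside main cylinders of the next
  index.\<close>

lemma child_DL:
  assumes "L \<in> DL (j + 1)"
  shows "\<exists>R\<in>DL j. child L R"
proof (cases "0 \<le> j")
  case True
  then obtain R where R: "R \<in> DL j" "L \<in> son R" using assms DL_Suc by blast
  then show ?thesis using child_son[OF adm_DL[OF R(1)] R(2)] by blast
next
  case False
  define i where "i = nat (- j - 1)"
  have j: "j + 1 = - int i" "j = - int (Suc i)" using False by (auto simp: i_def)
  have "L \<in> Smain i \<or> (\<exists>l\<ge>i. \<exists>R\<in>Srest l. L \<in> descendants (l - i) R)"
    using assms unfolding j(1) DL_neg_iff .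
  then show ?thesis
  proof
    assume "L \<in> Smain i"
    from child_Smain[OF this] obtain R where "R \<in> Smain (Suc i)" "child L R" by (elim bexE)
    then show ?thesis using Smain_DL[of R "Suc i"] unfolding j(2) by (intro bexI)
  next
    assume "\<exists>l\<ge>i. \<exists>R\<in>Srest l. L \<in> descendants (l - i) R"
    then obtain l R where l: "i \<le> l" "R \<in> Srest l" "L \<in> descendants (l - i) R" by blast
    show ?thesis
    proof (cases "l = i")
      case True
      then have "L \<in> Srest i" using l by simp
      from child_Srest[OF this] obtain R' where "R' \<in> Smain (Suc i)" "child L R'" by (elim bexE)
      then show ?thesis using Smain_DL[of R' "Suc i"] unfolding j(2) by (intro bexI)
    next
      case False
      then have "l - i = Suc (l - Suc i)" "Suc i \<le> l" using l(1) by auto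
      then obtain R' where R': "R' \<in> descendants (l - Suc i) R" "L \<in> son R'" using l(3) by auto
      then have mem: "R' \<in> DL j" unfolding j(2) using descendants_DL[OF l(2) \<open>Suc i \<le> l\<close>] by blast
      have "child L R'" using child_son[OF adm_DL[OF mem] R'(2)] .
      then show ?thesis using mem by (intro bexI)
    qed
  qed
qed

lemma ancestor_DL: "i \<le> j \<Longrightarrow> L \<in> DL j \<Longrightarrow> \<exists>R\<in>DL i. strip L \<subseteq> strip R"
proof (induction j arbitrary: L rule: int_ge_induct)
  case base
  then show ?case by blast
next
  case (step j)
  then obtain R where "R \<in> DL j" "strip L \<subseteq> strip R" using child_DL unfolding child_def by blast
  then show ?case using step.IH[of R] by blast
qed

lemma ancestor_Smain:
  assumes "L \<in> DL j"
  shows "\<exists>m. - int m \<le> j \<and> (\<exists>R\<in>Smain m. strip L \<subseteq> strip R)"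
proof -
  define i where "i = nat (- j)"
  have ij: "- int i \<le> j" by (simp add: i_def)
  obtain L1 where L1: "L1 \<in> DL (- int i)" "strip L \<subseteq> strip L1" using ancestor_DL[OF ij assms] by blast
  show ?thesis
  proof (cases "L1 \<in> Smain i")
    case True
    then show ?thesis using L1 ij by blast
  next
    case False
    then obtain l R where l: "i \<le> l" "R \<in> Srest l" "L1 \<in> descendants (l - i) R"
      using L1(1) unfolding DL_neg_iff by blast
    have "strip L1 \<subseteq> strip R" using sons_iter_subset[OF adm_Srest] l by blast
    moreover obtain R' where "R' \<in> Smain (Suc l)" "strip R \<subseteq> strip R'"
      using child_Srest[OF l(2)] unfolding child_def by blast
    ultimately have "\<exists>R\<in>Smain (Suc l). strip L \<subseteq> strip R" using L1(2) by blast
    moreover have "- int (Suc l) \<le> j" using l(1) ij by linarith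
    ultimately show ?thesis by blast
  qed
qed

text \<open>From some index on, a main cylinder of each index contains \<open>L\<close>.
  Disjointness of the levels makes it the only containing member, so the far ancestors have the
  unbounded logarithmic heights \<open>ln (hr n)\<close>.\<close>

lemma ancestors_tall:
  assumes "L \<in> DL j"
  shows "\<exists>i0\<le>j. \<forall>i\<le>i0. \<forall>R\<in>DL i. strip L \<subseteq> strip R \<longrightarrow> B < log_height R"
proof -
  obtain m R0 where m: "- int m \<le> j" "R0 \<in> Smain m" "strip L \<subseteq> strip R0"
    using ancestor_Smain[OF assms] by blast
  have anc: "\<exists>R\<in>Smain i. strip L \<subseteq> strip R" if "m \<le> i" for i
    using that
  proof (induction i rule: dec_induct)
    case base
    then show ?case using m by blast
  next
    case (step i)
    then obtain R where "R \<in> Smain i" "strip L \<subseteq> strip R" by blast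
    then show ?case using child_Smain[of R i] unfolding child_def by blast
  qed
  obtain i1 where i1: "B < ln (hr i1)" using ln_hr_unbounded by blast
  define M where "M = max m i1"
  show ?thesis
  proof (intro exI[of _ "- int M"] conjI allI impI ballI)
    show "- int M \<le> j" using m(1) by (simp add: M_def)
    fix i R assume i: "i \<le> - int M" and R: "R \<in> DL i" "strip L \<subseteq> strip R"
    define n where "n = nat (- i)"
    have n: "i = - int n" "M \<le> n" using i by (auto simp: n_def)
    obtain R' where R': "R' \<in> Smain n" "strip L \<subseteq> strip R'" using anc[of n] n(2) by (auto simp: M_def)
    have "R' \<in> DL i" using R'(1) by (simp add: n(1) DL_neg_iff)
    then have "R = R'"
      using DL_disjoint[OF R(1)] R(2) R'(2) strip_nonempty[OF adm_DL[OF assms]] by blast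
    then have "log_height R = ln (hr n)" using R'(1) by (auto simp: Smain_iff)
    moreover have "ln (hr i1) \<le> ln (hr n)"
      using hr_mono[of i1 n] n(2) P_bounds[of i1] P_bounds[of n] by (simp add: M_def)
    ultimately show "B < log_height R" using i1 by simp
  qed
qed

text \<open>Cylinders are open in the height variable and miss their dividing heights. There are
  countably many of these, hence they are negligible, and off them sons cover their parents over
  points that lie in cubes of every generation.\<close>

definition critical_heights :: "real set"
  where "critical_heights = (\<Union>j. \<Union>L\<in>DL j. levels L)"

lemma countable_critical_heights: "countable critical_heights"
proof -
  have "countable (levels L)" for L :: "'x cyl" by (cases L) auto
  then show ?thesis unfolding critical_heights_def by (intro countable_UN countable_DL) auto
qed

section \<open>Covering and fine cylinders at generic points\<close>

context
  fixes n b
  assumes generic_n: "\<And>k. n \<in> \<Union>(Q k)" and b_pos: "0 < b" and generic_b: "b \<notin> critical_heights"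
begin

lemma not_level: "L \<in> DL j \<Longrightarrow> b \<notin> levels L"
  using generic_b by (auto simp: critical_heights_def)

text \<open>At the least \<open>i\<close> with \<open>b\<close> between \<open>lo i\<close> and
  \<open>hi i\<close>, either \<open>i = 0\<close> and a main cylinder contains the point, or the
  preceding step \<open>l\<close> was vertical and \<open>b\<close> lies in its remainder, whose
  \<open>l\<close>-fold descendants belong to level \<open>0\<close>.\<close>

lemma cover_DL_0: "\<exists>L\<in>DL 0. (n, b) \<in> strip L"
proof -
  define i where "i = (LEAST i. lo i < b \<and> b < hi i)"
  have i: "lo i < b" "b < hi i"
    using LeastI_ex[OF exhaust_heights[OF b_pos]] by (auto simp: i_def)
  show ?thesis
  proof (cases i)
    case 0
    obtain E where "E \<in> Q (gen 0)" "n \<in> E" using generic_n by blast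
    then have "(hr 0, gen 0, E, mid 0) \<in> Smain 0" "(n, b) \<in> strip (hr 0, gen 0, E, mid 0)"
      using i 0 by (auto simp: Smain_iff strip_Smain)
    then show ?thesis using DL_neg_iff[of _ 0] by auto
  next
    case (Suc l)
    have out: "\<not> (lo l < b \<and> b < hi l)"
      using not_less_Least[of l "\<lambda>i. lo i < b \<and> b < hi i"] Suc by (auto simp: i_def)
    have nh: "\<not> horizontal l"
    proof
      assume "horizontal l"
      from step_horizontal(4,5)[OF this] out i Suc show False by simp
    qed
    obtain E where E: "E \<in> Q (gen l)" "n \<in> E" using generic_n by blast
    have "(hr l, gen l, E, mid l) \<in> DL (- int l)" using E(1) by (auto simp: DL_neg_iff Smain_iff)
    from not_level[OF this] have ne: "b \<noteq> lo l" "b \<noteq> hi l" by (auto simp: lo_def hi_def)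
    obtain L where L: "L \<in> Srest l" "(n, b) \<in> strip L"
    proof (cases "upward l")
      case True
      let ?L = "(hr l, gen l, E, mid l * (hr l)\<^sup>2)"
      have "?L \<in> Srest l" using True nh E(1) unfolding Srest_eq P_eq[of l] by auto
      moreover have "(n, b) \<in> strip ?L"
        using Srest_strip(4)[OF calculation] E(2) True out i ne step_up(4,5)[OF nh True] Suc by auto
      ultimately show ?thesis using that by blast
    next
      case False
      let ?L = "((hr l)\<^sup>2, gen l, E, mid l / hr l ^ 3)"
      have "?L \<in> Srest l" using False nh E(1) unfolding Srest_eq P_eq[of l] by auto
      moreover have "(n, b) \<in> strip ?L"
        using Srest_strip(4)[OF calculation] E(2) False out i ne step_down(4,5)[OF nh False] Suc by auto
      ultimately show ?thesis using that by blast
    qed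
    have "\<exists>L'\<in>descendants m L. (n, b) \<in> strip L'" if "m \<le> l" for m
      using that
    proof (induction m)
      case 0
      then show ?case using L(2) by simp
    next
      case (Suc m)
      then obtain L' where L': "L' \<in> descendants m L" "(n, b) \<in> strip L'" by auto
      have "L' \<in> DL (- int (l - m))"
        unfolding DL_neg_iff using L(1) L'(1) Suc(2) by (intro disjI2 exI[of _ l] conjI bexI[of _ L]) auto
      then have "b \<notin> levels L'" "adm L'" using not_level adm_DL by auto
      then obtain L'' where "L'' \<in> son L'" "(n, b) \<in> strip L''"
        using sons_cover[of L' n b] L'(2) generic_n by blast
      then show ?case using L'(1) by auto
    qed
    from this[of l] show ?thesis
      using L(1) DL_neg_iff[of _ 0] by fastforce
  qed
qed

text \<open>Each descent either raises \<open>k\<close> or halves \<open>ln r\<close>. Among many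
  descents one kind is frequent, and admissibility at heights comparable with \<open>b\<close> ties
  \<open>\<delta> powi k\<close> to \<open>ln r\<close>, so both become small.\<close>

lemma fine_DL:
  assumes "0 < \<epsilon>"
  shows "\<exists>j. \<exists>(r, k, E, a)\<in>DL j. (n, b) \<in> strip (r, k, E, a) \<and> \<delta> powi k < \<epsilon> \<and> ln r < \<epsilon>"
proof -
  obtain r1 k1 E1 a1 where L1: "(r1, k1, E1, a1) \<in> DL 0" "(n, b) \<in> strip (r1, k1, E1, a1)"
    using cover_DL_0 by auto
  have r1: "1 < r1" using admD[OF adm_DL[OF L1(1)]] by simp
  have chain: "\<exists>(r, k, E, a)\<in>DL (int m). (n, b) \<in> strip (r, k, E, a) \<and>
      (\<exists>v\<le>m. ln r = ln r1 / 2 ^ v \<and> k = k1 + int (m - v))" for m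
  proof (induction m)
    case 0
    then show ?case using L1 by (intro bexI[of _ "(r1, k1, E1, a1)"]) auto
  next
    case (Suc m)
    then obtain r k E a v where L: "(r, k, E, a) \<in> DL (int m)" "(n, b) \<in> strip (r, k, E, a)" "v \<le> m"
      "ln r = ln r1 / 2 ^ v" "k = k1 + int (m - v)" by auto
    have adm: "adm (r, k, E, a)" using adm_DL[OF L(1)] .
    obtain L' where L': "L' \<in> son (r, k, E, a)" "(n, b) \<in> strip L'"
      using sons_cover[OF adm L(2) not_level[OF L(1)] generic_n] by blast
    have D: "L' \<in> DL (int (Suc m))" using DL_Suc[of "int m"] L(1) L'(1) by (auto simp: add.commute)
    show ?case
      using adm L'(1)
    proof (cases rule: sons_cases)
      case (vertical r' k' E' a')
      then obtain a'' where "L' = (sqrt r, k, E, a'')" by auto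
      moreover have "ln (sqrt r) = ln r1 / 2 ^ Suc v" using admD[OF adm] L(4) by (simp add: ln_sqrt)
      ultimately show ?thesis using D L'(2) L(3,5) by (intro bexI[OF _ D]) (auto intro!: exI[of _ "Suc v"])
    next
      case (horizontal r' k' E' a' E'')
      then have "L' = (r, k + 1, E'', a)" by auto
      then show ?thesis using D L'(2) L(3-5) by (intro bexI[OF _ D]) (auto intro!: exI[of _ v])
    qed
  qed
  \<comment> \<open>The three bounds serve in turn to make the cube small, to exclude the large
    type, and to turn the lower inequality of the small type into
    \<open>ln r < \<epsilon>\<close>.\<close>
  define c where "c = min \<epsilon> (min (b / r1) (\<epsilon> * b * (exp 1)\<^sup>2 / r1))"
  have c: "0 < c" "c \<le> \<epsilon>" "c \<le> b / r1" "c \<le> \<epsilon> * b * (exp 1)\<^sup>2 / r1"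
    using assms b_pos r1 by (auto simp: c_def)
  obtain p where p: "\<delta> ^ p < c" using real_arch_pow_inv[OF c(1) \<delta>(2)] by blast
  define w where "w = \<delta> ^ p"
  have w: "0 < w" using \<delta> by (simp add: w_def)
  obtain q where q: "ln r1 * max 1 (\<Lambda> * (b * r1) * (exp 1)\<^sup>2 / w) < 2 ^ q" using real_arch_pow[of 2] by auto
  \<comment> \<open>Fewer than \<open>int p - k1\<close> horizontal steps would leave at least
    \<open>q\<close> vertical ones; then \<open>ln r\<close> is so small that the upper inequality
    already forces \<open>\<delta> powi k\<close> below \<open>w\<close>, a contradiction.\<close>
  define m where "m = nat (int p - k1) + q"
  obtain r k E a v where L: "(r, k, E, a) \<in> DL (int m)" "(n, b) \<in> strip (r, k, E, a)" "v \<le> m"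
      "ln r = ln r1 / 2 ^ v" "k = k1 + int (m - v)" using chain[of m] by auto
  have adm: "adm (r, k, E, a)" using adm_DL[OF L(1)] .
  have E: "0 < a" "1 < r" using admD[OF adm] by auto
  have r_le: "r \<le> r1"
  proof -
    have "ln r \<le> ln r1" using L(4) r1 by (simp add: divide_le_eq ln_ge_zero mult_le_cancel_left1)
    then show ?thesis using E r1 by simp
  qed
  have b: "a / r < b" "b < a * r" using L(2) by (auto simp: strip.simps)
  have a_gt: "b / r1 < a"
  proof -
    have "b < a * r1" using b(2) r_le E mult_left_mono[OF r_le, of a] by linarith
    then show ?thesis using r1 by (simp add: pos_divide_less_eq)
  qed
  have a_lt: "a < b * r1"
  proof -
    have "a < b * r" using b(1) E by (simp add: pos_divide_less_eq)
    also have "\<dots> \<le> b * r1" using r_le b_pos by simp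
    finally show ?thesis .
  qed
  have "int p \<le> k"
  proof (rule ccontr)
    assume "\<not> ?thesis"
    then have kp: "k < int p" by simp
    then have "m - v < nat (int p - k1)" using L(5) by linarith
    then have "m - v < m - q" by (simp add: m_def)
    then have "q \<le> v" by linarith
    then have "2 ^ q \<le> (2::real) ^ v" by (intro power_increasing) auto
    then have big: "ln r1 * max 1 (\<Lambda> * (b * r1) * (exp 1)\<^sup>2 / w) < 2 ^ v" using q by linarith
    have ln1: "0 < ln r1" using r1 by simp
    have "ln r1 * 1 \<le> ln r1 * max 1 (\<Lambda> * (b * r1) * (exp 1)\<^sup>2 / w)" using ln1 by (intro mult_left_mono) auto
    then have "ln r \<le> 1" using big L(4) by (simp add: divide_le_eq)
    then have "r \<le> exp 1" using E by (metis exp_le_cancel_iff exp_ln less_trans zero_less_one)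
    then have "\<delta> powi k \<le> \<Lambda> * a * (exp 1)\<^sup>2 * ln r" using adm by (auto simp: admissible_def)
    also have "\<dots> \<le> \<Lambda> * (b * r1) * (exp 1)\<^sup>2 * ln r"
      using a_lt \<Lambda>_pos E by (intro mult_right_mono mult_left_mono) auto
    also have "\<dots> < w"
    proof -
      have "ln r1 * (\<Lambda> * (b * r1) * (exp 1)\<^sup>2 / w) \<le> ln r1 * max 1 (\<Lambda> * (b * r1) * (exp 1)\<^sup>2 / w)"
        using ln1 by (intro mult_left_mono) auto
      with big have "ln r1 * (\<Lambda> * (b * r1) * (exp 1)\<^sup>2) / w < 2 ^ v" by simp
      then have "ln r1 * (\<Lambda> * (b * r1) * (exp 1)\<^sup>2) < 2 ^ v * w" using w by (simp add: pos_divide_less_eq)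
      then show ?thesis by (simp add: L(4) pos_divide_less_eq mult_ac)
    qed
    finally have "\<delta> powi k < \<delta> powi int p" by (simp add: w_def)
    moreover have "\<delta> powi int p \<le> \<delta> powi k"
      using kp \<delta> by (intro power_int_decreasing) auto
    ultimately show False by simp
  qed
  then have "\<delta> powi k \<le> \<delta> powi int p" using \<delta> by (intro power_int_decreasing) auto
  then have wk: "\<delta> powi k < c" using p by simp
  have "\<not> exp 1 < r"
  proof
    assume "exp 1 < r"
    then have "a * r\<^sup>2 \<le> \<delta> powi k" using adm by (auto simp: admissible_def)
    moreover have "a * 1 \<le> a * r\<^sup>2" using E by (intro mult_left_mono) auto
    ultimately show False using a_gt c(3) wk by linarith
  qed
  then have "a * (exp 1)\<^sup>2 * ln r \<le> \<delta> powi k" using adm by (auto simp: admissible_def)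
  moreover have "b / r1 * (exp 1)\<^sup>2 * ln r \<le> a * (exp 1)\<^sup>2 * ln r"
    using a_gt E by (intro mult_right_mono) auto
  ultimately have "b / r1 * (exp 1)\<^sup>2 * ln r < \<epsilon> * b * (exp 1)\<^sup>2 / r1" using wk c(4) by linarith
  then have "(b / r1 * (exp 1)\<^sup>2) * ln r < (b / r1 * (exp 1)\<^sup>2) * \<epsilon>" by (simp add: mult_ac)
  then have "ln r < \<epsilon>" using b_pos r1 by (subst (asm) mult_less_cancel_left_pos) auto
  then show ?thesis using L wk c(2) by (intro exI[of _ "int m"] bexI[of _ "(r, k, E, a)"]) auto
qed

end

end

section \<open>Stopping cubes in a dyadic system\<close>

lemma dball_mono: "r \<le> r' \<Longrightarrow> dball d X x r \<subseteq> dball d X x r'"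
  by (auto simp: dball_def intro: less_le_trans ennreal_leI)

lemma infsum_ennreal_le:
  fixes a :: "'i \<Rightarrow> ennreal"
  assumes "\<And>F. finite F \<Longrightarrow> F \<subseteq> J \<Longrightarrow> sum a F \<le> B"
  shows "infsum a J \<le> B"
  by (rule infsum_le_finite_sums) (auto intro: assms nonneg_summable_on_complete)

text \<open>\<open>approximation\<close> combines outer regularity with the existence of fine sets
  of the family; it is stated through a measurable \<open>U\<close>, so no topology on the space is
  involved. \<open>ancestors_large\<close> is what makes maximal sets exist in collections of
  bounded measure.\<close>

locale dyadic_system =
  fixes d :: "'x \<Rightarrow> 'x \<Rightarrow> ennreal" and M :: "'x measure" and D :: "int \<Rightarrow> 'x set set" and C :: real
  assumes infinite_measure: "emeasure M (space M) = \<infinity>"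
    and countable_D: "countable (\<Union>j. D j)"
    and sets_D: "P \<in> D j \<Longrightarrow> P \<in> sets M"
    and emeasure_D_pos: "P \<in> D j \<Longrightarrow> 0 < emeasure M P"
    and emeasure_D_finite: "P \<in> D j \<Longrightarrow> emeasure M P < \<infinity>"
    and disjoint_D: "disjoint (D j)"
    and C_ge_1: "1 \<le> C"
    and parent: "P \<in> D (j + 1) \<Longrightarrow> \<exists>R\<in>D j. P \<subseteq> R \<and> emeasure M R \<le> ennreal C * emeasure M P"
    and ancestors_large: "P \<in> D j \<Longrightarrow> \<exists>i0\<le>j. \<forall>i\<le>i0. \<forall>R\<in>D i. P \<subseteq> R \<longrightarrow> ennreal K < emeasure M R"
    and cover_D: "AE x in M. \<exists>P\<in>D 0. x \<in> P"
    and approximation: "P \<in> D 0 \<Longrightarrow> A \<in> sets M \<Longrightarrow> A \<subseteq> P \<Longrightarrow> 0 < \<eta> \<Longrightarrow>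
      \<exists>U\<in>sets M. emeasure M U \<le> emeasure M A + ennreal \<eta> \<and>
        (AE x in M. x \<in> A \<longrightarrow> (\<exists>j. \<exists>P'\<in>D j. x \<in> P' \<and> P' \<subseteq> U))"
    and geometry: "P \<in> D j \<Longrightarrow> \<exists>r>0. \<exists>x\<in>space M. P \<subseteq> dball d (space M) x (C * r) \<and>
      outer_measure_of M (enlarge d (space M) P r) \<le> ennreal C * emeasure M P"
begin

lemma ancestor: "i \<le> j \<Longrightarrow> P \<in> D j \<Longrightarrow> \<exists>R\<in>D i. P \<subseteq> R"
proof (induction j arbitrary: P rule: int_ge_induct)
  case base
  then show ?case by blast
next
  case (step j)
  from parent[OF step.prems] obtain R where "R \<in> D j" "P \<subseteq> R" by blast
  with step.IH[of R] show ?case by blast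
qed

lemma subset_or_disjoint:
  assumes "P \<in> D j" "R \<in> D i" "i \<le> j"
  shows "P \<subseteq> R \<or> P \<inter> R = {}"
proof -
  obtain R' where R': "R' \<in> D i" "P \<subseteq> R'" using ancestor assms by blast
  show ?thesis
  proof (cases "R' = R")
    case False
    then have "R' \<inter> R = {}" using disjoint_D[of i] R'(1) assms(2) by (auto simp: disjoint_def)
    then show ?thesis using R'(2) by blast
  qed (use R' in simp)
qed

text \<open>A set need not determine its level, so maximality refers to some level containing it,
  and only coarser levels are searched.\<close>

definition maximal :: "'x set set \<Rightarrow> 'x set set"
  where "maximal B = {P\<in>B. \<exists>j. P \<in> D j \<and> (\<forall>i<j. \<forall>R\<in>D i. P \<subseteq> R \<longrightarrow> R \<notin> B)}"

lemma maximal_subset: "maximal B \<subseteq> B" "maximal B \<subseteq> (\<Union>j. D j)"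
  by (auto simp: maximal_def)

lemma disjoint_maximal: "disjoint (maximal B)"
  unfolding disjoint_def
proof (intro ballI impI)
  fix P R assume PR: "P \<in> maximal B" "R \<in> maximal B" "P \<noteq> R"
  then obtain j i where ji: "P \<in> D j" "\<forall>i<j. \<forall>R\<in>D i. P \<subseteq> R \<longrightarrow> R \<notin> B"
    "R \<in> D i" "\<forall>k<i. \<forall>P\<in>D k. R \<subseteq> P \<longrightarrow> P \<notin> B" "P \<in> B" "R \<in> B"
    by (auto simp: maximal_def)
  consider "i = j" | "i < j" | "j < i" by linarith
  then show "P \<inter> R = {}"
  proof cases
    case 1
    then show ?thesis using disjoint_D[of j] ji PR(3) by (auto simp: disjoint_def)
  next
    case 2
    then show ?thesis using subset_or_disjoint[OF ji(1,3)] ji by auto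
  next
    case 3
    then show ?thesis using subset_or_disjoint[OF ji(3,1)] ji by auto
  qed
qed

text \<open>Ancestors beyond some level have measure above \<open>K\<close> and so lie outside
  \<open>B\<close>; the coarsest of the finitely many remaining levels with an ancestor in
  \<open>B\<close> gives the maximal set.\<close>

lemma exists_maximal:
  assumes B: "\<And>P. P \<in> B \<Longrightarrow> emeasure M P \<le> ennreal K" and P: "P \<in> B" "P \<in> D j"
  shows "\<exists>R\<in>maximal B. P \<subseteq> R"
proof -
  obtain i0 where i0: "i0 \<le> j" "\<forall>i\<le>i0. \<forall>R\<in>D i. P \<subseteq> R \<longrightarrow> ennreal K < emeasure M R"
    using ancestors_large[OF P(2), where K = K] by (elim exE conjE)
  define I where "I = {i\<in>{i0..j}. \<exists>R\<in>D i. P \<subseteq> R \<and> R \<in> B}"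
  have "finite I" by (rule finite_subset[of _ "{i0..j}"]) (auto simp: I_def)
  moreover have "j \<in> I" using P i0(1) by (auto simp: I_def)
  ultimately have "Min I \<in> I" and Min: "\<And>i. i \<in> I \<Longrightarrow> Min I \<le> i"
    using Min_in[of I] Min_le[of I] by blast+
  then obtain R where R: "R \<in> D (Min I)" "P \<subseteq> R" "R \<in> B" and le: "Min I \<le> j"
    by (auto simp: I_def)
  have "R' \<notin> B" if "i < Min I" "R' \<in> D i" "R \<subseteq> R'" for i R'
  proof
    assume "R' \<in> B"
    show False
    proof (cases "i0 \<le> i")
      case True
      then have "i \<in> I" using that le R(2) \<open>R' \<in> B\<close> by (auto simp: I_def)
      then show False using Min that(1) by fastforce
    next
      case False
      then have "i \<le> i0" by simp
      moreover have "P \<subseteq> R'" using R(2) that(3) by (rule order_trans)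
      ultimately have "ennreal K < emeasure M R'" using i0(2) that(2) by blast
      then show False using B[OF \<open>R' \<in> B\<close>] by simp
    qed
  qed
  then show ?thesis using R by (intro bexI[of _ R]) (auto simp: maximal_def)
qed

abbreviation L1_norm :: "('x \<Rightarrow> complex) \<Rightarrow> ennreal"
  where "L1_norm f \<equiv> (\<integral>\<^sup>+ y. ennreal (norm (f y)) \<partial>M)"

definition mass :: "('x \<Rightarrow> complex) \<Rightarrow> 'x set \<Rightarrow> ennreal"
  where "mass f P = (\<integral>\<^sup>+ y\<in>P. ennreal (norm (f y)) \<partial>M)"

definition heavy :: "('x \<Rightarrow> complex) \<Rightarrow> real \<Rightarrow> 'x set set"
  where "heavy f \<alpha> = {P. ennreal \<alpha> * emeasure M P < mass f P}"

abbreviation stopping :: "('x \<Rightarrow> complex) \<Rightarrow> real \<Rightarrow> 'x set set"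
  where "stopping f \<alpha> \<equiv> maximal (heavy f \<alpha>)"

lemma mass_mono: "P \<subseteq> R \<Longrightarrow> mass f P \<le> mass f R"
  unfolding mass_def by (intro nn_integral_mono) (auto split: split_indicator)

lemma mass_le: "mass f P \<le> L1_norm f"
  unfolding mass_def by (intro nn_integral_mono) (auto split: split_indicator)

context
  fixes f :: "'x \<Rightarrow> complex" and \<alpha> :: real
  assumes int_f: "integrable M f" and \<alpha>: "0 < \<alpha>"
begin

lemma measurable_f [measurable]: "f \<in> borel_measurable M"
  using int_f by auto

lemma norm_finite: "L1_norm f < \<infinity>"
  using int_f by (simp add: integrable_iff_bounded)

lemma mass_union:
  assumes "countable S" "disjoint S" "S \<subseteq> sets M"
  shows "mass f (\<Union>S) = (\<integral>\<^sup>+ P. mass f P \<partial>count_space S)"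
proof -
  have [measurable]: "P \<in> sets M" if "P \<in> S" for P using that assms by auto
  have dens: "mass f A = emeasure (density M (\<lambda>y. ennreal (norm (f y)))) A" if "A \<in> sets M" for A
    using that by (simp add: mass_def emeasure_density)
  have "disjoint_family_on (\<lambda>P. P) S"
    using assms(2) by (auto simp: disjoint_family_on_def disjoint_def)
  from emeasure_UN_countable[OF _ assms(1) this, of "density M (\<lambda>y. ennreal (norm (f y)))"]
  have "emeasure (density M (\<lambda>y. ennreal (norm (f y)))) (\<Union>S) = (\<integral>\<^sup>+ P. emeasure (density M (\<lambda>y. ennreal (norm (f y)))) P \<partial>count_space S)"
    using assms(3) by (simp add: subset_iff)
  also have "\<dots> = (\<integral>\<^sup>+ P. mass f P \<partial>count_space S)"
    by (intro nn_integral_cong) (use assms(3) dens in auto)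
  finally show ?thesis
    using assms by (subst dens) (auto intro: sets.countable_Union)
qed

lemma heavy_bounded: "P \<in> heavy f \<alpha> \<Longrightarrow> emeasure M P \<le> ennreal (enn2real (L1_norm f) / \<alpha>)"
proof -
  assume "P \<in> heavy f \<alpha>"
  then have "ennreal \<alpha> * emeasure M P \<le> L1_norm f"
    using mass_le[of f P] by (auto simp: heavy_def intro: less_imp_le less_le_trans)
  also have "\<dots> = ennreal \<alpha> * ennreal (enn2real (L1_norm f) / \<alpha>)"
    using \<alpha> norm_finite by (simp flip: ennreal_mult')
  finally show ?thesis
    using \<alpha> by (simp add: ennreal_mult_le_mult_iff)
qed

lemma stopping_D: "P \<in> stopping f \<alpha> \<Longrightarrow> \<exists>j. P \<in> D j"
  using maximal_subset by blast

lemma stopping_heavy: "P \<in> stopping f \<alpha> \<Longrightarrow> ennreal \<alpha> * emeasure M P < mass f P"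
  using maximal_subset by (auto simp: heavy_def)

text \<open>The parent, being coarser than a maximal heavy set, is not heavy, and its measure is
  larger by at most the factor \<open>C\<close>.\<close>

lemma stopping_mass_le:
  assumes "P \<in> stopping f \<alpha>"
  shows "mass f P \<le> ennreal (C * \<alpha>) * emeasure M P"
proof -
  obtain j where j: "P \<in> D j" "\<And>i R. i < j \<Longrightarrow> R \<in> D i \<Longrightarrow> P \<subseteq> R \<Longrightarrow> R \<notin> heavy f \<alpha>"
    using assms by (auto simp: maximal_def)
  obtain R where R: "R \<in> D (j - 1)" "P \<subseteq> R" "emeasure M R \<le> ennreal C * emeasure M P"
    using parent[of P "j - 1"] j(1) by auto
  have "mass f P \<le> mass f R" using R(2) by (rule mass_mono)
  also have "\<dots> \<le> ennreal \<alpha> * emeasure M R"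
    using j(2)[OF _ R(1,2)] by (simp add: heavy_def)
  also have "\<dots> \<le> ennreal \<alpha> * (ennreal C * emeasure M P)"
    using R(3) by (intro mult_left_mono) auto
  also have "\<dots> = ennreal (C * \<alpha>) * emeasure M P"
    using C_ge_1 \<alpha> by (simp add: ennreal_mult mult.assoc mult.left_commute)
  finally show ?thesis .
qed

lemma countable_stopping: "countable (stopping f \<alpha>)"
  using countable_subset[OF maximal_subset(2) countable_D] .

text \<open>This replaces Lebesgue's differentiation theorem: no cube that meets the exceptional set is heavy, so
  a fine cover of that set by cubes, of almost the same measure, bounds the integral of \<open>norm f\<close> over it.\<close>

lemma null_large_values:
  assumes P: "P \<in> D 0" and \<epsilon>: "0 < \<epsilon>"
  shows "{x\<in>P. \<alpha> + \<epsilon> \<le> norm (f x)} - \<Union>(stopping f \<alpha>) \<in> null_sets M"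
proof -
  define A where "A = {x\<in>P. \<alpha> + \<epsilon> \<le> norm (f x)} - \<Union>(stopping f \<alpha>)"
  have [measurable]: "P \<in> sets M" using sets_D[OF P] .
  have "\<Union>(stopping f \<alpha>) \<in> sets M"
    using countable_stopping stopping_D sets_D by (intro sets.countable_Union) auto
  moreover have "{x\<in>P. \<alpha> + \<epsilon> \<le> norm (f x)} = {x\<in>space M. x \<in> P \<and> \<alpha> + \<epsilon> \<le> norm (f x)}"
    using sets.sets_into_space[OF sets_D[OF P]] by auto
  ultimately have A[measurable]: "A \<in> sets M" unfolding A_def by measurable
  have AP: "A \<subseteq> P" by (auto simp: A_def)
  have fin: "emeasure M A < \<infinity>"
    using emeasure_mono[OF AP sets_D[OF P]] emeasure_D_finite[OF P] by (auto intro: le_less_trans)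
  define m where "m = measure M A"
  have m: "emeasure M A = ennreal m" using fin by (simp add: m_def emeasure_eq_ennreal_measure)
  have "\<not> 0 < m"
  proof
    assume m0: "0 < m"
    \<comment> \<open>With this \<open>\<eta>\<close> the final comparison reads \<open>(\<alpha> +
      \<epsilon>) * m \<le> \<alpha> * m + \<epsilon> * m / 2\<close>, which is absurd for
      \<open>m > 0\<close>.\<close>
    define \<eta> where "\<eta> = \<epsilon> * m / (2 * \<alpha>)"
    have \<eta>: "0 < \<eta>" using \<epsilon> m0 \<alpha> by (simp add: \<eta>_def)
    obtain U where U: "U \<in> sets M" "emeasure M U \<le> emeasure M A + ennreal \<eta>"
      "AE x in M. x \<in> A \<longrightarrow> (\<exists>j. \<exists>P'\<in>D j. x \<in> P' \<and> P' \<subseteq> U)"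
      using approximation[OF P A AP \<eta>] by blast
    \<comment> \<open>Members of \<open>B\<close> lie in \<open>U\<close> and so have bounded
      measure; hence each member that belongs to the system lies in a maximal one, and maximal ones
      are disjoint.\<close>
    define B where "B = {R. R \<subseteq> U \<and> R \<inter> A \<noteq> {}}"
    have U_le: "emeasure M U \<le> ennreal (m + \<eta>)" using U(2) m m0 \<eta> by simp
    have Bb: "emeasure M R \<le> ennreal (m + \<eta>)" if "R \<in> B" for R
      using emeasure_mono[OF _ U(1), of R] that U_le by (auto simp: B_def intro: order_trans)
    have light: "mass f R \<le> ennreal \<alpha> * emeasure M R" if R: "R \<in> maximal B" for R
    proof (rule ccontr)
      assume "\<not> ?thesis"
      then have "R \<in> heavy f \<alpha>" by (simp add: heavy_def)
      moreover obtain j where "R \<in> D j" using maximal_subset(2) R by blast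
      ultimately obtain S where "S \<in> stopping f \<alpha>" "R \<subseteq> S"
        using exists_maximal[OF heavy_bounded] by blast
      moreover have "R \<inter> A \<noteq> {}" using R maximal_subset(1) by (auto simp: B_def)
      ultimately show False by (auto simp: A_def)
    qed
    have cM: "countable (maximal B)" using countable_subset[OF maximal_subset(2) countable_D] .
    have sM: "maximal B \<subseteq> sets M" using maximal_subset(2) sets_D by blast
    have V[measurable]: "\<Union>(maximal B) \<in> sets M" using cM sM by (rule sets.countable_Union)
    have "ennreal (\<alpha> + \<epsilon>) * emeasure M A = (\<integral>\<^sup>+ x. ennreal (\<alpha> + \<epsilon>) * indicator A x \<partial>M)"
      by (simp add: nn_integral_cmult_indicator)
    also have "\<dots> \<le> mass f (\<Union>(maximal B))"
      unfolding mass_def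
    proof (rule nn_integral_mono_AE, use U(3) in eventually_elim)
      fix x assume x: "x \<in> A \<longrightarrow> (\<exists>j. \<exists>P'\<in>D j. x \<in> P' \<and> P' \<subseteq> U)"
      show "ennreal (\<alpha> + \<epsilon>) * indicator A x \<le> ennreal (norm (f x)) * indicator (\<Union>(maximal B)) x"
      proof (cases "x \<in> A")
        case True
        then obtain j P' where P': "P' \<in> D j" "x \<in> P'" "P' \<subseteq> U" using x by blast
        then have "P' \<in> B" using True by (auto simp: B_def)
        then have "x \<in> \<Union>(maximal B)" using exists_maximal[OF Bb _ P'(1)] P'(2) by blast
        moreover have "\<alpha> + \<epsilon> \<le> norm (f x)" using True by (simp add: A_def)
        ultimately show ?thesis using True by (simp add: ennreal_leI)
      qed simp
    qed
    also have "\<dots> = (\<integral>\<^sup>+ R. mass f R \<partial>count_space (maximal B))"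
      by (rule mass_union[OF cM disjoint_maximal sM])
    also have "\<dots> \<le> (\<integral>\<^sup>+ R. ennreal \<alpha> * emeasure M R \<partial>count_space (maximal B))"
      by (intro nn_integral_mono) (simp add: light)
    also have "\<dots> = ennreal \<alpha> * (\<integral>\<^sup>+ R. emeasure M R \<partial>count_space (maximal B))"
      by (rule nn_integral_cmult) simp
    also have "(\<integral>\<^sup>+ R. emeasure M R \<partial>count_space (maximal B)) = emeasure M (\<Union>(maximal B))"
    proof -
      have "disjoint_family_on (\<lambda>P. P) (maximal B)"
        using disjoint_maximal by (auto simp: disjoint_family_on_def disjoint_def)
      from emeasure_UN_countable[OF _ cM this, of M] sM show ?thesis by (simp add: subset_iff)
    qed
    also have "emeasure M (\<Union>(maximal B)) \<le> emeasure M U"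
      using U(1) maximal_subset(1) by (intro emeasure_mono) (auto simp: B_def)
    also note U_le
    finally have "ennreal ((\<alpha> + \<epsilon>) * m) \<le> ennreal (\<alpha> * (m + \<eta>))"
      using \<alpha> \<epsilon> \<eta> m0 by (simp add: m ennreal_mult mult_left_mono)
    then have "(\<alpha> + \<epsilon>) * m \<le> \<alpha> * (m + \<eta>)"
      using \<alpha> m0 \<eta> by (simp add: ennreal_le_iff)
    then show False using m0 \<epsilon> \<alpha> by (simp add: \<eta>_def field_simps)
  qed
  moreover have "0 \<le> m" by (simp add: m_def)
  ultimately have "emeasure M A = 0" using m by simp
  then show ?thesis using A unfolding A_def by auto
qed

lemma AE_large_values: "AE x in M. x \<notin> \<Union>(stopping f \<alpha>) \<longrightarrow> norm (f x) \<le> \<alpha>"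
proof -
  define Nn where "Nn = (\<Union>P\<in>D 0. \<Union>k. {x\<in>P. \<alpha> + 1 / real (Suc k) \<le> norm (f x)} - \<Union>(stopping f \<alpha>))"
  have "countable (D 0)" using countable_subset[OF _ countable_D] by blast
  then have "Nn \<in> null_sets M"
    unfolding Nn_def by (intro null_sets_UN' null_sets_UN null_large_values) auto
  then have "AE x in M. x \<notin> Nn" by (rule AE_not_in)
  with cover_D show ?thesis
  proof eventually_elim
    case (elim x)
    show ?case
    proof (intro impI, rule ccontr)
      assume x: "x \<notin> \<Union>(stopping f \<alpha>)" "\<not> norm (f x) \<le> \<alpha>"
      then have "0 < norm (f x) - \<alpha>" by simp
      then obtain k where "1 / real (Suc k) < norm (f x) - \<alpha>" by (rule nat_approx_posE)
      then have k: "\<alpha> + 1 / real (Suc k) \<le> norm (f x)" by linarith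
      obtain P where P: "P \<in> D 0" "x \<in> P" using elim(1) by blast
      have "x \<in> {x\<in>P. \<alpha> + 1 / real (Suc k) \<le> norm (f x)} - \<Union>(stopping f \<alpha>)"
        using P(2) k x(1) by blast
      then have "x \<in> Nn" unfolding Nn_def using P(1) by blast
      then show False using elim(2) by contradiction
    qed
  qed
qed

lemma sum_mass_le:
  assumes "finite F" "inj_on E F" "E ` F \<subseteq> stopping f \<alpha>"
  shows "(\<Sum>j\<in>F. mass f (E j)) \<le> L1_norm f"
proof -
  have [measurable]: "E j \<in> sets M" if "j \<in> F" for j
    using that assms(3) stopping_D sets_D by blast
  have "(\<Sum>j\<in>F. mass f (E j)) = (\<Sum>P\<in>E ` F. mass f P)"
    using assms(2) by (simp add: sum.reindex)
  also have "\<dots> = (\<integral>\<^sup>+ P. mass f P \<partial>count_space (E ` F))"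
    using assms(1) by (simp add: nn_integral_count_space_finite)
  also have "\<dots> = mass f (\<Union>(E ` F))"
    using assms disjoint_maximal[of "heavy f \<alpha>"]
    by (intro mass_union[symmetric]) (auto simp: countable_finite disjoint_def)
  also note mass_le
  finally show ?thesis .
qed

text \<open>\<open>b j\<close> is \<open>f\<close> minus its mean on the \<open>j\<close>-th
  stopping set, and \<open>g\<close> is that mean there, at most \<open>C * \<alpha>\<close> in norm
  by \<open>stopping_mass_le\<close>. The factor \<open>2\<close> comes from the norm of
  \<open>b j\<close>, at most twice the mass of \<open>f\<close> on the set. Indices are natural
  numbers from an enumeration, so \<open>J\<close> may be finite or empty.\<close>

lemma CZ_decomposition_stopping: "CZ_decomposition d M (2 * C) f \<alpha> (stopping f \<alpha>)"
proof -
  define J where "J = to_nat_on (stopping f \<alpha>) ` stopping f \<alpha>"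
  define E where "E = from_nat_into (stopping f \<alpha>)"
  have E_mem: "E j \<in> stopping f \<alpha>" if "j \<in> J" for j
    using that countable_stopping by (auto simp: J_def E_def)
  have E_image: "E ` J = stopping f \<alpha>"
    using countable_stopping by (force simp: J_def E_def image_image)
  have inj: "inj_on E J"
    unfolding J_def E_def using countable_stopping by (intro inj_onI) auto
  have sets_E [measurable]: "E j \<in> sets M" if "j \<in> J" for j
    using E_mem[OF that] stopping_D sets_D by blast
  have E_pos: "0 < emeasure M (E j)" and E_fin: "emeasure M (E j) < \<infinity>" if "j \<in> J" for j
    using E_mem[OF that] stopping_D emeasure_D_pos emeasure_D_finite by blast+
  have E_disj: "i = j" if "i \<in> J" "j \<in> J" "y \<in> E i" "y \<in> E j" for i j y
  proof -
    have "E i = E j"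
      using disjointD[OF disjoint_maximal E_mem[OF that(1)] E_mem[OF that(2)]] that(3,4) by blast
    then show ?thesis using inj_onD[OF inj] that by blast
  qed
  define avg where "avg P = (1 / measure M P) *\<^sub>R (LINT y:P|M. f y)" for P
  define b where "b j y = (indicator (E j) y :: real) *\<^sub>R (f y - avg (E j))" for j y
  \<comment> \<open>At each point at most one term is nonzero, so the series converges trivially;
    writing it as a series makes \<open>g\<close> measurable.\<close>
  define s where "s y = (\<Sum>n. if n \<in> J then b n y else 0)" for y
  define g where "g y = f y - s y" for y
  have s_in: "s y = b j y" if "j \<in> J" "y \<in> E j" for j y
  proof -
    have "s y = (\<Sum>n\<in>{j}. if n \<in> J then b n y else 0)"
      unfolding s_def using E_disj that by (intro suminf_finite) (auto simp: b_def split: split_indicator)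
    then show ?thesis using that by simp
  qed
  have s_out: "s y = 0" if "y \<notin> \<Union>(stopping f \<alpha>)" for y
  proof -
    have "(if n \<in> J then b n y else 0) = 0" for n
      using that E_mem by (auto simp: b_def split: split_indicator)
    then show ?thesis by (simp add: s_def)
  qed
  have int_ind: "integrable M (\<lambda>y. (indicator (E j) y :: real) *\<^sub>R f y)" if "j \<in> J" for j
    using integrable_mult_indicator[OF sets_E[OF that] int_f] .
  have int_b: "integrable M (b j)" if "j \<in> J" for j
    unfolding b_def scaleR_diff_right
    using E_fin[OF that] sets_E[OF that] by (intro Bochner_Integration.integrable_diff int_ind that) (auto intro!: integrable_mult_left)
  have norm_int: "ennreal (norm (LINT y:E j|M. f y)) \<le> mass f (E j)" if "j \<in> J" for j
  proof -
    have "ennreal (norm (LINT y:E j|M. f y)) \<le> (\<integral>\<^sup>+ y. ennreal (norm ((indicator (E j) y :: real) *\<^sub>R f y)) \<partial>M)"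
      unfolding set_lebesgue_integral_def by (rule integral_norm_bound_ennreal[OF int_ind[OF that]])
    also have "\<dots> = mass f (E j)"
      unfolding mass_def by (intro nn_integral_cong) (auto split: split_indicator)
    finally show ?thesis .
  qed
  have measure_E: "emeasure M (E j) = ennreal (measure M (E j))" "0 < measure M (E j)" if "j \<in> J" for j
    using E_pos[OF that] E_fin[OF that] by (auto simp: emeasure_eq_ennreal_measure)
  have norm_avg: "norm (avg (E j)) \<le> C * \<alpha>" if "j \<in> J" for j
  proof -
    have "ennreal (norm (LINT y:E j|M. f y)) \<le> ennreal (C * \<alpha> * measure M (E j))"
      using order_trans[OF norm_int[OF that] stopping_mass_le[OF E_mem[OF that]]] C_ge_1 \<alpha>
      by (simp add: measure_E[OF that] ennreal_mult)
    then have "norm (LINT y:E j|M. f y) \<le> C * \<alpha> * measure M (E j)"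
      using C_ge_1 \<alpha> by (subst (asm) ennreal_le_iff) auto
    then show ?thesis using measure_E(2)[OF that] by (simp add: avg_def field_simps)
  qed
  have int_b_le: "(\<integral>\<^sup>+ y. ennreal (norm (b j y)) \<partial>M) \<le> 2 * mass f (E j)" if "j \<in> J" for j
  proof -
    have "(\<integral>\<^sup>+ y. ennreal (norm (b j y)) \<partial>M)
        \<le> (\<integral>\<^sup>+ y. ennreal (norm (f y)) * indicator (E j) y + ennreal (norm (avg (E j))) * indicator (E j) y \<partial>M)"
      by (rule nn_integral_mono)
         (auto simp: b_def split: split_indicator intro: ennreal_leI norm_triangle_ineq4 simp flip: ennreal_plus)
    also have "\<dots> = mass f (E j) + ennreal (norm (avg (E j))) * emeasure M (E j)"
      unfolding mass_def using sets_E[OF that] by (subst nn_integral_add) (auto simp: nn_integral_cmult_indicator)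
    also have "ennreal (norm (avg (E j))) * emeasure M (E j) = ennreal (norm (LINT y:E j|M. f y))"
      using measure_E[OF that] by (simp add: avg_def flip: ennreal_mult')
    also have "mass f (E j) + \<dots> \<le> mass f (E j) + mass f (E j)"
      using norm_int[OF that] by (intro add_left_mono)
    finally show ?thesis by (simp add: mult_2)
  qed
  have mean_b: "(LINT y:E j|M. b j y) = 0" if "j \<in> J" for j
  proof -
    have "(LINT y:E j|M. b j y) = (LINT y|M. (indicator (E j) y :: real) *\<^sub>R f y - (indicator (E j) y :: real) *\<^sub>R avg (E j))"
      unfolding set_lebesgue_integral_def b_def
      by (intro Bochner_Integration.integral_cong) (auto split: split_indicator)
    also have "\<dots> = (LINT y:E j|M. f y) - measure M (E j) *\<^sub>R avg (E j)"
      unfolding set_lebesgue_integral_def using int_ind[OF that] E_fin[OF that] sets_E[OF that]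
      by (subst Bochner_Integration.integral_diff) auto
    also have "\<dots> = 0" using measure_E(2)[OF that] by (simp add: avg_def)
    finally show ?thesis .
  qed
  have "\<exists>r x. 0 < r \<and> x \<in> space M \<and> E j \<subseteq> dball d (space M) x (C * r) \<and>
      outer_measure_of M (enlarge d (space M) (E j) r) \<le> ennreal C * emeasure M (E j)" if "j \<in> J" for j
    using E_mem[OF that] stopping_D geometry by meson
  then obtain r x where rx: "\<And>j. j \<in> J \<Longrightarrow> 0 < r j \<and> x j \<in> space M \<and> E j \<subseteq> dball d (space M) (x j) (C * r j) \<and>
      outer_measure_of M (enlarge d (space M) (E j) (r j)) \<le> ennreal C * emeasure M (E j)"
    by metis
  have [measurable]: "s \<in> borel_measurable M"
    unfolding s_def
  proof (rule borel_measurable_suminf)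
    show "(\<lambda>y. if n \<in> J then b n y else 0) \<in> borel_measurable M" for n
      using int_b[of n] by (cases "n \<in> J") auto
  qed
  have g_meas: "g \<in> borel_measurable M" unfolding g_def by measurable
  have sums: "((\<lambda>j. b j y) has_sum (f y - g y)) J" for y
  proof (cases "\<exists>j\<in>J. y \<in> E j")
    case True
    then obtain j where j: "j \<in> J" "y \<in> E j" by blast
    then have "f y - g y = (\<Sum>i\<in>{j}. b i y)" using s_in by (simp add: g_def)
    then show ?thesis
      using j E_disj by (intro has_sum_finite_neutralI[of "{j}"]) (auto simp: b_def split: split_indicator)
  next
    case False
    then have "y \<notin> \<Union>(stopping f \<alpha>)" using E_image by auto
    then have "f y - g y = 0" by (simp add: g_def s_out)
    moreover have "b j y = 0" if "j \<in> J" for j using False that by (auto simp: b_def)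
    ultimately show ?thesis by (auto intro: has_sum_0)
  qed
  have g_bound: "AE y in M. norm (g y) \<le> 2 * C * \<alpha>"
    using AE_large_values
  proof eventually_elim
    case (elim y)
    show ?case
    proof (cases "\<exists>j\<in>J. y \<in> E j")
      case True
      then obtain j where j: "j \<in> J" "y \<in> E j" by blast
      then have "g y = avg (E j)" by (simp add: g_def s_in b_def)
      then show ?thesis using norm_avg[OF j(1)] C_ge_1 \<alpha> by (auto intro: order_trans)
    next
      case False
      then have y: "y \<notin> \<Union>(stopping f \<alpha>)" using E_image by auto
      have "norm (g y) \<le> \<alpha>" using elim y by (simp add: g_def s_out)
      also have "\<alpha> \<le> 2 * C * \<alpha>" using C_ge_1 \<alpha> by simp
      finally show ?thesis .
    qed
  qed
  have b_sum: "(\<Sum>\<^sub>\<infinity>j\<in>J. (\<integral>\<^sup>+ y. ennreal (norm (b j y)) \<partial>M)) \<le> ennreal (2 * C) * L1_norm f"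
  proof (rule infsum_ennreal_le)
    fix F assume F: "finite F" "F \<subseteq> J"
    have "(\<Sum>j\<in>F. (\<integral>\<^sup>+ y. ennreal (norm (b j y)) \<partial>M)) \<le> (\<Sum>j\<in>F. 2 * mass f (E j))"
      using F by (intro sum_mono int_b_le) auto
    also have "\<dots> \<le> 2 * L1_norm f"
      unfolding sum_distrib_left[symmetric]
      using F E_mem inj_on_subset[OF inj] by (intro mult_left_mono sum_mass_le) auto
    also have "\<dots> \<le> ennreal (2 * C) * L1_norm f"
      using C_ge_1 ennreal_leI[of 2 "2 * C"] by (intro mult_right_mono) auto
    finally show "(\<Sum>j\<in>F. (\<integral>\<^sup>+ y. ennreal (norm (b j y)) \<partial>M)) \<le> ennreal (2 * C) * L1_norm f" .
  qed
  have out_sum: "(\<Sum>\<^sub>\<infinity>j\<in>J. outer_measure_of M (enlarge d (space M) (E j) (r j)))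
      \<le> ennreal (2 * C / \<alpha>) * L1_norm f"
  proof (rule infsum_ennreal_le)
    fix F assume F: "finite F" "F \<subseteq> J"
    have "outer_measure_of M (enlarge d (space M) (E j) (r j)) \<le> ennreal (C / \<alpha>) * mass f (E j)" if "j \<in> F" for j
    proof -
      have j: "j \<in> J" using that F by auto
      have "outer_measure_of M (enlarge d (space M) (E j) (r j)) \<le> ennreal C * emeasure M (E j)"
        using rx[OF j] by simp
      also have "\<dots> = ennreal (C / \<alpha>) * (ennreal \<alpha> * emeasure M (E j))"
        using \<alpha> C_ge_1 by (simp flip: mult.assoc ennreal_mult')
      also have "\<dots> \<le> ennreal (C / \<alpha>) * mass f (E j)"
        using stopping_heavy[OF E_mem[OF j]] by (intro mult_left_mono) auto
      finally show ?thesis .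
    qed
    then have "(\<Sum>j\<in>F. outer_measure_of M (enlarge d (space M) (E j) (r j))) \<le> (\<Sum>j\<in>F. ennreal (C / \<alpha>) * mass f (E j))"
      by (rule sum_mono)
    also have "\<dots> \<le> ennreal (C / \<alpha>) * L1_norm f"
      unfolding sum_distrib_left[symmetric]
      using F E_mem inj_on_subset[OF inj] by (intro mult_left_mono sum_mass_le) auto
    also have "\<dots> \<le> ennreal (2 * C / \<alpha>) * L1_norm f"
      using C_ge_1 \<alpha> by (intro mult_right_mono ennreal_leI) (auto simp: divide_right_mono)
    finally show "(\<Sum>j\<in>F. outer_measure_of M (enlarge d (space M) (E j) (r j)))
      \<le> ennreal (2 * C / \<alpha>) * L1_norm f" .
  qed
  have ball: "E j \<subseteq> dball d (space M) (x j) (2 * C * r j)" if "j \<in> J" for j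
  proof -
    have "C * r j \<le> 2 * C * r j" using rx[OF that] C_ge_1 by simp
    moreover have "E j \<subseteq> dball d (space M) (x j) (C * r j)" using rx[OF that] by (elim conjE)
    ultimately show ?thesis using dball_mono order_trans by metis
  qed
  have b_out: "b j y = 0" if "y \<notin> E j" for j y using that by (simp add: b_def)
  show ?thesis
    unfolding CZ_decomposition_def
    using rx ball sets_E int_b g_meas sums g_bound b_sum out_sum mean_b b_out E_image
    by (intro exI[of _ J] exI[of _ E] exI[of _ r] exI[of _ x] exI[of _ g] exI[of _ b]) auto
qed

end

text \<open>At height \<open>1\<close> the conditions on \<open>g\<close> and \<open>b\<close> are
  immediate; the enlarged set is controlled by \<open>geometry\<close>, since the norm of the
  indicator is the measure of \<open>P\<close>.\<close>

lemma CZ_decomposition_indicator: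
  assumes "P \<in> D j"
  shows "CZ_decomposition d M (2 * C) (indicator P) 1 {P}"
proof -
  obtain r x where r: "0 < r" and x: "x \<in> space M" and ball: "P \<subseteq> dball d (space M) x (C * r)"
    and out: "outer_measure_of M (enlarge d (space M) P r) \<le> ennreal C * emeasure M P"
    using geometry[OF assms] by blast
  have P [measurable]: "P \<in> sets M" by (rule sets_D[OF assms])
  have norm: "(\<integral>\<^sup>+ y. ennreal (norm (indicator P y :: complex)) \<partial>M) = emeasure M P"
  proof -
    have "(\<integral>\<^sup>+ y. ennreal (norm (indicator P y :: complex)) \<partial>M) = (\<integral>\<^sup>+ y. indicator P y \<partial>M)"
      by (intro nn_integral_cong) (auto split: split_indicator)
    then show ?thesis by simp
  qed
  have "ennreal C * emeasure M P \<le> ennreal (2 * C) * emeasure M P"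
    using C_ge_1 by (intro mult_right_mono ennreal_leI) auto
  with out have out': "outer_measure_of M (enlarge d (space M) P r) \<le> ennreal (2 * C) * emeasure M P"
    by (rule order_trans)
  have "C * r \<le> 2 * C * r" using r C_ge_1 by simp
  from order_trans[OF ball dball_mono[OF this]] have ball': "P \<subseteq> dball d (space M) x (2 * C * r)" .
  show ?thesis
    unfolding CZ_decomposition_def norm
    using r x ball' out' P C_ge_1
    by (intro exI[of _ "{0}"] exI[of _ "\<lambda>_. P"] exI[of _ "\<lambda>_. r"] exI[of _ "\<lambda>_. x"] exI[of _ "indicator P"]
        exI[of _ "\<lambda>_ _. 0"]) (auto simp: set_lebesgue_integral_def split: split_indicator)
qed

text \<open>The property asks that the chosen sets make up the whole family, whereas stopping sets
  are only known to belong to it. The choice is therefore overridden at the pairs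
  \<open>(indicator P, 1)\<close>, from which \<open>P\<close> is recovered as the support.\<close>

theorem CZP_wrt_dyadic: "CZP_wrt d M (\<Union>j. D j)"
proof -
  define supp where "supp f = {y. f y \<noteq> 0}" for f :: "'x \<Rightarrow> complex"
  define test where "test f \<alpha> \<longleftrightarrow> \<alpha> = 1 \<and> supp f \<in> (\<Union>j. D j) \<and> f = indicator (supp f)" for f and \<alpha> :: real
  define \<E> where "\<E> f \<alpha> = (if test f \<alpha> then {supp f} else stopping f \<alpha>)" for f \<alpha>
  have "CZ_decomposition d M (2 * C) f \<alpha> (\<E> f \<alpha>)" if "integrable M f" "0 < \<alpha>" for f \<alpha>
  proof (cases "test f \<alpha>")
    case True
    then obtain j where j: "supp f \<in> D j" "\<alpha> = 1" "f = indicator (supp f)"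
      by (auto simp: test_def)
    then show ?thesis using CZ_decomposition_indicator[OF j(1)] True by (metis \<E>_def)
  qed (use CZ_decomposition_stopping[OF that] in \<open>simp add: \<E>_def\<close>)
  moreover have "(\<Union>j. D j) = \<Union>{\<E> f \<alpha> |f \<alpha>. integrable M f \<and> 0 < \<alpha>}"
  proof (intro equalityI subsetI)
    fix P assume "P \<in> (\<Union>j. D j)"
    then obtain j where P: "P \<in> D j" by blast
    define f :: "'x \<Rightarrow> complex" where "f = indicator P"
    have "supp f = P" by (auto simp: supp_def f_def indicator_def)
    then have "test f 1" using P by (auto simp: test_def f_def)
    then have "P \<in> \<E> f 1" using \<open>supp f = P\<close> by (simp add: \<E>_def)
    moreover have "integrable M f"
    proof -
      have "f = (\<lambda>y. complex_of_real (indicator P y))" by (auto simp: f_def indicator_def)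
      then show ?thesis using sets_D[OF P] emeasure_D_finite[OF P] by simp
    qed
    ultimately show "P \<in> \<Union>{\<E> f \<alpha> |f \<alpha>. integrable M f \<and> 0 < \<alpha>}"
      by (intro UnionI[of "\<E> f 1"] CollectI exI[of _ f] exI[of _ 1]) auto
  next
    fix P assume "P \<in> \<Union>{\<E> f \<alpha> |f \<alpha>. integrable M f \<and> 0 < \<alpha>}"
    then obtain f \<alpha> where "P \<in> \<E> f \<alpha>" by auto
    then show "P \<in> (\<Union>j. D j)"
      using maximal_subset(2)[of "heavy f \<alpha>"] by (cases "test f \<alpha>") (auto simp: \<E>_def test_def)
  qed
  ultimately show ?thesis
    unfolding CZP_wrt_def using infinite_measure C_ge_1
    by (intro conjI exI[of _ "2 * C"] exI[of _ \<E>]) auto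
qed

end

section \<open>Flow coordinates\<close>

lemma nn_integral_inverse_interval:
  assumes "0 < p" "p < q"
  shows "(\<integral>\<^sup>+ b. ennreal (1 / b) * indicator {p<..<q} b \<partial>lborel) = ennreal (ln q - ln p)"
proof -
  have "(\<integral>\<^sup>+ b. ennreal (1 / b) * indicator {p<..<q} b \<partial>lborel) = (\<integral>\<^sup>+ b. ennreal (1 / b) * indicator {p..q} b \<partial>lborel)"
  proof (rule nn_integral_cong_AE)
    show "AE b in lborel. ennreal (1 / b) * indicator {p<..<q} b = ennreal (1 / b) * indicator {p..q} b"
      using AE_lborel_singleton[of p] AE_lborel_singleton[of q]
      by eventually_elim (auto split: split_indicator)
  qed
  also have "\<dots> = ennreal (ln q - ln p)"
    by (rule nn_integral_FTC_Icc) (use assms in \<open>auto intro!: derivative_eq_intros\<close>)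
  finally show ?thesis .
qed

locale flow_setting = strat_group N
  for N :: "('a::{second_countable_topology, t2_space}, real ^ 'n::{finite, wellorder}) strat" +
  fixes Z :: "(real ^ 'n::{finite, wellorder}) \<times> real" and \<mu> :: "('a \<times> real) measure" and \<phi> :: "'a \<times> real \<Rightarrow> real"
  assumes Z: "Z \<in> Z_set N" and density_\<mu>: "flow_measure_density N Z \<mu> \<phi>"
begin

text \<open>The logarithm of an element of \<open>N\<close> that conjugates the vertical
  one-parameter subgroup to that of \<open>Z\<close>.\<close>

definition base_point :: "real ^ 'n::{finite, wellorder}"
  where "base_point = (SOME Y. orbit_velocity Y = fst Z)"

definition \<xi> :: "real \<Rightarrow> 'a"
  where "\<xi> b = orbit base_point b"

text \<open>For \<open>b > 0\<close> this is \<open>(n, 1) exp (ln b Z)\<close>. As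
  \<open>dl b\<close> makes sense for every real \<open>b\<close>, the map is a continuous bijection
  of the full product with continuous inverse, and positivity of the height is imposed on sets
  only.\<close>

definition \<Psi> :: "'a \<times> real \<Rightarrow> 'a \<times> real"
  where "\<Psi> = (\<lambda>(n, b). (n \<otimes>\<^bsub>N\<^esub> \<xi> b, b))"

definition proj :: "'a \<times> real \<Rightarrow> 'a"
  where "proj = (\<lambda>(n, b). n \<otimes>\<^bsub>N\<^esub> inv\<^bsub>N\<^esub> \<xi> b)"

lemma flow_Z: "flow N Z t = (\<xi> (exp t), exp t)"
proof -
  have "orbit_velocity base_point = fst Z"
    unfolding base_point_def by (rule someI_ex) (rule orbit_velocity_surj)
  moreover have "Z = (fst Z, 1)" using Z_set_snd[OF Z] by (cases Z) simp
  ultimately show ?thesis using flow_eq[of base_point "fst Z" t] by (simp add: \<xi>_def)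
qed

lemma N_cancel [simp]: "n \<otimes>\<^bsub>N\<^esub> m \<otimes>\<^bsub>N\<^esub> inv\<^bsub>N\<^esub> m = n" "n \<otimes>\<^bsub>N\<^esub> inv\<^bsub>N\<^esub> m \<otimes>\<^bsub>N\<^esub> m = n"
  using group_N by (simp_all add: group.inv_solve_right' monoid.m_assoc[OF group.is_monoid] group.r_inv group.l_inv
      monoid.r_one[OF group.is_monoid])

lemma proj_\<Psi> [simp]: "proj (\<Psi> (n, b)) = n" "snd (\<Psi> x) = snd x" "\<Psi> (proj x, snd x) = x"
  by (auto simp: proj_def \<Psi>_def split: prod.splits)

lemma \<Psi>_proj_iff: "x = \<Psi> (n, b) \<longleftrightarrow> proj x = n \<and> snd x = b"
  by (metis proj_\<Psi> snd_conv)

lemma inj_\<Psi>: "inj \<Psi>"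
  by (rule injI) (metis \<Psi>_proj_iff surj_pair)

lemma \<Psi>_image: "\<Psi> ` S = {x. (proj x, snd x) \<in> S}"
  by (force simp: \<Psi>_proj_iff)

lemma flow_\<Psi>: "(n, 1) \<otimes>\<^bsub>GA N\<^esub> flow N Z t = \<Psi> (n, exp t)"
  by (simp add: flow_Z \<Psi>_def)

lemma cyl_set_eq:
  assumes "0 < a" "0 < r"
  shows "cyl_set N Z (r, k, E, a) = \<Psi> ` strip (r, k, E, a)"
proof (intro equalityI subsetI)
  fix x assume "x \<in> cyl_set N Z (r, k, E, a)"
  then obtain n t where x: "x = \<Psi> (n, exp t)" "n \<in> E" "ln (a / r) < t" "t < ln (a * r)"
    by (auto simp: flow_\<Psi>)
  have "exp (ln (a / r)) < exp t" "exp t < exp (ln (a * r))"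
    using x(3,4) by (simp_all only: exp_less_cancel_iff)
  then have "a / r < exp t" "exp t < a * r"
    using assms by (simp_all add: exp_ln)
  then show "x \<in> \<Psi> ` strip (r, k, E, a)" using x by (auto simp: strip.simps)
next
  fix x assume "x \<in> \<Psi> ` strip (r, k, E, a)"
  then obtain n b where x: "x = \<Psi> (n, b)" "n \<in> E" "a / r < b" "b < a * r"
    by (auto simp: strip.simps)
  have ar: "0 < a / r" using assms by simp
  have b: "0 < b" using ar x(3) by linarith
  have "ln (a / r) < ln b" "ln b < ln (a * r)"
    using x(3,4) ar b by (metis ln_less_cancel_iff less_trans)+
  moreover have "x = (n, 1) \<otimes>\<^bsub>GA N\<^esub> flow N Z (ln b)" using x b by (simp add: flow_\<Psi>)
  ultimately show "x \<in> cyl_set N Z (r, k, E, a)" using x(2) by force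
qed

lemma d_Z_\<Psi>:
  assumes "0 < b" "0 < b'"
  shows "d_Z N Z (\<Psi> (n, b)) (\<Psi> (n', b')) = d_G N (n, b) (n', b')"
  using assms by (simp add: d_Z_def \<Psi>_def flow_N_def flow_Z)

lemma \<phi>_\<Psi>: "0 < b \<Longrightarrow> \<phi> (\<Psi> (n, b)) = \<phi> (n, 1)"
proof -
  assume b: "0 < b"
  have "\<phi> (n, 1) = \<phi> ((n, 1) \<otimes>\<^bsub>GA N\<^esub> flow N Z (ln b))"
    using density_\<mu> by (simp add: flow_measure_density_def)
  then show ?thesis using b by (simp only: flow_\<Psi> exp_ln)
qed

lemma continuous_\<xi>: "continuous_on S \<xi>"
proof -
  have "continuous_on S (\<lambda>b. base_point \<star> - dl b base_point)"
    by (intro continuous_star continuous_intros continuous_dl)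
  then show ?thesis
    unfolding \<xi>_def orbit_def by (rule continuous_on_compose2[OF continuous_expo]) auto
qed

lemma continuous_mult:
  assumes "continuous_on S f" "continuous_on S g"
  shows "continuous_on S (\<lambda>x. f x \<otimes>\<^bsub>N\<^esub> g x)"
proof -
  have "continuous_on S (\<lambda>x. logN N (f x) \<star> logN N (g x))"
    by (intro continuous_star continuous_on_compose2[OF continuous_log] assms) auto
  then have "continuous_on S (\<lambda>x. expo N (logN N (f x) \<star> logN N (g x)))"
    by (rule continuous_on_compose2[OF continuous_expo]) auto
  then show ?thesis by (simp add: star_def)
qed

lemma continuous_inv:
  assumes "continuous_on S f"
  shows "continuous_on S (\<lambda>x. inv\<^bsub>N\<^esub> f x)"
proof -
  have "continuous_on S (\<lambda>x. - logN N (f x))"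
    by (intro continuous_intros continuous_on_compose2[OF continuous_log assms]) auto
  then have "continuous_on S (\<lambda>x. expo N (- logN N (f x)))"
    by (rule continuous_on_compose2[OF continuous_expo]) auto
  then show ?thesis by (simp flip: inv_expo)
qed

lemma continuous_\<Psi>: "continuous_on UNIV \<Psi>"
  unfolding \<Psi>_def split_beta
  by (intro continuous_intros continuous_mult continuous_on_compose2[OF continuous_\<xi>]) auto

lemma continuous_proj: "continuous_on UNIV proj"
  unfolding proj_def split_beta
  by (intro continuous_intros continuous_mult continuous_inv continuous_on_compose2[OF continuous_\<xi>]) auto

lemma measurable_proj [measurable]: "proj \<in> borel_measurable borel"
  by (rule borel_measurable_continuous_onI[OF continuous_proj])

lemma measurable_right_mult [measurable]: "(\<lambda>n. n \<otimes>\<^bsub>N\<^esub> m) \<in> borel_measurable borel"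
  by (rule borel_measurable_continuous_onI) (intro continuous_mult continuous_intros)

lemma sets_product: "sets (haar_N N \<Otimes>\<^sub>M (lborel :: real measure)) = sets borel"
proof -
  have "sets (haar_N N \<Otimes>\<^sub>M (lborel :: real measure)) = sets (borel \<Otimes>\<^sub>M borel)"
    by (rule sets_pair_measure_cong) simp_all
  then show ?thesis unfolding borel_prod .
qed

lemma carrier_borel: "carrier (GA N) \<in> sets borel"
proof -
  have "carrier (GA N) = snd -` {0<..}" by auto
  then show ?thesis by (auto intro!: borel_open open_vimage_snd)
qed

lemma sets_right_haar: "sets (right_haar_G N) = sets (restrict_space borel (carrier (GA N)))"
  unfolding right_haar_G_def sets_density by (rule sets_restrict_space_cong) (rule sets_product)

lemma \<mu>_eq: "\<mu> = density (right_haar_G N) (\<lambda>x. ennreal (\<phi> x))"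
  using density_\<mu> by (simp add: flow_measure_density_def)

lemma sets_\<mu>_eq: "sets \<mu> = sets (restrict_space borel (carrier (GA N)))"
  by (simp add: \<mu>_eq sets_right_haar)

lemma sets_\<mu>_iff: "A \<in> sets \<mu> \<longleftrightarrow> A \<in> sets borel \<and> A \<subseteq> carrier (GA N)"
  using carrier_borel by (auto simp: sets_\<mu>_eq sets_restrict_space_iff)

lemma space_\<mu>: "space \<mu> = carrier (GA N)"
  using sets_eq_imp_space_eq[OF sets_\<mu>_eq] by (simp add: space_restrict_space)

abbreviation \<nu> where "\<nu> \<equiv> slice_measure N \<phi>"

lemma sets_\<nu> [simp, measurable_cong]: "sets \<nu> = sets borel" and space_\<nu> [simp]: "space \<nu> = UNIV"
  by (simp_all add: slice_measure_def)

text \<open>The density is constrained on \<open>carrier (GA N)\<close> only; cutting it off there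
  gives a Borel function on the whole product, to which Tonelli's theorem applies.\<close>

lemma measurable_\<phi>_extended: "(\<lambda>x. ennreal (\<phi> x) * indicator (carrier (GA N)) x) \<in> borel_measurable borel"
proof -
  have "\<phi> \<in> borel_measurable (right_haar_G N)"
    using density_\<mu> by (simp add: flow_measure_density_def)
  then have "\<phi> \<in> borel_measurable (restrict_space borel (carrier (GA N)))"
    by (subst measurable_cong_sets[OF sets_right_haar[symmetric] refl])
  then have "(\<lambda>x. ennreal (\<phi> x)) \<in> borel_measurable (restrict_space borel (carrier (GA N)))"
    by measurable
  then show ?thesis
    using carrier_borel by (subst (asm) borel_measurable_restrict_space_iff_ennreal) auto
qed

lemma measurable_slice [measurable]: "(\<lambda>n. (n, c)) \<in> borel_measurable (borel :: 'a measure)" for c :: real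
  by (rule borel_measurable_continuous_onI) (intro continuous_intros)

lemma measurable_\<phi>_1 [measurable]: "(\<lambda>n. ennreal (\<phi> (n, 1))) \<in> borel_measurable borel"
  using measurable_compose[OF measurable_slice[of 1] measurable_\<phi>_extended] by simp

text \<open>At each height, right invariance of the Haar measure removes the translation by
  \<open>\<xi> b\<close>, and flow invariance replaces \<open>\<phi>\<close> by its value at height
  \<open>1\<close>. The iterated form rests on sigma-finiteness of the Haar measure rather than of
  the slice measure.\<close>

lemma emeasure_\<mu>:
  assumes A: "A \<in> sets \<mu>"
  shows "emeasure \<mu> A = (\<integral>\<^sup>+ b. ennreal (1 / b) * emeasure \<nu> {n. \<Psi> (n, b) \<in> A} * indicator {0<..} b \<partial>lborel)"
proof -
  let ?C = "carrier (GA N)"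
  have AB [measurable]: "A \<in> sets borel" and AC: "A \<subseteq> ?C" using A by (auto simp: sets_\<mu>_iff)
  define F where "F x = ennreal (1 / snd x) * (ennreal (\<phi> x) * indicator ?C x) * indicator A x" for x
  have [measurable]: "(snd :: 'a \<times> real \<Rightarrow> real) \<in> borel_measurable borel"
    by (rule borel_measurable_continuous_onI) (intro continuous_intros)
  have F_borel: "F \<in> borel_measurable borel"
    unfolding F_def using measurable_\<phi>_extended by measurable
  then have F_prod: "F \<in> borel_measurable (haar_N N \<Otimes>\<^sub>M lborel)"
    by (subst measurable_cong_sets[OF sets_product refl])
  have \<phi>_meas: "(\<lambda>x. ennreal (\<phi> x)) \<in> borel_measurable (right_haar_G N)"
    using density_\<mu> by (auto simp: flow_measure_density_def)
  have A': "A \<in> sets (right_haar_G N)" using A by (simp add: sets_\<mu>_eq sets_right_haar)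
  have "emeasure \<mu> A = (\<integral>\<^sup>+ x. ennreal (\<phi> x) * indicator A x \<partial>right_haar_G N)"
    unfolding \<mu>_eq by (rule emeasure_density[OF \<phi>_meas A'])
  also have "\<dots> = (\<integral>\<^sup>+ x. (case x of (n, a) \<Rightarrow> ennreal (1 / a)) * (ennreal (\<phi> x) * indicator A x)
      \<partial>restrict_space (haar_N N \<Otimes>\<^sub>M lborel) ?C)"
    unfolding right_haar_G_def
  proof (rule nn_integral_density)
    have "sets (restrict_space (haar_N N \<Otimes>\<^sub>M lborel) ?C) = sets (restrict_space borel ?C)"
      by (rule sets_restrict_space_cong) (rule sets_product)
    note cong = measurable_cong_sets[OF this refl]
    have "(\<lambda>x. ennreal (1 / snd x)) \<in> borel_measurable (restrict_space borel ?C)"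
      by (rule measurable_restrict_space1) measurable
    then show "(\<lambda>(n, a). ennreal (1 / a)) \<in> borel_measurable (restrict_space (haar_N N \<Otimes>\<^sub>M lborel) ?C)"
      unfolding cong split_beta .
    have "(\<lambda>x. ennreal (\<phi> x) * indicator A x) \<in> borel_measurable (right_haar_G N)"
      using \<phi>_meas A' by measurable
    then show "(\<lambda>x. ennreal (\<phi> x) * indicator A x) \<in> borel_measurable (restrict_space (haar_N N \<Otimes>\<^sub>M lborel) ?C)"
      unfolding right_haar_G_def by simp
  qed
  also have "\<dots> = (\<integral>\<^sup>+ x. F x \<partial>(haar_N N \<Otimes>\<^sub>M lborel))"
    using carrier_borel sets_product
    by (subst nn_integral_restrict_space)
       (auto simp: F_def split_beta space_pair_measure mult_ac intro!: nn_integral_cong)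
  also have "\<dots> = (\<integral>\<^sup>+ b. (\<integral>\<^sup>+ n. F (n, b) \<partial>haar_N N) \<partial>lborel)"
  proof -
    interpret h: sigma_finite_measure "haar_N N" by (rule sigma_finite_haar_N)
    interpret pair_sigma_finite "haar_N N" "lborel :: real measure" by standard
    show ?thesis using nn_integral_snd[OF F_prod] by simp
  qed
  also have "\<dots> = (\<integral>\<^sup>+ b. ennreal (1 / b) * emeasure \<nu> {n. \<Psi> (n, b) \<in> A} * indicator {0<..} b \<partial>lborel)"
  proof (rule nn_integral_cong)
    fix b :: real
    show "(\<integral>\<^sup>+ n. F (n, b) \<partial>haar_N N) = ennreal (1 / b) * emeasure \<nu> {n. \<Psi> (n, b) \<in> A} * indicator {0<..} b"
    proof (cases "0 < b")
      case True
      have [measurable]: "(\<lambda>n. F (n, b)) \<in> borel_measurable borel"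
        using measurable_compose[OF measurable_slice F_borel] .
      have "(\<lambda>n. \<Psi> (n, b)) \<in> borel_measurable borel"
        using measurable_compose[OF measurable_right_mult[of "\<xi> b"] measurable_slice[of b]] by (simp add: \<Psi>_def)
      from measurable_sets_borel[OF this AB] have S [measurable]: "{n. \<Psi> (n, b) \<in> A} \<in> sets borel"
        by (simp add: vimage_def)
      have "(\<integral>\<^sup>+ n. F (n, b) \<partial>haar_N N) = (\<integral>\<^sup>+ n. F (n \<otimes>\<^bsub>N\<^esub> \<xi> b, b) \<partial>haar_N N)"
        by (rule nn_integral_haar_N_right[OF stratified, symmetric]) measurable
      also have "\<dots> = (\<integral>\<^sup>+ n. ennreal (1 / b) * (ennreal (\<phi> (n, 1)) * indicator {n. \<Psi> (n, b) \<in> A} n) \<partial>haar_N N)"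
      proof (rule nn_integral_cong)
        fix n
        show "F (n \<otimes>\<^bsub>N\<^esub> \<xi> b, b) = ennreal (1 / b) * (ennreal (\<phi> (n, 1)) * indicator {n. \<Psi> (n, b) \<in> A} n)"
          using True \<phi>_\<Psi>[OF True, of n] by (simp add: F_def \<Psi>_def mult.assoc indicator_def)
      qed
      also have "\<dots> = ennreal (1 / b) * (\<integral>\<^sup>+ n. ennreal (\<phi> (n, 1)) * indicator {n. \<Psi> (n, b) \<in> A} n \<partial>haar_N N)"
        by (rule nn_integral_cmult) measurable
      also have "(\<integral>\<^sup>+ n. ennreal (\<phi> (n, 1)) * indicator {n. \<Psi> (n, b) \<in> A} n \<partial>haar_N N) = emeasure \<nu> {n. \<Psi> (n, b) \<in> A}"
        unfolding slice_measure_def using S by (subst emeasure_density) auto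
      finally show ?thesis using True by simp
    next
      case False
      then show ?thesis by (simp add: F_def)
    qed
  qed
  finally show ?thesis .
qed

lemma \<Psi>_image_sets:
  assumes "E \<in> sets borel" "I \<in> sets borel" "I \<subseteq> {0<..}"
  shows "\<Psi> ` (E \<times> I) \<in> sets \<mu>"
proof -
  have snd_meas: "(snd :: 'a \<times> real \<Rightarrow> real) \<in> borel_measurable borel"
    by (rule borel_measurable_continuous_onI) (intro continuous_intros)
  have "\<Psi> ` (E \<times> I) = (proj -` E) \<inter> (snd -` I)" by (auto simp: \<Psi>_image)
  moreover have "proj -` E \<in> sets borel" by (rule measurable_sets_borel[OF measurable_proj assms(1)])
  moreover have "(snd :: 'a \<times> real \<Rightarrow> real) -` I \<in> sets borel" by (rule measurable_sets_borel[OF snd_meas assms(2)])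
  ultimately show ?thesis using assms(3) by (auto simp: sets_\<mu>_iff)
qed

lemma emeasure_\<Psi>_box:
  assumes E: "E \<in> sets borel" and pq: "0 < p" "p < q"
  shows "emeasure \<mu> (\<Psi> ` (E \<times> {p<..<q})) = emeasure \<nu> E * ennreal (ln q - ln p)"
proof -
  have S: "\<Psi> ` (E \<times> {p<..<q}) \<in> sets \<mu>"
    using E pq by (intro \<Psi>_image_sets) auto
  have "{n. \<Psi> (n, b) \<in> \<Psi> ` (E \<times> {p<..<q})} = (if b \<in> {p<..<q} then E else {})" for b
    by (auto simp: \<Psi>_image)
  then have "emeasure \<mu> (\<Psi> ` (E \<times> {p<..<q})) = (\<integral>\<^sup>+ b. emeasure \<nu> E * (ennreal (1 / b) * indicator {p<..<q} b) \<partial>lborel)"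
    unfolding emeasure_\<mu>[OF S] using pq by (intro nn_integral_cong) (auto split: split_indicator simp: mult.commute)
  also have "\<dots> = emeasure \<nu> E * (\<integral>\<^sup>+ b. ennreal (1 / b) * indicator {p<..<q} b \<partial>lborel)"
    by (rule nn_integral_cmult) measurable
  finally show ?thesis using nn_integral_inverse_interval[OF pq] by simp
qed

text \<open>The exceptional set consists of a null set of \<open>N\<close> at all heights and of all
  of \<open>N\<close> at countably many heights; both contribute nothing to the iterated
  integral.\<close>

lemma AE_generic:
  assumes null: "Nn \<in> null_sets \<nu>" and H: "countable (H :: real set)"
  shows "AE x in \<mu>. \<exists>n b. x = \<Psi> (n, b) \<and> n \<notin> Nn \<and> 0 < b \<and> b \<notin> H"
proof (rule AE_I')
  define B where "B = \<Psi> ` (Nn \<times> {0<..}) \<union> \<Psi> ` (UNIV \<times> (H \<inter> {0<..}))"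
  have HB: "H \<in> sets borel" using H by (rule sets.countable[rotated]) auto
  have "Nn \<in> sets borel" using null by auto
  then have B: "B \<in> sets \<mu>"
    unfolding B_def using HB by (intro sets.Un \<Psi>_image_sets) auto
  have "emeasure \<mu> B = (\<integral>\<^sup>+ b. 0 \<partial>(lborel :: real measure))"
    unfolding emeasure_\<mu>[OF B]
  proof (rule nn_integral_cong_AE)
    have "H \<in> null_sets lborel" using H by (rule countable_imp_null_set_lborel)
    then have "AE b in lborel. b \<notin> H" by (rule AE_not_in)
    then show "AE b in lborel. ennreal (1 / b) * emeasure \<nu> {n. \<Psi> (n, b) \<in> B} * indicator {0<..} b = 0"
    proof eventually_elim
      case (elim b)
      show ?case
      proof (cases "0 < b")
        case True
        then have "{n. \<Psi> (n, b) \<in> B} = Nn" using elim by (auto simp: B_def \<Psi>_image)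
        then show ?thesis using null_setsD1[OF null] by simp
      qed simp
    qed
  qed
  then show "B \<in> null_sets \<mu>" using B by auto
  show "{x \<in> space \<mu>. \<not> (\<exists>n b. x = \<Psi> (n, b) \<and> n \<notin> Nn \<and> 0 < b \<and> b \<notin> H)} \<subseteq> B"
  proof
    fix x assume "x \<in> {x \<in> space \<mu>. \<not> (\<exists>n b. x = \<Psi> (n, b) \<and> n \<notin> Nn \<and> 0 < b \<and> b \<notin> H)}"
    then have "0 < snd x" "\<not> (proj x \<notin> Nn \<and> snd x \<notin> H)"
      by (auto simp: space_\<mu> \<Psi>_proj_iff)
    then show "x \<in> B" by (auto simp: B_def \<Psi>_image)
  qed
qed

end

section \<open>The cylinders as a dyadic system\<close>

locale christ_setting = flow_setting N Z \<mu> \<phi>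
  for N :: "('a::{second_countable_topology, t2_space}, real ^ 'n::{finite, wellorder}) strat"
    and Z :: "(real ^ 'n::{finite, wellorder}) \<times> real" and \<mu> :: "('a \<times> real) measure" and \<phi> :: "'a \<times> real \<Rightarrow> real" +
  fixes Q :: "int \<Rightarrow> 'a set set" and \<delta> C1 c \<gamma> \<Lambda> r0 :: real and k0 :: int and Q0 :: "'a set"
  assumes doubling_\<nu>: "doubling (d_N N) (slice_measure N \<phi>)"
    and christ: "christ_decomposition (d_N N) (slice_measure N \<phi>) Q \<delta> C1 c"
    and \<gamma>_ge: "5 \<le> \<gamma>" and \<Lambda>_gt: "exp 3 / \<delta> < \<Lambda>"
    and start: "large_admissible Q \<delta> \<gamma> \<Lambda> (r0, k0, Q0, 1)"
begin

abbreviation ball_N where "ball_N \<equiv> dball (d_N N) UNIV"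
abbreviation cyl where "cyl \<equiv> cyl_set N Z"

lemma constants: "0 < \<delta>" "\<delta> < 1" "0 < C1" "0 < c"
  using christ by (auto simp: christ_decomposition_def)

lemma open_Q: "E \<in> Q k \<Longrightarrow> open E"
  using christ by (auto simp: christ_decomposition_def)

lemma cube_center:
  assumes "E \<in> Q k"
  obtains x where "x \<in> E" "ball_N x (c * \<delta> powi k) \<subseteq> E" "E \<subseteq> ball_N x (C1 * \<delta> powi k)"
proof -
  have "\<forall>k. \<forall>E\<in>Q k. \<exists>x\<in>E. dball (d_N N) (space \<nu>) x (c * \<delta> powi k) \<subseteq> E \<and>
                            E \<subseteq> dball (d_N N) (space \<nu>) x (C1 * \<delta> powi k)"
    using christ unfolding christ_decomposition_def by (elim conjE)
  then show ?thesis using assms that unfolding space_\<nu> by meson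
qed

sublocale cylinder_system Q \<delta> \<gamma> \<Lambda> r0 k0 Q0
proof
  show "0 < \<delta>" "\<delta> < 1" by (rule constants)+
  show "5 \<le> \<gamma>" "exp 3 / \<delta> < \<Lambda>" "large_admissible Q \<delta> \<gamma> \<Lambda> (r0, k0, Q0, 1)"
    by (fact \<gamma>_ge \<Lambda>_gt start)+
  show "disjoint (Q k)" "countable (Q k)" for k
    using christ by (auto simp: christ_decomposition_def)
  show "E \<noteq> {}" if "E \<in> Q k" for E k
    using cube_center[OF that] by blast
  show "\<exists>!R. R \<in> Q (k - 1) \<and> E \<subseteq> R" if "E \<in> Q k" for E k
  proof -
    have "\<forall>k. \<forall>E\<in>Q k. \<exists>!R. R \<in> Q (k - 1) \<and> E \<subseteq> R"
      using christ unfolding christ_decomposition_def by (elim conjE)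
    with that show ?thesis by blast
  qed
  show "finite (cube_sons Q k E)" if "E \<in> Q k" for E k
  proof -
    have "\<forall>k. \<forall>E\<in>Q k. finite (cube_sons Q k E) \<and> real (card (cube_sons Q k E)) \<le> C1"
      using christ unfolding christ_decomposition_def by (elim conjE)
    with that show ?thesis by blast
  qed
qed

lemma parent_measure:
  assumes "E \<in> Q k"
  shows "emeasure \<nu> (cube_parent Q k E) \<le> ennreal C1 * emeasure \<nu> E"
proof -
  have "\<forall>k. \<forall>E\<in>Q k. emeasure \<nu> (cube_parent Q k E) \<le> ennreal C1 * emeasure \<nu> E"
    using christ unfolding christ_decomposition_def by (elim conjE)
  with assms show ?thesis by blast
qed

lemma null_complement: "{n. \<exists>k. n \<notin> \<Union>(Q k)} \<in> null_sets \<nu>"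
proof -
  have null: "\<forall>k. emeasure \<nu> (space \<nu> - \<Union>(Q k)) = 0"
    using christ unfolding christ_decomposition_def by (elim conjE)
  have "UNIV - \<Union>(Q k) \<in> null_sets \<nu>" for k
  proof (rule null_setsI)
    show "emeasure \<nu> (UNIV - \<Union>(Q k)) = 0" using null by simp
    have "open (\<Union>(Q k))" by (intro open_Union ballI open_Q)
    then have "UNIV - \<Union>(Q k) \<in> sets borel" by (intro sets.Diff borel_open) auto
    then show "UNIV - \<Union>(Q k) \<in> sets \<nu>" by simp
  qed
  then have "(\<Union>k. UNIV - \<Union>(Q k)) \<in> null_sets \<nu>" by (rule null_sets_UN)
  moreover have "(\<Union>k. UNIV - \<Union>(Q k)) = {n. \<exists>k. n \<notin> \<Union>(Q k)}" by auto
  ultimately show ?thesis by simp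
qed

text \<open>Measurability of balls follows from positivity of their measure, because
  \<open>emeasure\<close> is \<open>0\<close> on non-measurable sets.\<close>

lemma dball_measure:
  assumes "0 < r"
  shows "0 < emeasure \<nu> (ball_N x r)" "emeasure \<nu> (ball_N x r) < \<infinity>"
    "ball_N x r \<in> sets borel"
proof -
  show pos: "0 < emeasure \<nu> (ball_N x r)" and "emeasure \<nu> (ball_N x r) < \<infinity>"
    using doubling_\<nu> assms by (auto simp: doubling_def)
  from pos show "ball_N x r \<in> sets borel"
    using emeasure_notin_sets[of "ball_N x r" \<nu>] by fastforce
qed

lemma borel_Q: "E \<in> Q k \<Longrightarrow> E \<in> sets borel"
  using open_Q by auto

lemma measure_Q:
  assumes "E \<in> Q k"
  shows "0 < emeasure \<nu> E" "emeasure \<nu> E < \<infinity>"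
proof -
  obtain x where "x \<in> E" and x: "ball_N x (c * \<delta> powi k) \<subseteq> E" "E \<subseteq> ball_N x (C1 * \<delta> powi k)"
    by (rule cube_center[OF assms])
  have pos: "0 < c * \<delta> powi k" "0 < C1 * \<delta> powi k" using constants by auto
  have "emeasure \<nu> (ball_N x (c * \<delta> powi k)) \<le> emeasure \<nu> E"
    by (rule emeasure_mono[OF x(1)]) (use borel_Q[OF assms] in simp)
  with dball_measure(1)[OF pos(1)] show "0 < emeasure \<nu> E" by (rule less_le_trans)
  have "emeasure \<nu> E \<le> emeasure \<nu> (ball_N x (C1 * \<delta> powi k))"
    by (rule emeasure_mono[OF x(2)]) (use dball_measure(3)[OF pos(2)] in simp)
  from this dball_measure(2)[OF pos(2)] show "emeasure \<nu> E < \<infinity>" by (rule le_less_trans)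
qed

lemma cyl_facts:
  assumes "adm L"
  shows "cyl L = \<Psi> ` strip L" "cyl L \<in> sets \<mu>" "open (cyl L)"
    "emeasure \<mu> (cyl L) = emeasure \<nu> (base L) * ennreal (2 * log_height L)"
    "\<exists>k. base L \<in> Q k" "0 < log_height L"
proof -
  obtain r k E a where L: "L = (r, k, E, a)" by (cases L)
  have E: "E \<in> Q k" "0 < a" "1 < r" using admD assms unfolding L by auto
  have pq: "0 < a / r" "a / r < a * r" using adm_order[of r k E a] assms unfolding L by auto
  show eq: "cyl L = \<Psi> ` strip L" unfolding L using E by (intro cyl_set_eq) auto
  show "cyl L \<in> sets \<mu>"
    unfolding eq unfolding L strip.simps using borel_Q[OF E(1)] pq by (intro \<Psi>_image_sets) auto
  have "\<Psi> ` strip L = proj -` E \<inter> snd -` {a / r<..<a * r}"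
    by (auto simp: L strip.simps \<Psi>_image)
  moreover have "open (proj -` E)"
    using continuous_proj open_Q[OF E(1)] by (simp add: continuous_on_open_vimage)
  ultimately show "open (cyl L)" unfolding eq by (simp add: open_Int open_vimage_snd)
  have "ln (a * r) - ln (a / r) = 2 * ln r" using E by (simp add: ln_mult ln_div)
  then show "emeasure \<mu> (cyl L) = emeasure \<nu> (base L) * ennreal (2 * log_height L)"
    unfolding eq unfolding L strip.simps using emeasure_\<Psi>_box[OF borel_Q[OF E(1)] pq] by simp
  show "\<exists>k. base L \<in> Q k" "0 < log_height L" using E by (auto simp: L)
qed

definition D_sets :: "int \<Rightarrow> ('a \<times> real) set set"
  where "D_sets j = cyl ` DL j"

lemma D_sets_cases:
  assumes "S \<in> D_sets j"
  obtains L where "L \<in> DL j" "adm L" "S = cyl L"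
  using assms adm_DL by (auto simp: D_sets_def)

lemma \<Psi>_subset_iff: "\<Psi> ` S \<subseteq> \<Psi> ` T \<longleftrightarrow> S \<subseteq> T"
  using inj_\<Psi> by (rule inj_image_subset_iff)

lemma base_mono:
  assumes "adm L" "strip L \<subseteq> strip R"
  shows "base L \<subseteq> base R"
proof
  fix n assume n: "n \<in> base L"
  obtain r k E a where L: "L = (r, k, E, a)" by (cases L)
  obtain r' k' E' a' where R: "R = (r', k', E', a')" by (cases R)
  have "a / r < a" "a < a * r" using adm_order assms(1) unfolding L by blast+
  then have "(n, a) \<in> strip L" using n by (simp add: L strip.simps)
  then show "n \<in> base R" using assms(2) by (auto simp: R strip.simps)
qed

text \<open>A parent has at most three times the logarithmic height over the same base, or the same
  height over the parent cube, whence \<open>3\<close> and \<open>C1\<close>. \<open>C_ball\<close>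
  bounds the path lengths in large and in small cylinders, in units of
  \<open>ln r / 2\<close>.\<close>

definition C_parent :: real where "C_parent = max 3 C1"
definition C_ball :: real where "C_ball = 4 * (\<gamma> + 1) + 2 * C1 * \<Lambda> * (exp 1)\<^sup>2"

lemma C_ball_bounds: "4 * (\<gamma> + 1) \<le> C_ball" "4 * (\<gamma> + 1) + 2 * C1 * \<Lambda> \<le> C_ball" "4 + 2 * C1 * \<Lambda> * (exp 1)\<^sup>2 \<le> C_ball" "0 < C_ball"
proof -
  have p: "0 < C1 * \<Lambda>" using constants \<Lambda>_pos by simp
  have "1 \<le> (exp (1::real))\<^sup>2" by (simp add: one_le_power)
  then have "2 * (C1 * \<Lambda>) * 1 \<le> 2 * (C1 * \<Lambda>) * (exp 1)\<^sup>2" using p by (intro mult_left_mono) auto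
  then show "4 * (\<gamma> + 1) \<le> C_ball" "4 * (\<gamma> + 1) + 2 * C1 * \<Lambda> \<le> C_ball"
    "4 + 2 * C1 * \<Lambda> * (exp 1)\<^sup>2 \<le> C_ball" "0 < C_ball"
    using p \<gamma>_ge by (auto simp: C_ball_def mult.assoc)
qed

text \<open>A small cylinder is crossed at its own height \<open>a\<close>, where the upper
  inequality gives a cost proportional to \<open>ln r\<close>. A large one may be too wide for that
  and is crossed higher up.\<close>

lemma cyl_subset_ball:
  assumes adm: "adm (r, k, E, a)" and x: "E \<subseteq> ball_N x (C1 * \<delta> powi k)"
  shows "cyl (r, k, E, a) \<subseteq> dball (d_Z N Z) (space \<mu>) (\<Psi> (x, a)) (C_ball * (ln r / 2))"
proof
  have E: "E \<in> Q k" "0 < a" "1 < r" using admD[OF adm] by auto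
  have ar: "0 < a / r" using E by simp
  fix y assume "y \<in> cyl (r, k, E, a)"
  then have "y \<in> \<Psi> ` strip (r, k, E, a)" by (simp only: cyl_facts(1)[OF adm])
  then obtain n b where y: "y = \<Psi> (n, b)" "n \<in> E" "a / r < b" "b < a * r"
    by (auto simp: strip.simps)
  have b: "0 < b" using ar y(3) by linarith
  have lnr: "0 < ln r" using E by simp
  have "ln (a / r) < ln b" "ln b < ln (a * r)"
    using y(3,4) ar b by (metis ln_less_cancel_iff less_trans)+
  then have lnb: "\<bar>ln a - ln b\<bar> < ln r" using E by (simp add: ln_mult ln_div abs_less_iff)
  have dN: "d_N N x n < ennreal (C1 * \<delta> powi k)" using x y(2) by (auto simp: dball_def)
  have "d_G N (x, a) (n, b) < ennreal (C_ball * (ln r / 2))"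
  proof (cases "exp 1 < r")
    case True
    \<comment> \<open>At this height the upper inequality bounds the horizontal leg by
      \<open>C1 * \<Lambda>\<close>, a constant that \<open>ln r > 1\<close> absorbs, while the
      climb costs \<open>\<gamma> * ln r\<close>.\<close>
    define h where "h = a * r powr \<gamma>"
    have h: "0 < h" using E by (simp add: h_def)
    have lnh: "ln h = ln a + \<gamma> * ln r" using E by (simp add: h_def ln_mult ln_powr)
    have "\<delta> powi k \<le> \<Lambda> * h" using adm True by (auto simp: admissible_def h_def mult.assoc)
    then have \<rho>: "C1 * \<delta> powi k / h \<le> C1 * \<Lambda>" using h constants by (simp add: pos_divide_le_eq mult.assoc)
    have lnr1: "1 < ln r" using True E by (subst ln_exp[symmetric], subst ln_less_cancel_iff) auto
    have "\<bar>ln a - ln h\<bar> < (\<gamma> + 1) * ln r"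
      using lnr \<gamma>_ge by (simp add: lnh abs_less_iff distrib_right)
    moreover have "\<bar>ln h - ln b\<bar> < (\<gamma> + 1) * ln r"
    proof -
      have "0 \<le> \<gamma> * ln r" using lnr \<gamma>_ge by simp
      then show ?thesis using lnb unfolding lnh distrib_right by linarith
    qed
    ultimately have "d_G N (x, a) (n, b) < ennreal ((\<gamma> + 1) * ln r + C1 * \<delta> powi k / h + (\<gamma> + 1) * ln r)"
      using d_G_lessI[OF dN E(2) b h] by blast
    also have "\<dots> \<le> ennreal (C_ball * (ln r / 2))"
    proof (rule ennreal_leI)
      have "C1 * \<Lambda> * 1 \<le> C1 * \<Lambda> * ln r" using constants \<Lambda>_pos lnr1 by (intro mult_left_mono) auto
      then have "(\<gamma> + 1) * ln r + C1 * \<delta> powi k / h + (\<gamma> + 1) * ln r \<le> (4 * (\<gamma> + 1) + 2 * C1 * \<Lambda>) * (ln r / 2)"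
        using \<rho> by (simp add: algebra_simps)
      also have "\<dots> \<le> C_ball * (ln r / 2)" using C_ball_bounds(2) lnr by (intro mult_right_mono) auto
      finally show "(\<gamma> + 1) * ln r + C1 * \<delta> powi k / h + (\<gamma> + 1) * ln r \<le> C_ball * (ln r / 2)" .
    qed
    finally show ?thesis .
  next
    case False
    then have "\<delta> powi k \<le> \<Lambda> * a * (exp 1)\<^sup>2 * ln r" using adm by (auto simp: admissible_def)
    then have "C1 * \<delta> powi k \<le> C1 * (\<Lambda> * a * (exp 1)\<^sup>2 * ln r)" using constants by (intro mult_left_mono) auto
    also have "\<dots> = (C1 * \<Lambda> * (exp 1)\<^sup>2 * ln r) * a" by simp
    finally have \<rho>: "C1 * \<delta> powi k / a \<le> C1 * \<Lambda> * (exp 1)\<^sup>2 * ln r" using E by (simp add: pos_divide_le_eq)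
    have "d_G N (x, a) (n, b) < ennreal (ln r + C1 * \<delta> powi k / a + ln r)"
      using d_G_lessI[OF dN E(2) b E(2), of "ln r" "ln r"] lnb lnr by simp
    also have "\<dots> \<le> ennreal (C_ball * (ln r / 2))"
    proof (rule ennreal_leI)
      have "ln r + C1 * \<delta> powi k / a + ln r \<le> (4 + 2 * C1 * \<Lambda> * (exp 1)\<^sup>2) * (ln r / 2)"
        using \<rho> by (simp add: algebra_simps)
      also have "\<dots> \<le> C_ball * (ln r / 2)" using C_ball_bounds(3) lnr by (intro mult_right_mono) auto
      finally show "ln r + C1 * \<delta> powi k / a + ln r \<le> C_ball * (ln r / 2)" .
    qed
    finally show ?thesis .
  qed
  then show "y \<in> dball (d_Z N Z) (space \<mu>) (\<Psi> (x, a)) (C_ball * (ln r / 2))"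
    using b E(2) d_Z_\<Psi>[OF E(2) b] by (simp add: dball_def space_\<mu> y(1))
qed

text \<open>The left side bounds the displacement in \<open>N\<close> along a path of length
  \<open>ln r / 2\<close> ending in the cylinder, as its heights stay below
  \<open>a * r * exp (ln r / 2)\<close>. The lower inequalities for both types are tailored to
  this.\<close>

lemma admissible_enlargement:
  assumes adm: "adm (r, k, E, a)"
  shows "a * r * exp (ln r / 2) * (ln r / 2) \<le> \<delta> powi k"
proof -
  have E: "0 < a" "1 < r" using admD[OF adm] by auto
  have lnr: "0 < ln r" using E by simp
  have r_exp: "r = exp (ln r)" using E by simp
  show ?thesis
  proof (cases "exp 1 < r")
    case True
    have "ln r / 2 \<le> exp (ln r / 2)" using exp_ge_add_one_self[of "ln r / 2"] by linarith
    then have "exp (ln r / 2) * (ln r / 2) \<le> exp (ln r / 2) * exp (ln r / 2)" by (intro mult_left_mono) auto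
    also have "\<dots> = r" using E by (simp flip: exp_add)
    finally have "a * r * (exp (ln r / 2) * (ln r / 2)) \<le> a * r * r" using E by (intro mult_left_mono) auto
    also have "\<dots> = a * r\<^sup>2" by (simp add: power2_eq_square)
    also have "\<dots> \<le> \<delta> powi k" using adm True by (auto simp: admissible_def)
    finally show ?thesis by (simp add: mult.assoc)
  next
    case False
    then have le: "r \<le> exp 1" by simp
    then have "ln r \<le> ln (exp 1)" using E by (subst ln_le_cancel_iff) auto
    then have "exp (ln r / 2) \<le> exp 1" by simp
    then have "r * exp (ln r / 2) \<le> exp 1 * exp 1" using le E by (intro mult_mono) auto
    then have "r * exp (ln r / 2) * (ln r / 2) \<le> (exp 1)\<^sup>2 * ln r"
      using lnr by (intro mult_mono) (auto simp: power2_eq_square)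
    then have "a * (r * exp (ln r / 2) * (ln r / 2)) \<le> a * ((exp 1)\<^sup>2 * ln r)" using E by (intro mult_left_mono) auto
    also have "\<dots> \<le> \<delta> powi k" using adm False by (auto simp: admissible_def mult.assoc)
    finally show ?thesis by (simp add: mult.assoc)
  qed
qed

text \<open>A path of length \<open>ln r / 2\<close> widens the logarithmic half-height
  \<open>ln r\<close> to \<open>3 / 2 * ln r\<close> and moves the base by less than
  \<open>\<delta> powi k\<close>, hence the radius
  \<open>(C1 + 1) * \<delta> powi k\<close>.\<close>

lemma enlarge_subset:
  assumes adm: "adm (r, k, E, a)" and x: "E \<subseteq> ball_N x (C1 * \<delta> powi k)"
  shows "enlarge (d_Z N Z) (space \<mu>) (cyl (r, k, E, a)) (ln r / 2)
    \<subseteq> \<Psi> ` (ball_N x ((C1 + 1) * \<delta> powi k) \<times> {a * exp (- (3 / 2 * ln r))<..<a * exp (3 / 2 * ln r)})"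
proof
  have E: "E \<in> Q k" "0 < a" "1 < r" using admD[OF adm] by auto
  have ar: "0 < a / r" using E by simp
  have lnr: "0 < ln r" using E by simp
  fix x' assume "x' \<in> enlarge (d_Z N Z) (space \<mu>) (cyl (r, k, E, a)) (ln r / 2)"
  then obtain y where x': "0 < snd x'" and y: "y \<in> cyl (r, k, E, a)" "d_Z N Z x' y < ennreal (ln r / 2)"
    by (auto simp: enlarge_def space_\<mu> INF_less_iff)
  have "y \<in> \<Psi> ` strip (r, k, E, a)" using y(1) by (simp only: cyl_facts(1)[OF adm])
  then obtain n b where nb: "y = \<Psi> (n, b)" "n \<in> E" "a / r < b" "b < a * r"
    by (auto simp: strip.simps)
  define n' b' where "n' = proj x'" and "b' = snd x'"
  have x'_eq: "x' = \<Psi> (n', b')" by (simp add: n'_def b'_def)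
  have b: "0 < b" "0 < b'" using ar nb(3) x' by (auto simp: b'_def)
  have d: "d_G N (n', b') (n, b) < ennreal (ln r / 2)"
    using y(2) d_Z_\<Psi>[OF b(2,1)] by (simp add: x'_eq nb(1))
  have "ln (a / r) < ln b" "ln b < ln (a * r)"
    using nb(3,4) ar b by (metis ln_less_cancel_iff less_trans)+
  then have lnb: "ln a - ln r < ln b" "ln b < ln a + ln r" using E by (auto simp: ln_mult ln_div)
  have "b * exp (ln r / 2) * (ln r / 2) \<le> a * r * exp (ln r / 2) * (ln r / 2)"
    using nb(4) lnr by (intro mult_right_mono) auto
  also note admissible_enlargement[OF adm]
  finally have "d_N N n' n < ennreal (\<delta> powi k)"
    by (rule less_le_trans[OF d_G_lessD(2)[OF d] ennreal_leI])
  then have "d_N N n n' < ennreal (\<delta> powi k)" unfolding d_N_eq by (rule cc_dist_less_sym)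
  moreover have "d_N N x n < ennreal (C1 * \<delta> powi k)" using x nb(2) by (auto simp: dball_def)
  ultimately have "d_N N x n' < ennreal (C1 * \<delta> powi k + \<delta> powi k)"
    unfolding d_N_eq by (intro cc_dist_less_trans)
  then have "n' \<in> ball_N x ((C1 + 1) * \<delta> powi k)" by (simp add: dball_def distrib_right)
  moreover have "a * exp (- (3 / 2 * ln r)) < b'" "b' < a * exp (3 / 2 * ln r)"
  proof -
    have l: "\<bar>ln b' - ln b\<bar> < ln r / 2" by (rule d_G_lessD(1)[OF d])
    have "exp (ln a - 3 / 2 * ln r) < exp (ln b')" "exp (ln b') < exp (ln a + 3 / 2 * ln r)"
      unfolding exp_less_cancel_iff using l lnb by linarith+
    then show "a * exp (- (3 / 2 * ln r)) < b'" "b' < a * exp (3 / 2 * ln r)"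
      by (simp_all only: diff_conv_add_uminus exp_add exp_ln[OF E(2)] exp_ln[OF b(2)])
  qed
  ultimately show "x' \<in> \<Psi> ` (ball_N x ((C1 + 1) * \<delta> powi k) \<times> {a * exp (- (3 / 2 * ln r))<..<a * exp (3 / 2 * ln r)})"
    unfolding x'_eq by auto
qed

lemma enlarge_measure:
  "\<exists>B\<ge>0. \<forall>r k E a. adm (r, k, E, a) \<longrightarrow>
     outer_measure_of \<mu> (enlarge (d_Z N Z) (space \<mu>) (cyl (r, k, E, a)) (ln r / 2))
       \<le> ennreal B * emeasure \<mu> (cyl (r, k, E, a))"
proof -
  \<comment> \<open>The ratio between the radius of the enlarged base and that of the ball inside
    the cube; the summand \<open>1\<close> makes it exceed \<open>1\<close>.\<close>
  define K where "K = (C1 + 1) / c + 1"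
  have K: "1 < K" using constants by (simp add: K_def)
  obtain B where B: "1 < B" "\<And>x r. 0 < r \<Longrightarrow>
      emeasure \<nu> (ball_N x (K * r)) \<le> ennreal B * emeasure \<nu> (ball_N x r)"
  proof -
    have "\<forall>C>1. \<exists>D>1. \<forall>x\<in>space \<nu>. \<forall>r>0.
        emeasure \<nu> (dball (d_N N) (space \<nu>) x (C * r)) \<le> ennreal D * emeasure \<nu> (dball (d_N N) (space \<nu>) x r)"
      using doubling_\<nu> unfolding doubling_def by (elim conjE)
    then show ?thesis using that K unfolding space_\<nu> by (metis UNIV_I)
  qed
  \<comment> \<open>Doubling contributes \<open>B\<close>, and the quotient of the logarithmic
    lengths \<open>3 * ln r\<close> and \<open>2 * ln r\<close> contributes
    \<open>3 / 2\<close>.\<close>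
  have "outer_measure_of \<mu> (enlarge (d_Z N Z) (space \<mu>) (cyl (r, k, E, a)) (ln r / 2))
       \<le> ennreal (3 / 2 * B) * emeasure \<mu> (cyl (r, k, E, a))" if adm: "adm (r, k, E, a)" for r k E a
  proof -
    have E: "E \<in> Q k" "0 < a" "1 < r" using admD[OF adm] by auto
    obtain x where "x \<in> E" and x: "ball_N x (c * \<delta> powi k) \<subseteq> E" "E \<subseteq> ball_N x (C1 * \<delta> powi k)"
      by (rule cube_center[OF E(1)])
    have w: "0 < \<delta> powi k" by simp
    let ?Bx = "ball_N x ((C1 + 1) * \<delta> powi k)"
    let ?p = "a * exp (- (3 / 2 * ln r))" and ?q = "a * exp (3 / 2 * ln r)"
    have Bx: "?Bx \<in> sets borel" by (rule dball_measure(3)) (use constants in simp)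
    have "- (3 / 2 * ln r) < 3 / 2 * ln r" using E by simp
    then have pq: "0 < ?p" "?p < ?q" using E by auto
    have "ln ?q - ln ?p = 3 * ln r" using E by (simp add: ln_mult)
    then have box: "emeasure \<mu> (\<Psi> ` (?Bx \<times> {?p<..<?q})) = emeasure \<nu> ?Bx * ennreal (3 * ln r)"
      using emeasure_\<Psi>_box[OF Bx pq] by simp
    have "(C1 + 1) * \<delta> powi k \<le> K * (c * \<delta> powi k)"
      using constants w by (simp add: K_def field_simps)
    then have "?Bx \<subseteq> ball_N x (K * (c * \<delta> powi k))" by (rule dball_mono)
    then have "emeasure \<nu> ?Bx \<le> emeasure \<nu> (ball_N x (K * (c * \<delta> powi k)))"
      using dball_measure(3)[of "K * (c * \<delta> powi k)"] K constants by (intro emeasure_mono) auto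
    also have "\<dots> \<le> ennreal B * emeasure \<nu> (ball_N x (c * \<delta> powi k))"
      using constants by (intro B(2)) auto
    also have "\<dots> \<le> ennreal B * emeasure \<nu> E"
      using x(1) borel_Q[OF E(1)] by (intro mult_left_mono emeasure_mono) auto
    finally have \<nu>_le: "emeasure \<nu> ?Bx \<le> ennreal B * emeasure \<nu> E" .
    have S: "\<Psi> ` (?Bx \<times> {?p<..<?q}) \<in> sets \<mu>" using Bx pq by (intro \<Psi>_image_sets) auto
    have "outer_measure_of \<mu> (enlarge (d_Z N Z) (space \<mu>) (cyl (r, k, E, a)) (ln r / 2))
        \<le> outer_measure_of \<mu> (\<Psi> ` (?Bx \<times> {?p<..<?q}))"
      by (rule outer_measure_of_mono[OF enlarge_subset[OF adm x(2)]])
    also have "\<dots> = emeasure \<nu> ?Bx * ennreal (3 * ln r)" using S box by simp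
    also have "\<dots> \<le> ennreal B * emeasure \<nu> E * ennreal (3 * ln r)"
      using \<nu>_le by (intro mult_right_mono) auto
    also have "\<dots> = ennreal (3 / 2 * B) * (emeasure \<nu> E * ennreal (2 * ln r))"
    proof -
      have "ennreal B * ennreal (3 * ln r) = ennreal (3 / 2 * B) * ennreal (2 * ln r)"
        using B(1) E by (simp flip: ennreal_mult')
      then show ?thesis by (metis mult.assoc mult.commute)
    qed
    also have "\<dots> = ennreal (3 / 2 * B) * emeasure \<mu> (cyl (r, k, E, a))"
      using cyl_facts(4)[OF adm] by simp
    finally show ?thesis .
  qed
  then show ?thesis using B(1) by (intro exI[of _ "3 / 2 * B"]) auto
qed

lemma child_measure:
  assumes "adm L" "adm R" "child L R"
  shows "emeasure \<mu> (cyl R) \<le> ennreal C_parent * emeasure \<mu> (cyl L)"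
proof -
  note L = cyl_facts[OF assms(1)] and R = cyl_facts[OF assms(2)]
  have C: "0 < C_parent" "3 \<le> C_parent" "C1 \<le> C_parent" by (auto simp: C_parent_def)
  from assms(3) consider "base L = base R" "log_height R \<le> 3 * log_height L"
    | k where "log_height R = log_height L" "base L \<in> Q k" "base R = cube_parent Q k (base L)"
    by (auto simp: child_def)
  then show ?thesis
  proof cases
    case 1
    have "2 * log_height R \<le> C_parent * (2 * log_height L)"
    proof -
      have "3 * (2 * log_height L) \<le> C_parent * (2 * log_height L)"
        by (rule mult_right_mono[OF C(2)]) (use L(6) in simp)
      then show ?thesis using 1(2) by linarith
    qed
    then have "ennreal (2 * log_height R) \<le> ennreal C_parent * ennreal (2 * log_height L)"
      using C(1) by (simp add: ennreal_leI flip: ennreal_mult')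
    then have "emeasure \<nu> (base R) * ennreal (2 * log_height R)
        \<le> emeasure \<nu> (base R) * (ennreal C_parent * ennreal (2 * log_height L))"
      by (intro mult_left_mono) auto
    then show ?thesis unfolding L(4) R(4) 1(1) by (simp add: mult_ac)
  next
    case 2
    have "emeasure \<nu> (base R) \<le> ennreal C1 * emeasure \<nu> (base L)"
      using parent_measure[OF 2(2)] 2(3) by simp
    also have "\<dots> \<le> ennreal C_parent * emeasure \<nu> (base L)"
      using C(3) by (intro mult_right_mono ennreal_leI) auto
    finally show ?thesis
      unfolding L(4) R(4) 2(1) by (simp add: mult_right_mono flip: mult.assoc)
  qed
qed

lemma AE_good: "AE x in \<mu>. \<exists>n b. x = \<Psi> (n, b) \<and> (\<forall>k. n \<in> \<Union>(Q k)) \<and> 0 < b \<and> b \<notin> critical_heights"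
  using AE_generic[OF null_complement countable_critical_heights] by (rule eventually_mono) auto

text \<open>\<open>fine_DL\<close> gives a cylinder with small \<open>\<delta> powi k\<close> and
  small \<open>ln r\<close>; \<open>dball_d_N_subset_open\<close> turns the small metric diameter of
  its cube into smallness in the topology of \<open>N\<close>.\<close>

lemma small_cylinder:
  assumes O: "open O'" "\<Psi> (n, b) \<in> O'" and n: "\<And>k. n \<in> \<Union>(Q k)" and b: "0 < b" "b \<notin> critical_heights"
  shows "\<exists>j. \<exists>S\<in>D_sets j. \<Psi> (n, b) \<in> S \<and> S \<subseteq> O'"
proof -
  have "open (\<Psi> -` O')" using continuous_\<Psi> O(1) by (simp add: continuous_on_open_vimage)
  moreover have "(n, b) \<in> \<Psi> -` O'" using O(2) by simp
  ultimately obtain A1 A2 where A: "open A1" "open A2" "n \<in> A1" "b \<in> A2" "A1 \<times> A2 \<subseteq> \<Psi> -` O'"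
    by (elim open_prod_elim) auto
  obtain \<epsilon>1 where \<epsilon>1: "0 < \<epsilon>1" "ball_N n \<epsilon>1 \<subseteq> A1"
    using dball_d_N_subset_open[OF A(1,3)] by blast
  obtain \<epsilon>2 where \<epsilon>2: "0 < \<epsilon>2" "ball b \<epsilon>2 \<subseteq> A2" using A(2,4) openE by blast
  \<comment> \<open>The first bound keeps the diameter bound \<open>2 * C1 * \<delta> powi k\<close>
    of the cube below \<open>\<epsilon>1\<close>. The second gives
    \<open>r\<^sup>2 < 1 + \<epsilon>2 / b\<close>, and two heights in the cylinder differ by a
    factor below \<open>r\<^sup>2\<close>.\<close>
  define \<epsilon> where "\<epsilon> = min (\<epsilon>1 / (2 * C1)) (ln (1 + \<epsilon>2 / b) / 2)"
  have q1: "1 < 1 + \<epsilon>2 / b" using \<epsilon>2(1) b(1) by simp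
  have \<epsilon>: "0 < \<epsilon>" using \<epsilon>1(1) constants q1 by (simp add: \<epsilon>_def)
  obtain j r k E a where L: "(r, k, E, a) \<in> DL j" "(n, b) \<in> strip (r, k, E, a)" "\<delta> powi k < \<epsilon>" "ln r < \<epsilon>"
    using fine_DL[OF n b \<epsilon>] by blast
  have adm: "adm (r, k, E, a)" using adm_DL[OF L(1)] .
  have E: "E \<in> Q k" "0 < a" "1 < r" using admD[OF adm] by auto
  have nb: "n \<in> E" "a / r < b" "b < a * r" using L(2) by (auto simp: strip.simps)
  have "strip (r, k, E, a) \<subseteq> A1 \<times> A2"
  proof
    fix y assume "y \<in> strip (r, k, E, a)"
    then obtain n' b' where y: "y = (n', b')" "n' \<in> E" "a / r < b'" "b' < a * r" by (auto simp: strip.simps)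
    obtain x where "x \<in> E" "ball_N x (c * \<delta> powi k) \<subseteq> E" and x: "E \<subseteq> ball_N x (C1 * \<delta> powi k)" by (rule cube_center[OF E(1)])
    have "d_N N x n < ennreal (C1 * \<delta> powi k)" "d_N N x n' < ennreal (C1 * \<delta> powi k)"
      using x nb(1) y(2) by (auto simp: dball_def)
    then have "d_N N n n' < ennreal (C1 * \<delta> powi k + C1 * \<delta> powi k)"
      unfolding d_N_eq by (intro cc_dist_less_trans[of _ _ _ n x]) (auto intro: cc_dist_less_sym)
    also have "\<dots> \<le> ennreal \<epsilon>1"
    proof (rule ennreal_leI)
      have "\<delta> powi k \<le> \<epsilon>1 / (2 * C1)" using L(3) by (simp add: \<epsilon>_def)
      then show "C1 * \<delta> powi k + C1 * \<delta> powi k \<le> \<epsilon>1" using constants by (simp add: pos_le_divide_eq mult_ac)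
    qed
    finally have n': "n' \<in> A1" using \<epsilon>1(2) by (auto simp: dball_def)
    have r2: "r\<^sup>2 < 1 + \<epsilon>2 / b"
    proof -
      have "2 * ln r < ln (1 + \<epsilon>2 / b)" using L(4) by (simp add: \<epsilon>_def)
      then have "ln (r\<^sup>2) < ln (1 + \<epsilon>2 / b)" using E by (simp add: ln_realpow)
      then show ?thesis using E q1 by (subst (asm) ln_less_cancel_iff) auto
    qed
    have up: "v < u * r\<^sup>2" if "a / r < u" "v < a * r" for u v
    proof -
      have "a < u * r" using that(1) E by (simp add: pos_divide_less_eq)
      then have "a * r < u * r * r" using E by simp
      then show ?thesis using that(2) by (simp add: power2_eq_square)
    qed
    have "b * r\<^sup>2 < b * (1 + \<epsilon>2 / b)" using r2 b(1) by (rule mult_strict_left_mono)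
    then have br: "b * r\<^sup>2 < b + \<epsilon>2" using b(1) by (simp add: distrib_left)
    have "b' < b + \<epsilon>2" using up[OF nb(2) y(4)] br by linarith
    moreover have "b - \<epsilon>2 < b'"
    proof (rule ccontr)
      assume "\<not> ?thesis"
      then have le: "b' \<le> b - \<epsilon>2" by simp
      have b'0: "0 < b'" using y(3) E by (meson divide_pos_pos less_trans zero_less_one)
      have "b < b' * r\<^sup>2" by (rule up[OF y(3) nb(3)])
      also have "\<dots> = b' + b' * (r\<^sup>2 - 1)" by (simp add: algebra_simps)
      also have "b' * (r\<^sup>2 - 1) \<le> b * (r\<^sup>2 - 1)"
        using le \<epsilon>2(1) E by (intro mult_right_mono) auto
      also have "b * (r\<^sup>2 - 1) = b * r\<^sup>2 - b" by (simp add: algebra_simps)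
      finally show False using br le by linarith
    qed
    ultimately have "b' \<in> ball b \<epsilon>2" by (simp add: dist_real_def abs_less_iff)
    then show "y \<in> A1 \<times> A2" using n' \<epsilon>2(2) y(1) by auto
  qed
  then have "cyl (r, k, E, a) \<subseteq> O'" unfolding cyl_facts(1)[OF adm] using A(5) by blast
  moreover have "\<Psi> (n, b) \<in> cyl (r, k, E, a)" unfolding cyl_facts(1)[OF adm] using L(2) by blast
  moreover have "cyl (r, k, E, a) \<in> D_sets j" unfolding D_sets_def using L(1) by (rule imageI)
  ultimately show ?thesis by blast
qed

text \<open>Outer regularity of finite Borel measures is invoked on the vector space, to which the
  chart \<open>T\<close> carries the restriction of \<open>\<mu>\<close> to \<open>S0\<close>;
  finiteness is the reason for restricting.\<close>

lemma outer_approximation: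
  assumes S0: "S0 \<in> sets \<mu>" "emeasure \<mu> S0 < \<infinity>" and A: "A \<in> sets \<mu>" "A \<subseteq> S0" and \<eta>: "0 < \<eta>"
  shows "\<exists>O'. open O' \<and> A \<subseteq> O' \<and> emeasure \<mu> (O' \<inter> S0) \<le> emeasure \<mu> A + ennreal \<eta>"
proof -
  define T where "T = (\<lambda>(n, b). (logN N n, b :: real))"
  define T' where "T' = (\<lambda>(X, b). (expo N X, b :: real))"
  have T: "continuous_on UNIV T" and T': "continuous_on UNIV T'"
    unfolding T_def T'_def split_beta
    by (intro continuous_intros continuous_on_compose2[OF continuous_log] continuous_on_compose2[OF continuous_expo]; auto)+
  have TT': "T (T' v) = v" "T' (T x) = x" for v x by (simp_all add: T_def T'_def split_beta)
  define M where "M = distr (density \<mu> (indicator S0)) borel T"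
  have T_borel: "T \<in> borel_measurable borel" and T'_borel: "T' \<in> borel_measurable borel"
    using T T' by (auto intro: borel_measurable_continuous_onI)
  have T_\<mu>: "T \<in> borel_measurable (density \<mu> (indicator S0))"
    using measurable_restrict_space1[OF T_borel] by (simp add: measurable_cong_sets[OF sets_\<mu>_eq refl])
  have M_eq: "emeasure M U = emeasure \<mu> (T -` U \<inter> S0)" if "U \<in> sets borel" for U
  proof -
    have S: "T -` U \<inter> space \<mu> \<in> sets \<mu>"
      using measurable_sets[OF T_\<mu> that] by simp
    have "emeasure M U = emeasure (density \<mu> (indicator S0)) (T -` U \<inter> space \<mu>)"
      unfolding M_def using that T_\<mu> by (simp add: emeasure_distr)
    also have "\<dots> = (\<integral>\<^sup>+ x. indicator (T -` U \<inter> S0) x \<partial>\<mu>)"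
      using S S0 by (subst emeasure_density) (auto intro!: nn_integral_cong split: split_indicator)
    also have "\<dots> = emeasure \<mu> (T -` U \<inter> S0)"
    proof -
      have "T -` U \<inter> S0 = (T -` U \<inter> space \<mu>) \<inter> S0" using sets.sets_into_space[OF S0(1)] by auto
      then show ?thesis using S S0 by (metis nn_integral_indicator sets.Int)
    qed
    finally show ?thesis .
  qed
  have "emeasure M (space M) \<noteq> \<infinity>"
    using M_eq[of UNIV] S0(2) by (simp add: M_def)
  moreover have "T' -` A \<in> sets borel"
    using measurable_sets_borel[OF T'_borel] A by (auto simp: sets_\<mu>_iff)
  ultimately have INF: "emeasure M (T' -` A) = (INF U\<in>{U. T' -` A \<subseteq> U \<and> open U}. emeasure M U)"
    by (intro outer_regular) (auto simp: M_def)
  have "x \<in> T -` (T' -` A) \<inter> S0 \<longleftrightarrow> x \<in> A" for x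
    unfolding vimage_eq Int_iff TT' using A(2) by blast
  then have "T -` (T' -` A) \<inter> S0 = A" by blast
  then have MA: "emeasure M (T' -` A) = emeasure \<mu> A" using M_eq[OF \<open>T' -` A \<in> sets borel\<close>] by simp
  have "emeasure \<mu> A < \<infinity>" using emeasure_mono[OF A(2) S0(1)] S0(2) by (rule le_less_trans)
  then obtain m where "emeasure \<mu> A = ennreal m" "0 \<le> m" by (cases "emeasure \<mu> A") auto
  then have "emeasure \<mu> A < emeasure \<mu> A + ennreal \<eta>"
    using \<eta> by (simp add: ennreal_lessI flip: ennreal_plus)
  then have "(INF U\<in>{U. T' -` A \<subseteq> U \<and> open U}. emeasure M U) < emeasure \<mu> A + ennreal \<eta>"
    using INF MA by simp
  then obtain U where U: "T' -` A \<subseteq> U" "open U" "emeasure M U < emeasure \<mu> A + ennreal \<eta>"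
    by (auto simp: INF_less_iff)
  have "open (T -` U)" using T U(2) by (simp add: continuous_on_open_vimage)
  moreover have "A \<subseteq> T -` U"
  proof
    fix x assume "x \<in> A"
    then have "T x \<in> T' -` A" by (simp only: vimage_eq TT'(2))
    then have "T x \<in> U" using U(1) by blast
    then show "x \<in> T -` U" by (simp only: vimage_eq)
  qed
  ultimately show ?thesis using M_eq[of U] U(2,3) by (intro exI[of _ "T -` U"]) auto
qed

text \<open>The base of an ancestor contains that of \<open>L\<close>, so its measure is bounded
  below, and the unbounded logarithmic height alone makes the product large.\<close>

lemma large_ancestors:
  assumes "L \<in> DL j"
  shows "\<exists>i0\<le>j. \<forall>i\<le>i0. \<forall>R\<in>DL i. strip L \<subseteq> strip R \<longrightarrow> ennreal K < emeasure \<mu> (cyl R)"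
proof -
  obtain k where k: "base L \<in> Q k" using cyl_facts(5)[OF adm_DL[OF assms]] by blast
  define v where "v = enn2real (emeasure \<nu> (base L))"
  have v: "emeasure \<nu> (base L) = ennreal v" "0 < v"
    using measure_Q[OF k] by (auto simp: v_def enn2real_positive_iff)
  define B where "B = max 0 (K / (2 * v))"
  obtain i0 where i0: "i0 \<le> j" "\<And>i R. i \<le> i0 \<Longrightarrow> R \<in> DL i \<Longrightarrow> strip L \<subseteq> strip R \<Longrightarrow> B < log_height R"
    using ancestors_tall[OF assms, of B] by meson
  show ?thesis
  proof (intro exI[of _ i0] conjI allI impI ballI)
    fix i R assume R: "i \<le> i0" "R \<in> DL i" "strip L \<subseteq> strip R"
    note C = cyl_facts[OF adm_DL[OF R(2)]]
    have h: "B < log_height R" using i0(2)[OF R] .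
    have "K / (2 * v) < log_height R" using h by (simp add: B_def)
    then have "K < v * (2 * log_height R)" using v(2) by (simp add: pos_divide_less_eq mult_ac)
    moreover have "0 < v * (2 * log_height R)" using v(2) C(6) by simp
    ultimately have "ennreal K < ennreal (v * (2 * log_height R))" by (simp add: ennreal_lessI)
    also have "\<dots> = emeasure \<nu> (base L) * ennreal (2 * log_height R)"
      using v by (simp add: ennreal_mult')
    also have "\<dots> \<le> emeasure \<nu> (base R) * ennreal (2 * log_height R)"
    proof (intro mult_right_mono emeasure_mono)
      show "base L \<subseteq> base R" using base_mono[OF adm_DL[OF assms] R(3)] .
      show "base R \<in> sets \<nu>" using C(5) borel_Q by auto
    qed simp
    also have "\<dots> = emeasure \<mu> (cyl R)" by (rule C(4)[symmetric])
    finally show "ennreal K < emeasure \<mu> (cyl R)" .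
  qed (rule i0(1))
qed

lemma cyl_subset_iff: "adm L \<Longrightarrow> adm R \<Longrightarrow> cyl L \<subseteq> cyl R \<longleftrightarrow> strip L \<subseteq> strip R"
  by (simp add: cyl_facts(1) \<Psi>_subset_iff)

lemma exists_cylinder: "\<exists>L. L \<in> DL 0"
proof -
  have "P 0 \<in> Smain 0" using large_P[of 0] unfolding P_eq[of 0] by (auto simp: Smain_iff)
  from Smain_DL[OF this] show ?thesis unfolding of_nat_0 minus_zero by (rule exI)
qed

text \<open>Ancestors of a single cylinder already have arbitrarily large measure.\<close>

lemma infinite_\<mu>: "emeasure \<mu> (space \<mu>) = \<infinity>"
proof (rule ccontr)
  assume "\<not> ?thesis"
  then have fin: "emeasure \<mu> (space \<mu>) = ennreal (enn2real (emeasure \<mu> (space \<mu>)))" by (simp add: less_top)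
  obtain L where L: "L \<in> DL 0" using exists_cylinder by blast
  obtain i0 where i0: "i0 \<le> 0" "\<And>i R. i \<le> i0 \<Longrightarrow> R \<in> DL i \<Longrightarrow> strip L \<subseteq> strip R \<Longrightarrow>
      ennreal (enn2real (emeasure \<mu> (space \<mu>))) < emeasure \<mu> (cyl R)"
    using large_ancestors[OF L] by meson
  obtain R where R: "R \<in> DL i0" "strip L \<subseteq> strip R" using ancestor_DL[OF i0(1) L] by blast
  have "emeasure \<mu> (cyl R) \<le> emeasure \<mu> (space \<mu>)" by (rule emeasure_space)
  then show False using i0(2)[OF _ R] fin by simp
qed

theorem CZP_D_family: "CZP_wrt (d_Z N Z) \<mu> (D_family N Z Q \<delta> \<gamma> \<Lambda> P0)"
proof -
  obtain B where B: "0 \<le> B" "\<And>r k E a. adm (r, k, E, a) \<Longrightarrow>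
     outer_measure_of \<mu> (enlarge (d_Z N Z) (space \<mu>) (cyl (r, k, E, a)) (ln r / 2))
       \<le> ennreal B * emeasure \<mu> (cyl (r, k, E, a))"
    using enlarge_measure by blast
  define C where "C = max C_parent (max C_ball B)"
  have C: "C_parent \<le> C" "C_ball \<le> C" "B \<le> C" "3 \<le> C" by (auto simp: C_def C_parent_def)
  interpret dyadic_system "d_Z N Z" \<mu> D_sets C
  proof
    show "emeasure \<mu> (space \<mu>) = \<infinity>" by (rule infinite_\<mu>)
    show "countable (\<Union>j. D_sets j)" unfolding D_sets_def by (intro countable_UN countable_image countable_DL) auto
    show "1 \<le> C" using C(4) by simp
    show "S \<in> sets \<mu>" if "S \<in> D_sets j" for S j
      using that cyl_facts(2) by (elim D_sets_cases) auto
    show "0 < emeasure \<mu> S" "emeasure \<mu> S < \<infinity>" if S: "S \<in> D_sets j" for S j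
    proof -
      obtain L where L: "adm L" "S = cyl L" using S by (elim D_sets_cases)
      note f = cyl_facts[OF L(1)]
      obtain k where "base L \<in> Q k" using f(5) by blast
      from measure_Q[OF this] f(6) show "0 < emeasure \<mu> S" "emeasure \<mu> S < \<infinity>"
        unfolding L(2) f(4) by (auto simp: ennreal_zero_less_mult_iff ennreal_mult_less_top)
    qed
    show "disjoint (D_sets j)" for j
      unfolding disjoint_def
    proof (intro ballI impI)
      fix S S' assume "S \<in> D_sets j" "S' \<in> D_sets j" "S \<noteq> S'"
      then obtain L L' where L: "L \<in> DL j" "L' \<in> DL j" "adm L" "adm L'" "S = cyl L" "S' = cyl L'" "L \<noteq> L'"
        by (metis D_sets_cases)
      have "strip L \<inter> strip L' = {}" using DL_disjoint[OF L(1,2,7)] .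
      then have "\<Psi> ` strip L \<inter> \<Psi> ` strip L' = {}" by (metis image_Int[OF inj_\<Psi>] image_empty)
      then show "S \<inter> S' = {}" using L(5,6) cyl_facts(1)[OF L(3)] cyl_facts(1)[OF L(4)] by simp
    qed
    show "\<exists>R\<in>D_sets j. S \<subseteq> R \<and> emeasure \<mu> R \<le> ennreal C * emeasure \<mu> S" if S: "S \<in> D_sets (j + 1)" for S j
    proof -
      obtain L where L: "L \<in> DL (j + 1)" "adm L" "S = cyl L" using S by (elim D_sets_cases)
      obtain R where R: "R \<in> DL j" "child L R" using child_DL[OF L(1)] by blast
      have admR: "adm R" using adm_DL[OF R(1)] .
      have "emeasure \<mu> (cyl R) \<le> ennreal C_parent * emeasure \<mu> S"
        using child_measure[OF L(2) admR R(2)] L(3) by simp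
      also have "\<dots> \<le> ennreal C * emeasure \<mu> S" using C(1) by (intro mult_right_mono ennreal_leI) auto
      finally have "emeasure \<mu> (cyl R) \<le> ennreal C * emeasure \<mu> S" .
      moreover have "S \<subseteq> cyl R"
        using R(2) cyl_subset_iff[OF L(2) admR] L(3) unfolding child_def by blast
      ultimately show ?thesis using R(1) by (intro bexI[of _ "cyl R"]) (auto simp: D_sets_def)
    qed
    show "\<exists>i0\<le>j. \<forall>i\<le>i0. \<forall>R\<in>D_sets i. S \<subseteq> R \<longrightarrow> ennreal K < emeasure \<mu> R" if S: "S \<in> D_sets j" for S j K
    proof -
      obtain L where L: "L \<in> DL j" "adm L" "S = cyl L" using S by (elim D_sets_cases)
      obtain i0 where i0: "i0 \<le> j" "\<And>i R. i \<le> i0 \<Longrightarrow> R \<in> DL i \<Longrightarrow> strip L \<subseteq> strip R \<Longrightarrow> ennreal K < emeasure \<mu> (cyl R)"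
        using large_ancestors[OF L(1), of K] by meson
      show ?thesis
      proof (intro exI[of _ i0] conjI allI impI ballI)
        fix i S' assume i: "i \<le> i0" and S': "S' \<in> D_sets i" "S \<subseteq> S'"
        obtain R where R: "R \<in> DL i" "adm R" "S' = cyl R" using S'(1) by (elim D_sets_cases)
        have "strip L \<subseteq> strip R" using S'(2) L(3) R(3) cyl_subset_iff[OF L(2) R(2)] by simp
        then show "ennreal K < emeasure \<mu> S'" using i0(2)[OF i R(1)] R(3) by simp
      qed (rule i0(1))
    qed
    show "AE x in \<mu>. \<exists>S\<in>D_sets 0. x \<in> S"
      using AE_good
    proof eventually_elim
      case (elim x)
      then obtain n b where x: "x = \<Psi> (n, b)" "\<And>k. n \<in> \<Union>(Q k)" "0 < b" "b \<notin> critical_heights" by blast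
      obtain L where L: "L \<in> DL 0" "(n, b) \<in> strip L" using cover_DL_0[OF x(2-4)] by blast
      have "x \<in> cyl L" using cyl_facts(1)[OF adm_DL[OF L(1)]] L(2) x(1) by blast
      then show ?case using L(1) by (auto simp: D_sets_def)
    qed
    show "\<exists>U\<in>sets \<mu>. emeasure \<mu> U \<le> emeasure \<mu> A + ennreal \<eta> \<and>
        (AE x in \<mu>. x \<in> A \<longrightarrow> (\<exists>j. \<exists>S'\<in>D_sets j. x \<in> S' \<and> S' \<subseteq> U))"
      if S: "S \<in> D_sets 0" and A: "A \<in> sets \<mu>" "A \<subseteq> S" and \<eta>: "0 < \<eta>" for S A \<eta>
    proof -
      obtain L where L: "adm L" "S = cyl L" using S by (elim D_sets_cases)
      note f = cyl_facts[OF L(1), folded L(2)]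
      obtain k where "base L \<in> Q k" using f(5) by blast
      then have "emeasure \<mu> S < \<infinity>" using measure_Q[of "base L" k] unfolding f(4) by (auto simp: ennreal_mult_less_top)
      then obtain O' where O': "open O'" "A \<subseteq> O'" "emeasure \<mu> (O' \<inter> S) \<le> emeasure \<mu> A + ennreal \<eta>"
        using outer_approximation[OF f(2) _ A \<eta>] by blast
      \<comment> \<open>Intersecting with \<open>S\<close> keeps the set open, so fine cylinders fit
        inside, while it is only the part of \<open>O'\<close> in \<open>S\<close> whose measure is
        controlled.\<close>
      have op: "open (O' \<inter> S)" using O'(1) f(3) by (rule open_Int)
      have "O' \<inter> S \<in> sets \<mu>"
        using op f(2) by (auto simp: sets_\<mu>_iff)
      moreover have "AE x in \<mu>. x \<in> A \<longrightarrow> (\<exists>j. \<exists>S'\<in>D_sets j. x \<in> S' \<and> S' \<subseteq> O' \<inter> S)"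
        using AE_good
      proof eventually_elim
        case (elim x)
        then obtain n b where x: "x = \<Psi> (n, b)" "\<And>k. n \<in> \<Union>(Q k)" "0 < b" "b \<notin> critical_heights" by blast
        show ?case
        proof
          assume "x \<in> A"
          then have "\<Psi> (n, b) \<in> O' \<inter> S" using O'(2) A(2) x(1) by blast
          from small_cylinder[OF op this x(2-4)] show "\<exists>j. \<exists>S'\<in>D_sets j. x \<in> S' \<and> S' \<subseteq> O' \<inter> S"
            unfolding x(1) .
        qed
      qed
      ultimately show ?thesis using O'(3) by (intro bexI[of _ "O' \<inter> S"]) auto
    qed
    show "\<exists>r>0. \<exists>x\<in>space \<mu>. S \<subseteq> dball (d_Z N Z) (space \<mu>) x (C * r) \<and>
        outer_measure_of \<mu> (enlarge (d_Z N Z) (space \<mu>) S r) \<le> ennreal C * emeasure \<mu> S" if S: "S \<in> D_sets j" for S j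
    proof -
      obtain L where L: "adm L" "S = cyl L" using S by (elim D_sets_cases)
      obtain r k E a where L_eq: "L = (r, k, E, a)" by (cases L)
      note adm = L(1)[unfolded L_eq]
      have E: "E \<in> Q k" "0 < a" "1 < r" using admD[OF adm] by auto
      obtain x where "x \<in> E" "ball_N x (c * \<delta> powi k) \<subseteq> E" and x: "E \<subseteq> ball_N x (C1 * \<delta> powi k)" by (rule cube_center[OF E(1)])
      have lnr: "0 < ln r / 2" using E by simp
      have "C_ball * (ln r / 2) \<le> C * (ln r / 2)" using C(2) lnr by (intro mult_right_mono) auto
      from order_trans[OF cyl_subset_ball[OF adm x] dball_mono[OF this]]
      have "S \<subseteq> dball (d_Z N Z) (space \<mu>) (\<Psi> (x, a)) (C * (ln r / 2))" by (simp only: L(2) L_eq)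
      moreover have "outer_measure_of \<mu> (enlarge (d_Z N Z) (space \<mu>) S (ln r / 2)) \<le> ennreal C * emeasure \<mu> S"
      proof -
        have "outer_measure_of \<mu> (enlarge (d_Z N Z) (space \<mu>) S (ln r / 2)) \<le> ennreal B * emeasure \<mu> S"
          using B(2)[OF adm] by (simp only: L(2) L_eq)
        also have "\<dots> \<le> ennreal C * emeasure \<mu> S" using C(3) by (intro mult_right_mono ennreal_leI) auto
        finally show ?thesis .
      qed
      moreover have "\<Psi> (x, a) \<in> space \<mu>" using E(2) by (simp add: space_\<mu>)
      ultimately show ?thesis using lnr by blast
    qed
  qed
  have "D_family N Z Q \<delta> \<gamma> \<Lambda> P0 = (\<Union>j. D_sets j)" by (simp add: D_family_def D_sets_def)
  then show ?thesis using CZP_wrt_dyadic by simp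
qed

end

theorem theorem1p2:
  fixes N :: "('a::{second_countable_topology, t2_space}, real ^ 'n::{finite, wellorder}) strat"
    and Z :: "(real ^ 'n::{finite, wellorder}) \<times> real"
    and \<mu> :: "('a \<times> real) measure" and \<phi> :: "'a \<times> real \<Rightarrow> real"
    and Q :: "int \<Rightarrow> 'a set set" and \<delta> C1 c \<gamma> \<Lambda> r0 :: real
    and k0 :: int and Q0 :: "'a set"
  assumes "stratified_group N"
    and "Z \<in> Z_set N"
    and "doubling_flow_measure N Z \<mu> \<phi>"
    and "christ_decomposition (d_N N) (slice_measure N \<phi>) Q \<delta> C1 c"
    and "3 \<le> C1"
    and "\<And>k E. E \<in> Q k \<Longrightarrow> 2 \<le> card (cube_sons Q k E)"
    and "5 \<le> \<gamma>"
    and "exp 3 / \<delta> < \<Lambda>"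
    and "large_admissible Q \<delta> \<gamma> \<Lambda> (r0, k0, Q0, 1)"
  shows "CZP_wrt (d_Z N Z) \<mu> (D_family N Z Q \<delta> \<gamma> \<Lambda> (r0, k0, Q0, 1))"
proof -
  interpret christ_setting N Z \<mu> \<phi> Q \<delta> C1 c \<gamma> \<Lambda> r0 k0 Q0
    using assms by unfold_locales (auto simp: doubling_flow_measure_def)
  show ?thesis by (rule CZP_D_family)
qed

end
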